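(* Let $k$ be an algebraically closed field and $\phi:\mathbf Z[q_*]\to k$ a ring homomorphism. Then every simple left $H_\phi$-module that is finite-dimensional over $k$ is a quotient of a standard $H_\phi$-module, i.e. of $I(\chi)=H\otimes_{A\cap H,\chi}k$ for some ring homomorphism $\chi:A\cap H\to k$ extending $\phi$.
   Context: Root datum. $(X,X^\vee,R,R^\vee,B)$ is a reduced based root datum: $X,X^\vee$ are free abelian groups of finite rank $\ge 1$ in perfect duality $(\ ,\ ):X\times X^\vee\to\mathbf Z$; $R\subset X$, $R^\vee\subset X^\vee$ are finite nonempty sets of roots and coroots in bijection $\alpha\leftrightarrow\alpha^\vee$ with $(\alpha,\alpha^\vee)=2$; the reflections $s_\alpha(x)=x-(x,\alpha^\vee)\alpha$ preserve $R$ and the dual reflections preserve $R^\vee$; $R$ is reduced; $B$ is a basis of $R$, defining positive roots $R^+$ and negative roots $R^-$. $x\in X$ is dominant if $(x,\beta^\vee)\ge 0$ for all $\beta\in B$. Weyl groups. $W_o\subset GL(X)$ is the finite group generated by the $s_\alpha$, $\alpha\in R$. $W=W_o\ltimes X$; $x\in X$ is written $e^x$ in $W$, so $w_oe^xw_o^{-1}=e^{w_o(x)}$. $W_{aff}=W_o\ltimes Q(R)$, with $Q(R)\subset X$ the subgroup generated by $R$. $R_m$ is the set of roots $\alpha$ whose coroot $\alpha^\vee$ is minimal in $R^\vee$ for the order: $\alpha_1^\vee\preceq\alpha_2^\vee$ iff $\alpha_2^\vee-\alpha_1^\vee\in\sum_{\beta\in B}\mathbf N\beta^\vee$. With $S=\{s_\beta:\beta\in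 B\}\cup\{s_\alpha e^{\alpha}:\alpha\in R_m\}$, $(W_{aff},S)$ is a Coxeter system. The length on $W$, extending that of $(W_{aff},S)$, is $\ell(w_oe^x)=\sum_{\alpha\in R^+,w_o(\alpha)\in R^+}|(x,\alpha^\vee)|+\sum_{\alpha\in R^+,w_o(\alpha)\in R^-}|1+(x,\alpha^\vee)|$. $\Omega$ is the subgroup of elements of length $0$; it normalizes $S$ and $W=\Omega W_{aff}$ (semi-direct product). Generic weights. $(q_s)_{s\in S}$ are indeterminates with $q_s=q_{s'}$ iff $s,s'$ are conjugate in $W$ (independent otherwise); $\mathbf Z[q_*]$ is the polynomial ring they generate. For $w=us_1\cdots s_n$ with $u\in\Omega$ and $s_1\cdots s_n$ a reduced expression in $W_{aff}$, $q_w=q_{s_1}\cdots q_{s_n}$. One also adjoins indeterminates $q_s^{1/2}$ with squares $q_s$ (equal for conjugate $s$), and $q_w^{1/2}$ is the corresponding monomial. Hecke algebra. $H$ is the $\mathbf Z[q_*]$-algebra, free as a module with basis $(T_w)_{w\in W}$, with $(T_s+1)(T_s-q_s)=0$ for $s\in S$ and $T_{ww'}=T_wT_{w'}$ if $\ell(ww')=\ell(w)+\ell(w')$. $H[q_*^{-1/2}]=H\otimes_{\mathbf Z[q_*]}\mathbf Z[q_*^{\pm1/2}]$; in it the $T_w$ are invertible, and $\tilde T_w:=q_w^{-1/2}T_w$. For $x\in X$, $\tilde\theta_x:=\tilde T_{e^y}\tilde T_{e^z}^{-1}$, where $x=y-z$ with $y,z$ dominant (independent of the choice). $A$ is the commutative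 subalgebra of $H[q_*^{-1/2}]$ spanned over $\mathbf Z[q_*^{\pm1/2}]$ by the $\tilde\theta_x$, $x\in X$. Specialization. $H_\phi=H\otimes_{\mathbf Z[q_*],\phi}k$. For a ring homomorphism $\chi:A\cap H\to k$ extending $\phi$, the (left) standard $H_\phi$-module is $I(\chi)=H\otimes_{A\cap H,\chi}k$, where $H$ is viewed as a right $A\cap H$-module and $k$ as an $A\cap H$-module via $\chi$. *)

theory Defs
  imports
    "HOL-Algebra.Algebra"
    "HOL-Algebra.Algebraic_Closure_Type"
    "HOL-Library.Poly_Mapping"
begin

section \<open>Based root data\<close>

definition zmul :: "int \<Rightarrow> 'a::ab_group_add \<Rightarrow> 'a" where
  "zmul n x = (\<Sum>i<nat n. x) - (\<Sum>i<nat (- n). x)"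

definition is_Z_basis :: "'a::ab_group_add set \<Rightarrow> bool" where
  "is_Z_basis E \<longleftrightarrow> finite E \<and>
     (\<forall>x. \<exists>!c. (\<forall>e. e \<notin> E \<longrightarrow> c e = 0) \<and> x = (\<Sum>e\<in>E. zmul (c e) e))"

definition nat_span :: "'i set \<Rightarrow> ('i \<Rightarrow> 'a::ab_group_add) \<Rightarrow> 'a set" where
  "nat_span I v = {\<Sum>i\<in>I. zmul (int (c i)) (v i) | c. True}"

text \<open>The groups \<open>X\<close> and its dual are the whole types \<open>'x\<close> and \<open>'y\<close>. The field \<open>coroot\<close> is only
  meaningful on \<open>roots\<close>, and the set of coroots is its image.\<close>

record ('x, 'y) root_data =
  pairing :: "'x \<Rightarrow> 'y \<Rightarrow> int"
  roots :: "'x set"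
  coroot :: "'x \<Rightarrow> 'y"
  simples :: "'x set"

definition coroots :: "('x, 'y) root_data \<Rightarrow> 'y set" where
  "coroots D = coroot D ` roots D"

definition reflection :: "('x::ab_group_add, 'y) root_data \<Rightarrow> 'x \<Rightarrow> 'x \<Rightarrow> 'x" where
  "reflection D \<alpha> x = x - zmul (pairing D x (coroot D \<alpha>)) \<alpha>"

definition coreflection :: "('x, 'y::ab_group_add) root_data \<Rightarrow> 'x \<Rightarrow> 'y \<Rightarrow> 'y" where
  "coreflection D \<alpha> y = y - zmul (pairing D \<alpha> y) (coroot D \<alpha>)"

definition perfect_pairing :: "('x::ab_group_add \<Rightarrow> 'y::ab_group_add \<Rightarrow> int) \<Rightarrow> bool" where
  "perfect_pairing p \<longleftrightarrow>
     (\<forall>y. additive (\<lambda>x. p x y)) \<and> (\<forall>x. additive (p x)) \<and>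
     (\<forall>f. additive f \<longrightarrow> (\<exists>!y. \<forall>x. f x = p x y)) \<and>
     (\<forall>g. additive g \<longrightarrow> (\<exists>!x. \<forall>y. g y = p x y))"

definition positive_roots :: "('x::ab_group_add, 'y) root_data \<Rightarrow> 'x set" where
  "positive_roots D = {\<alpha> \<in> roots D. \<alpha> \<in> nat_span (simples D) (\<lambda>\<beta>. \<beta>)}"

definition negative_roots :: "('x::ab_group_add, 'y) root_data \<Rightarrow> 'x set" where
  "negative_roots D = {\<alpha> \<in> roots D. - \<alpha> \<in> nat_span (simples D) (\<lambda>\<beta>. \<beta>)}"

definition reduced_based_root_datum ::
    "('x::ab_group_add, 'y::ab_group_add) root_data \<Rightarrow> bool" where
  "reduced_based_root_datum D \<longleftrightarrow>
     (\<exists>E::'x set. is_Z_basis E \<and> E \<noteq> {}) \<and>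
     (\<exists>E::'y set. is_Z_basis E \<and> E \<noteq> {}) \<and>
     perfect_pairing (pairing D) \<and>
     finite (roots D) \<and> roots D \<noteq> {} \<and> inj_on (coroot D) (roots D) \<and>
     (\<forall>\<alpha>\<in>roots D. pairing D \<alpha> (coroot D \<alpha>) = 2) \<and>
     (\<forall>\<alpha>\<in>roots D. reflection D \<alpha> ` roots D \<subseteq> roots D) \<and>
     (\<forall>\<alpha>\<in>roots D. coreflection D \<alpha> ` coroots D \<subseteq> coroots D) \<and>
     \<comment> \<open>reduced: the only roots proportional to \<open>\<alpha>\<close> are \<open>\<alpha>\<close> and \<open>- \<alpha>\<close>\<close>
     (\<forall>\<alpha>\<in>roots D. \<forall>\<beta>\<in>roots D. \<forall>m n.
        n \<noteq> 0 \<and> zmul n \<beta> = zmul m \<alpha> \<longrightarrow> \<beta> = \<alpha> \<or> \<beta> = - \<alpha>) \<and>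
     \<comment> \<open>\<open>simples D\<close> is a basis of the root system\<close>
     simples D \<subseteq> roots D \<and>
     (\<forall>c. (\<Sum>\<beta>\<in>simples D. zmul (c \<beta>) \<beta>) = 0 \<longrightarrow> (\<forall>\<beta>\<in>simples D. c \<beta> = 0)) \<and>
     roots D = positive_roots D \<union> negative_roots D"

definition dominant :: "('x, 'y) root_data \<Rightarrow> 'x \<Rightarrow> bool" where
  "dominant D x \<longleftrightarrow> (\<forall>\<beta>\<in>simples D. pairing D x (coroot D \<beta>) \<ge> 0)"


section \<open>Weyl groups\<close>

definition linear_group :: "('x::ab_group_add \<Rightarrow> 'x) monoid" where
  "linear_group = \<lparr>carrier = {g. bij g \<and> additive g}, monoid.mult = (\<circ>), one = id\<rparr>"

definition finite_weyl :: "('x::ab_group_add, 'y) root_data \<Rightarrow> ('x \<Rightarrow> 'x) set" where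
  "finite_weyl D = generate linear_group (reflection D ` roots D)"

text \<open>The pair \<open>(g, x)\<close> stands for the element written as the product of \<open>g\<close> and the translation
  \<open>e\<^sup>x\<close>, in this order. The product follows from
  \<open>e\<^sup>x h = h e\<^sup>z\<close>, where \<open>z\<close> is the image of \<open>x\<close> under the inverse of \<open>h\<close>.\<close>

type_synonym 'x weyl_elt = "('x \<Rightarrow> 'x) \<times> 'x"

definition ext_weyl :: "('x::ab_group_add, 'y) root_data \<Rightarrow> 'x weyl_elt monoid" where
  "ext_weyl D =
     \<lparr>carrier = finite_weyl D \<times> UNIV,
      monoid.mult = (\<lambda>(g, x) (h, y). (g \<circ> h, inv_into UNIV h x + y)),
      one = (id, 0)\<rparr>"

definition translation :: "'x \<Rightarrow> 'x weyl_elt" where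
  "translation x = (id, x)"

definition len :: "('x::ab_group_add, 'y) root_data \<Rightarrow> 'x weyl_elt \<Rightarrow> nat" where
  "len D w = (case w of (g, x) \<Rightarrow>
     (\<Sum>\<alpha> | \<alpha> \<in> positive_roots D \<and> g \<alpha> \<in> positive_roots D. nat \<bar>pairing D x (coroot D \<alpha>)\<bar>) +
     (\<Sum>\<alpha> | \<alpha> \<in> positive_roots D \<and> g \<alpha> \<in> negative_roots D. nat \<bar>1 + pairing D x (coroot D \<alpha>)\<bar>))"

definition coroot_le :: "('x, 'y::ab_group_add) root_data \<Rightarrow> 'y \<Rightarrow> 'y \<Rightarrow> bool" where
  "coroot_le D a b \<longleftrightarrow> b - a \<in> nat_span (simples D) (coroot D)"

definition minimal_coroot_roots :: "('x, 'y::ab_group_add) root_data \<Rightarrow> 'x set" where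
  "minimal_coroot_roots D =
     {\<alpha> \<in> roots D. \<forall>b\<in>coroots D. coroot_le D b (coroot D \<alpha>) \<longrightarrow> b = coroot D \<alpha>}"

definition simple_reflections :: "('x::ab_group_add, 'y::ab_group_add) root_data \<Rightarrow> 'x weyl_elt set" where
  "simple_reflections D =
     {(reflection D \<beta>, 0) | \<beta>. \<beta> \<in> simples D} \<union>
     {(reflection D \<alpha>, \<alpha>) | \<alpha>. \<alpha> \<in> minimal_coroot_roots D}"

definition Omega :: "('x::ab_group_add, 'y) root_data \<Rightarrow> 'x weyl_elt set" where
  "Omega D = {w \<in> carrier (ext_weyl D). len D w = 0}"

definition word_prod :: "('x::ab_group_add, 'y) root_data \<Rightarrow> 'x weyl_elt list \<Rightarrow> 'x weyl_elt" where
  "word_prod D ss = foldr (monoid.mult (ext_weyl D)) ss (one (ext_weyl D))"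

definition reduced_word ::
    "('x::ab_group_add, 'y::ab_group_add) root_data \<Rightarrow> 'x weyl_elt list \<Rightarrow> bool" where
  "reduced_word D ss \<longleftrightarrow> set ss \<subseteq> simple_reflections D \<and>
     (\<forall>ts. set ts \<subseteq> simple_reflections D \<and> word_prod D ts = word_prod D ss
        \<longrightarrow> length ss \<le> length ts)"


section \<open>Generic weights\<close>

text \<open>The indeterminates \<open>v = q\<^sup>1\<^sup>/\<^sup>2\<close> are indexed by the conjugacy classes, in the extended group, of
  elements of \<open>S\<close>, so that conjugate reflections share one. Every coefficient ring is a set of
  Laurent polynomials in the \<open>v\<close>: a monomial is an integer exponent vector
  \<open>'x weyl_elt set \<Rightarrow>\<^sub>0 int\<close>.\<close>

type_synonym 'x exponent = "'x weyl_elt set \<Rightarrow>\<^sub>0 int"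
type_synonym 'x laurent = "'x exponent \<Rightarrow>\<^sub>0 int"

definition conj_class :: "('x::ab_group_add, 'y) root_data \<Rightarrow> 'x weyl_elt \<Rightarrow> 'x weyl_elt set" where
  "conj_class D s =
     {w \<otimes>\<^bsub>ext_weyl D\<^esub> s \<otimes>\<^bsub>ext_weyl D\<^esub> inv\<^bsub>ext_weyl D\<^esub> w | w. w \<in> carrier (ext_weyl D)}"

definition monomial :: "'x exponent \<Rightarrow> 'x laurent" where
  "monomial e = Poly_Mapping.single e 1"

text \<open>\<open>half_weight_ring\<close> is generated by all \<open>v\<close> and their inverses, and \<open>weight_ring\<close> is its subring of
  polynomials in the \<open>q = v\<^sup>2\<close> (even nonnegative exponents).\<close>

definition half_weight_ring :: "('x::ab_group_add, 'y::ab_group_add) root_data \<Rightarrow> 'x laurent set" where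
  "half_weight_ring D =
     {p. \<forall>e\<in>Poly_Mapping.keys p. Poly_Mapping.keys e \<subseteq> conj_class D ` simple_reflections D}"

definition weight_ring :: "('x::ab_group_add, 'y::ab_group_add) root_data \<Rightarrow> 'x laurent set" where
  "weight_ring D =
     {p \<in> half_weight_ring D. \<forall>e\<in>Poly_Mapping.keys p. \<forall>c.
        Poly_Mapping.lookup e c \<ge> 0 \<and> even (Poly_Mapping.lookup e c)}"

definition q_gen :: "('x::ab_group_add, 'y) root_data \<Rightarrow> 'x weyl_elt \<Rightarrow> 'x laurent" where
  "q_gen D s = monomial (Poly_Mapping.single (conj_class D s) 2)"

text \<open>\<open>q_exponent D w\<close> is the exponent of \<open>q\<^sub>w\<^sup>1\<^sup>/\<^sup>2\<close> as a monomial in the \<open>v\<close>. By Matsumoto's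
  theorem it does not depend on the chosen reduced expression.\<close>

definition q_exponent ::
    "('x::ab_group_add, 'y::ab_group_add) root_data \<Rightarrow> 'x weyl_elt \<Rightarrow> 'x exponent" where
  "q_exponent D w =
     (let (u, ss) = (SOME (u, ss). u \<in> Omega D \<and> reduced_word D ss \<and>
                       w = u \<otimes>\<^bsub>ext_weyl D\<^esub> word_prod D ss)
      in \<Sum>s\<leftarrow>ss. Poly_Mapping.single (conj_class D s) 1)"


section \<open>The generic Hecke algebra\<close>

definition scale :: "'r::mult_zero \<Rightarrow> ('a \<Rightarrow>\<^sub>0 'r) \<Rightarrow> ('a \<Rightarrow>\<^sub>0 'r)" where
  "scale a f = Poly_Mapping.map ((*) a) f"

text \<open>The bilinear map between free modules that takes the prescribed values on pairs of basis
  elements.\<close>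

definition bilinear_ext ::
    "('a \<Rightarrow> 'b \<Rightarrow> ('c \<Rightarrow>\<^sub>0 'r::comm_ring_1)) \<Rightarrow> ('a \<Rightarrow>\<^sub>0 'r) \<Rightarrow> ('b \<Rightarrow>\<^sub>0 'r) \<Rightarrow> ('c \<Rightarrow>\<^sub>0 'r)" where
  "bilinear_ext t f g =
     (\<Sum>a\<in>Poly_Mapping.keys f. \<Sum>b\<in>Poly_Mapping.keys g.
        scale (Poly_Mapping.lookup f a * Poly_Mapping.lookup g b) (t a b))"

type_synonym 'x hecke_elt = "'x weyl_elt \<Rightarrow>\<^sub>0 'x laurent"

definition T_elt :: "'x weyl_elt \<Rightarrow> 'x hecke_elt" where
  "T_elt w = Poly_Mapping.single w 1"

text \<open>An algebra that is free with basis \<open>T_elt\<close> is determined by the table \<open>t\<close> of the products of basis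
  elements. \<open>hecke_over D t C\<close> is the free module with coefficients in \<open>C\<close>, with this
  multiplication; enlarging \<open>C\<close> is extension of scalars.\<close>

type_synonym 'x hecke_table = "'x weyl_elt \<Rightarrow> 'x weyl_elt \<Rightarrow> 'x hecke_elt"

definition hecke_over ::
    "('x::ab_group_add, 'y) root_data \<Rightarrow> 'x hecke_table \<Rightarrow> 'x laurent set \<Rightarrow> 'x hecke_elt ring" where
  "hecke_over D t C =
     \<lparr>carrier = {f. Poly_Mapping.keys f \<subseteq> carrier (ext_weyl D) \<and> (\<forall>w. Poly_Mapping.lookup f w \<in> C)},
      monoid.mult = bilinear_ext t, one = T_elt \<one>\<^bsub>ext_weyl D\<^esub>, ring.zero = 0, add = (+)\<rparr>"

definition hecke ::
    "('x::ab_group_add, 'y::ab_group_add) root_data \<Rightarrow> 'x hecke_table \<Rightarrow> 'x hecke_elt ring" where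
  "hecke D t = hecke_over D t (weight_ring D)"

definition half_hecke ::
    "('x::ab_group_add, 'y::ab_group_add) root_data \<Rightarrow> 'x hecke_table \<Rightarrow> 'x hecke_elt ring" where
  "half_hecke D t = hecke_over D t (half_weight_ring D)"

text \<open>\<open>t\<close> is the multiplication table of the generic Hecke algebra. The relations determine \<open>t\<close> on the
  extended affine Weyl group.\<close>

definition is_hecke_table ::
    "('x::ab_group_add, 'y::ab_group_add) root_data \<Rightarrow> 'x hecke_table \<Rightarrow> bool" where
  "is_hecke_table D t \<longleftrightarrow>
     ring (hecke D t) \<and>
     (\<forall>s\<in>simple_reflections D.
        (T_elt s + \<one>\<^bsub>hecke D t\<^esub>) \<otimes>\<^bsub>hecke D t\<^esub> (T_elt s - scale (q_gen D s) \<one>\<^bsub>hecke D t\<^esub>) = 0) \<and>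
     (\<forall>w\<in>carrier (ext_weyl D). \<forall>w'\<in>carrier (ext_weyl D).
        len D (w \<otimes>\<^bsub>ext_weyl D\<^esub> w') = len D w + len D w' \<longrightarrow>
        T_elt (w \<otimes>\<^bsub>ext_weyl D\<^esub> w') = T_elt w \<otimes>\<^bsub>hecke D t\<^esub> T_elt w')"

definition T_tilde ::
    "('x::ab_group_add, 'y::ab_group_add) root_data \<Rightarrow> 'x weyl_elt \<Rightarrow> 'x hecke_elt" where
  "T_tilde D w = scale (monomial (- q_exponent D w)) (T_elt w)"

definition theta_tilde ::
    "('x::ab_group_add, 'y::ab_group_add) root_data \<Rightarrow> 'x hecke_table \<Rightarrow> 'x \<Rightarrow> 'x hecke_elt" where
  "theta_tilde D t x =
     (let (y, z) = (SOME (y, z). dominant D y \<and> dominant D z \<and> x = y - z)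
      in T_tilde D (translation y) \<otimes>\<^bsub>half_hecke D t\<^esub>
           inv\<^bsub>half_hecke D t\<^esub> (T_tilde D (translation z)))"

definition bernstein_A ::
    "('x::ab_group_add, 'y::ab_group_add) root_data \<Rightarrow> 'x hecke_table \<Rightarrow> 'x hecke_elt set" where
  "bernstein_A D t =
     {\<Sum>x\<in>F. scale (a x) (theta_tilde D t x) | F a. finite F \<and> (\<forall>x\<in>F. a x \<in> half_weight_ring D)}"

definition A_cap_H ::
    "('x::ab_group_add, 'y::ab_group_add) root_data \<Rightarrow> 'x hecke_table \<Rightarrow> 'x hecke_elt set" where
  "A_cap_H D t = bernstein_A D t \<inter> carrier (hecke D t)"


section \<open>Left modules over a not necessarily commutative ring\<close>

locale left_module = R?: ring R + M?: abelian_group M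
  for R :: "('a, 'b) ring_scheme" (structure) and M :: "('a, 'm, 'c) module_scheme" (structure) +
  assumes smult_closed: "\<lbrakk>a \<in> carrier R; x \<in> carrier M\<rbrakk> \<Longrightarrow> a \<odot>\<^bsub>M\<^esub> x \<in> carrier M"
    and smult_l_distr: "\<lbrakk>a \<in> carrier R; b \<in> carrier R; x \<in> carrier M\<rbrakk> \<Longrightarrow>
      (a \<oplus> b) \<odot>\<^bsub>M\<^esub> x = a \<odot>\<^bsub>M\<^esub> x \<oplus>\<^bsub>M\<^esub> b \<odot>\<^bsub>M\<^esub> x"
    and smult_r_distr: "\<lbrakk>a \<in> carrier R; x \<in> carrier M; y \<in> carrier M\<rbrakk> \<Longrightarrow>
      a \<odot>\<^bsub>M\<^esub> (x \<oplus>\<^bsub>M\<^esub> y) = a \<odot>\<^bsub>M\<^esub> x \<oplus>\<^bsub>M\<^esub> a \<odot>\<^bsub>M\<^esub> y"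
    and smult_assoc: "\<lbrakk>a \<in> carrier R; b \<in> carrier R; x \<in> carrier M\<rbrakk> \<Longrightarrow>
      (a \<otimes> b) \<odot>\<^bsub>M\<^esub> x = a \<odot>\<^bsub>M\<^esub> (b \<odot>\<^bsub>M\<^esub> x)"
    and smult_one: "x \<in> carrier M \<Longrightarrow> \<one> \<odot>\<^bsub>M\<^esub> x = x"

definition simple_left_module ::
    "('a, 'b) ring_scheme \<Rightarrow> ('a, 'm, 'c) module_scheme \<Rightarrow> bool" where
  "simple_left_module R M \<longleftrightarrow>
     left_module R M \<and> carrier M \<noteq> {\<zero>\<^bsub>M\<^esub>} \<and>
     (\<forall>N. submodule N R M \<longrightarrow> N = {\<zero>\<^bsub>M\<^esub>} \<or> N = carrier M)"

definition left_module_hom ::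
    "('a, 'b) ring_scheme \<Rightarrow> ('a, 'm, 'c) module_scheme \<Rightarrow> ('a, 'n, 'd) module_scheme
       \<Rightarrow> ('m \<Rightarrow> 'n) set" where
  "left_module_hom R M N =
     {f \<in> carrier M \<rightarrow> carrier N.
        (\<forall>x\<in>carrier M. \<forall>y\<in>carrier M. f (x \<oplus>\<^bsub>M\<^esub> y) = f x \<oplus>\<^bsub>N\<^esub> f y) \<and>
        (\<forall>a\<in>carrier R. \<forall>x\<in>carrier M. f (a \<odot>\<^bsub>M\<^esub> x) = a \<odot>\<^bsub>N\<^esub> f x)}"

definition is_quotient_of ::
    "('a, 'b) ring_scheme \<Rightarrow> ('a, 'n, 'd) module_scheme \<Rightarrow> ('a, 'm, 'c) module_scheme \<Rightarrow> bool" where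
  "is_quotient_of R N M \<longleftrightarrow> (\<exists>f\<in>left_module_hom R M N. f ` carrier M = carrier N)"


section \<open>Specialization and standard modules\<close>

text \<open>Both specialization and induction are tensor products of \<open>H\<close> with \<open>k\<close>, constructed as quotients
  of the free abelian group on \<open>H \<times> k\<close>. That group is kept as the monoid ring of the multiplicative
  monoid \<open>H \<times> k\<close>, whose product induces all the products and actions below:
  \<open>(h \<otimes> a) (h' \<otimes> b) = h h' \<otimes> a b\<close>.\<close>

definition pair_ring ::
    "'h ring \<Rightarrow> (('h \<times> 'k::comm_ring_1) \<Rightarrow>\<^sub>0 int) ring" where
  "pair_ring H =
     \<lparr>carrier = {f. Poly_Mapping.keys f \<subseteq> carrier H \<times> UNIV},
      monoid.mult = bilinear_ext (\<lambda>(h, a) (h', b). frag_of (h \<otimes>\<^bsub>H\<^esub> h', a * b)),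
      one = frag_of (\<one>\<^bsub>H\<^esub>, 1), ring.zero = 0, add = (+)\<rparr>"

text \<open>The subgroup by which the free group on \<open>H \<times> k\<close> is divided to obtain \<open>H \<otimes>\<^bsub>B\<^esub> k\<close>,
  for a right action \<open>r\<close> of \<open>B\<close> on \<open>H\<close> and a left action \<open>l\<close> of \<open>B\<close> on \<open>k\<close>.\<close>

definition tensor_kernel ::
    "'h ring \<Rightarrow> 'b set \<Rightarrow> ('h \<Rightarrow> 'b \<Rightarrow> 'h) \<Rightarrow> ('b \<Rightarrow> 'k \<Rightarrow> 'k)
       \<Rightarrow> (('h \<times> 'k::comm_ring_1) \<Rightarrow>\<^sub>0 int) set" where
  "tensor_kernel H B r l =
     generate (add_monoid (pair_ring H))
       ({frag_of (h \<oplus>\<^bsub>H\<^esub> h', a) - frag_of (h, a) - frag_of (h', a) | h h' a.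
           h \<in> carrier H \<and> h' \<in> carrier H} \<union>
        {frag_of (h, a + a') - frag_of (h, a) - frag_of (h, a') | h a a'. h \<in> carrier H} \<union>
        {frag_of (r h b, a) - frag_of (h, l b a) | h b a. h \<in> carrier H \<and> b \<in> B})"

definition specialization_kernel ::
    "('x::ab_group_add, 'y::ab_group_add) root_data \<Rightarrow> 'x hecke_table
       \<Rightarrow> ('x laurent \<Rightarrow> 'k::comm_ring_1) \<Rightarrow> ('x hecke_elt \<times> 'k \<Rightarrow>\<^sub>0 int) set" where
  "specialization_kernel D t \<phi> =
     tensor_kernel (hecke D t) (weight_ring D) (\<lambda>h p. scale p h) (\<lambda>p a. \<phi> p * a)"

definition hecke_specialized ::
    "('x::ab_group_add, 'y::ab_group_add) root_data \<Rightarrow> 'x hecke_table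
       \<Rightarrow> ('x laurent \<Rightarrow> 'k::comm_ring_1) \<Rightarrow> ('x hecke_elt \<times> 'k \<Rightarrow>\<^sub>0 int) set ring" where
  "hecke_specialized D t \<phi> = pair_ring (hecke D t) Quot specialization_kernel D t \<phi>"

definition scalar ::
    "('x::ab_group_add, 'y::ab_group_add) root_data \<Rightarrow> 'x hecke_table
       \<Rightarrow> ('x laurent \<Rightarrow> 'k::comm_ring_1) \<Rightarrow> 'k \<Rightarrow> ('x hecke_elt \<times> 'k \<Rightarrow>\<^sub>0 int) set" where
  "scalar D t \<phi> a =
     specialization_kernel D t \<phi> +>\<^bsub>pair_ring (hecke D t)\<^esub> frag_of (\<one>\<^bsub>hecke D t\<^esub>, a)"

definition finite_dimensional ::
    "('x::ab_group_add, 'y::ab_group_add) root_data \<Rightarrow> 'x hecke_table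
       \<Rightarrow> ('x laurent \<Rightarrow> 'k::comm_ring_1)
       \<Rightarrow> (('x hecke_elt \<times> 'k \<Rightarrow>\<^sub>0 int) set, 'm) module \<Rightarrow> bool" where
  "finite_dimensional D t \<phi> M \<longleftrightarrow>
     (\<exists>F. finite F \<and> F \<subseteq> carrier M \<and>
        (\<forall>m\<in>carrier M. \<exists>c. m = (\<Oplus>\<^bsub>M\<^esub>v\<in>F. scalar D t \<phi> (c v) \<odot>\<^bsub>M\<^esub> v)))"

definition characters_extending ::
    "('x::ab_group_add, 'y::ab_group_add) root_data \<Rightarrow> 'x hecke_table
       \<Rightarrow> ('x laurent \<Rightarrow> 'k::comm_ring_1) \<Rightarrow> ('x hecke_elt \<Rightarrow> 'k) set" where
  "characters_extending D t \<phi> =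
     {\<chi> \<in> ring_hom (hecke D t\<lparr>carrier := A_cap_H D t\<rparr>) ring_of_type_algebra.
        \<forall>p\<in>weight_ring D. \<chi> (scale p \<one>\<^bsub>hecke D t\<^esub>) = \<phi> p}"

definition standard_kernel ::
    "('x::ab_group_add, 'y::ab_group_add) root_data \<Rightarrow> 'x hecke_table
       \<Rightarrow> ('x hecke_elt \<Rightarrow> 'k::comm_ring_1) \<Rightarrow> ('x hecke_elt \<times> 'k \<Rightarrow>\<^sub>0 int) set" where
  "standard_kernel D t \<chi> =
     tensor_kernel (hecke D t) (A_cap_H D t) (\<lambda>h b. h \<otimes>\<^bsub>hecke D t\<^esub> b) (\<lambda>b a. \<chi> b * a)"

text \<open>A class of \<open>H\<^sub>\<phi>\<close> acts on a class of the standard module by multiplying representatives. The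
  record fields \<open>mult\<close> and \<open>one\<close> play no role for modules.\<close>

definition standard_module ::
    "('x::ab_group_add, 'y::ab_group_add) root_data \<Rightarrow> 'x hecke_table
       \<Rightarrow> ('x hecke_elt \<Rightarrow> 'k::comm_ring_1)
       \<Rightarrow> (('x hecke_elt \<times> 'k \<Rightarrow>\<^sub>0 int) set, ('x hecke_elt \<times> 'k \<Rightarrow>\<^sub>0 int) set) module" where
  "standard_module D t \<chi> =
     \<lparr>carrier = a_rcosets\<^bsub>pair_ring (hecke D t)\<^esub> standard_kernel D t \<chi>,
      monoid.mult = undefined, one = undefined,
      ring.zero = standard_kernel D t \<chi>,
      add = set_add (pair_ring (hecke D t)),
      module.smult = rcoset_mult (pair_ring (hecke D t)) (standard_kernel D t \<chi>)\<rparr>"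

end

theory Submission
  imports Defs
begin

text \<open>
Let \<open>M\<close> be simple and finite-dimensional over \<open>k\<close>. If \<open>A \<inter> H\<close> is a commutative ring, its elements act on
\<open>M\<close> by commuting linear maps, so that they have a common eigenvector \<open>v \<noteq> 0\<close>, with eigenvalues given
by a character \<open>\<chi>\<close> of \<open>A \<inter> H\<close> that extends \<open>\<phi>\<close>. Then \<open>h \<otimes> a \<mapsto> h a v\<close> is a well-defined
homomorphism from the standard module of \<open>\<chi>\<close> to \<open>M\<close>, nonzero and hence onto, as \<open>M\<close> is simple
(lemmas \<open>J_kills\<close>, \<open>ev_hom\<close>, \<open>ev_surj\<close>).

Finite dimension enters through \<open>common_eigenvector\<close>: in an invariant subspace with a shortest possible
spanning list, an operator minus one of its eigenvalues has an image with a shorter list, which is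
therefore zero.

That \<open>A \<inter> H\<close> is a commutative ring rests on the invertibility of \<open>T\<close> at a dominant translation over Laurent
polynomials, on the additivity of the length on dominant translations, and on the fact that every element
of \<open>X\<close> is a difference of dominant ones. Then \<open>y - z \<mapsto> T\<^sub>y T\<^sub>z\<inverse>\<close> is a
homomorphism from \<open>X\<close> to the units, whose span is \<open>A\<close> (lemmas \<open>theta_add\<close>, \<open>A_commute\<close>). The normalizing
monomials \<open>q\<^sub>w\<^sup>1\<^sup>/\<^sup>2\<close> are units of the coefficient ring and do not affect the span.

Both the invertibility and the description of those monomials need that every element of \<open>W\<close> is a product of an
element of length zero and simple reflections, with lengths decreasing by one (lemma
\<open>exists_descent\<close>). The length is half the sum over the roots of the absolute values of an
integer cocycle, \<open>height\<close>. The cocycle of a simple reflection vanishes outside one root and its negative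
(lemmas \<open>wall_simple\<close>, \<open>wall_minimal\<close>), so the effect of such a factor on the length is explicit.
If no simple reflection shortens \<open>w\<close>, then the inverse of \<open>w\<close> maps a point of the fundamental alcove to a
point that satisfies the inequalities of that alcove, so that \<open>w\<close> has length zero.
\<close>

section \<open>Algebras given by a multiplication table\<close>

lemma lookup_scale [simp]: "Poly_Mapping.lookup (scale a f) x = a * Poly_Mapping.lookup f x"
  unfolding scale_def by (transfer) (auto simp: when_def)

lemma scale_zero_left [simp]: "scale 0 f = 0"
  by (rule poly_mapping_eqI) simp

lemma scale_zero_right [simp]: "scale a 0 = 0"
  by (rule poly_mapping_eqI) simp

lemma scale_one [simp]: "scale (1 :: 'r::comm_ring_1) f = f"
  by (rule poly_mapping_eqI) simp

lemma scale_add: "scale (a :: 'r::comm_ring_1) (f + g) = scale a f + scale a g"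
  by (rule poly_mapping_eqI) (simp add: lookup_add algebra_simps)

lemma scale_add_left: "scale (a + b :: 'r::comm_ring_1) f = scale a f + scale b f"
  by (rule poly_mapping_eqI) (simp add: lookup_add algebra_simps)

lemma scale_diff_left: "scale (a - b :: 'r::comm_ring_1) f = scale a f - scale b f"
  by (rule poly_mapping_eqI) (simp add: lookup_minus algebra_simps)

lemma scale_scale [simp]: "scale (a :: 'r::comm_ring_1) (scale b f) = scale (a * b) f"
  by (rule poly_mapping_eqI) (simp add: algebra_simps)

lemma scale_uminus_left: "scale (- a :: 'r::comm_ring_1) f = - scale a f"
  by (rule poly_mapping_eqI) (simp add: lookup_uminus)

lemma scale_diff: "scale (a :: 'r::comm_ring_1) (f - g) = scale a f - scale a g"
  by (rule poly_mapping_eqI) (simp add: lookup_minus algebra_simps)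

lemma scale_sum: "scale (a :: 'r::comm_ring_1) (sum f A) = (\<Sum>x\<in>A. scale a (f x))"
  by (induction A rule: infinite_finite_induct) (simp_all add: scale_add)

lemma scale_single [simp]:
  "scale (a :: 'r::comm_ring_1) (Poly_Mapping.single x b) = Poly_Mapping.single x (a * b)"
  by (rule poly_mapping_eqI) (simp add: lookup_single when_def)

lemma keys_scale: "Poly_Mapping.keys (scale (a :: 'r::comm_ring_1) f) \<subseteq> Poly_Mapping.keys f"
  by (auto simp: in_keys_iff)

lemma poly_mapping_scale_induct [consumes 1, case_names zero single add]:
  fixes f :: "'a \<Rightarrow>\<^sub>0 'r::comm_ring_1"
  assumes "Poly_Mapping.keys f \<subseteq> K"
    and zero: "P 0"
    and single: "\<And>x c. x \<in> K \<Longrightarrow> P (Poly_Mapping.single x c)"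
    and add: "\<And>f g. Poly_Mapping.keys f \<subseteq> K \<Longrightarrow> Poly_Mapping.keys g \<subseteq> K \<Longrightarrow> P f \<Longrightarrow> P g \<Longrightarrow> P (f + g)"
  shows "P f"
proof -
  define S where "S I = (\<Sum>x\<in>I. Poly_Mapping.single x (Poly_Mapping.lookup f x))" for I
  have *: "P (S I) \<and> Poly_Mapping.keys (S I) \<subseteq> K" if "finite I" "I \<subseteq> K" for I
    using that
  proof (induction I rule: finite_induct)
    case empty
    then show ?case by (simp add: S_def zero)
  next
    case (insert x I)
    have k: "Poly_Mapping.keys (Poly_Mapping.single x (Poly_Mapping.lookup f x)) \<subseteq> K"
      using insert.prems by auto
    have "S (insert x I) = Poly_Mapping.single x (Poly_Mapping.lookup f x) + S I"
      using insert.hyps by (simp add: S_def)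
    then show ?case
      using insert add[OF k] single keys_add[of "Poly_Mapping.single x (Poly_Mapping.lookup f x)" "S I"] k
      by auto
  qed
  have "f = S (Poly_Mapping.keys f)"
    unfolding S_def
    by (rule poly_mapping_eqI) (auto simp: lookup_sum lookup_single when_def in_keys_iff)
  then show ?thesis using *[of "Poly_Mapping.keys f"] assms(1) by simp
qed

lemma bilinear_ext_superset:
  assumes "finite A" "finite B" "Poly_Mapping.keys f \<subseteq> A" "Poly_Mapping.keys g \<subseteq> B"
  shows "bilinear_ext t f g =
    (\<Sum>a\<in>A. \<Sum>b\<in>B. scale (Poly_Mapping.lookup f a * Poly_Mapping.lookup g b) (t a b))"
proof -
  have "(\<Sum>b\<in>B. scale (Poly_Mapping.lookup f a * Poly_Mapping.lookup g b) (t a b)) =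
      (\<Sum>b\<in>Poly_Mapping.keys g. scale (Poly_Mapping.lookup f a * Poly_Mapping.lookup g b) (t a b))" for a
    by (rule sum.mono_neutral_right) (use assms in \<open>auto simp: in_keys_iff\<close>)
  then have "(\<Sum>a\<in>A. \<Sum>b\<in>B. scale (Poly_Mapping.lookup f a * Poly_Mapping.lookup g b) (t a b)) =
     (\<Sum>a\<in>A. \<Sum>b\<in>Poly_Mapping.keys g. scale (Poly_Mapping.lookup f a * Poly_Mapping.lookup g b) (t a b))"
    by simp
  also have "\<dots> = bilinear_ext t f g" unfolding bilinear_ext_def
    by (rule sum.mono_neutral_right) (use assms in \<open>auto simp: in_keys_iff\<close>)
  finally show ?thesis by simp
qed

lemma bilinear_ext_zero [simp]: "bilinear_ext t 0 g = 0" "bilinear_ext t f 0 = 0"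
  by (simp_all add: bilinear_ext_def)

lemma bilinear_ext_single:
  "bilinear_ext t (Poly_Mapping.single a c) (Poly_Mapping.single b d) = scale (c * d) (t a b)"
  using bilinear_ext_superset[of "{a}" "{b}" "Poly_Mapping.single a c" "Poly_Mapping.single b d" t]
  by simp

lemma bilinear_ext_add_left:
  "bilinear_ext t (f + f') g = bilinear_ext t f g + bilinear_ext t f' g"
proof -
  let ?A = "Poly_Mapping.keys f \<union> Poly_Mapping.keys f'"
  let ?B = "Poly_Mapping.keys g"
  show ?thesis
    using bilinear_ext_superset[of ?A ?B f g t] bilinear_ext_superset[of ?A ?B f' g t]
      bilinear_ext_superset[of ?A ?B "f + f'" g t] keys_add[of f f']
    by (simp add: lookup_add distrib_right scale_add_left sum.distrib)
qed

lemma bilinear_ext_add_right: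
  "bilinear_ext t f (g + g') = bilinear_ext t f g + bilinear_ext t f g'"
proof -
  let ?A = "Poly_Mapping.keys f"
  let ?B = "Poly_Mapping.keys g \<union> Poly_Mapping.keys g'"
  show ?thesis
    using bilinear_ext_superset[of ?A ?B f g t] bilinear_ext_superset[of ?A ?B f g' t]
      bilinear_ext_superset[of ?A ?B f "g + g'" t] keys_add[of g g']
    by (simp add: lookup_add distrib_left scale_add_left sum.distrib)
qed

lemma bilinear_ext_scale_left:
  "bilinear_ext t (scale p f) g = scale p (bilinear_ext t f g)"
  using bilinear_ext_superset[of "Poly_Mapping.keys f" "Poly_Mapping.keys g" "scale p f" g t]
  by (simp add: keys_scale bilinear_ext_def scale_sum mult.assoc)

lemma bilinear_ext_scale_right:
  "bilinear_ext t f (scale p g) = scale p (bilinear_ext t f g)"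
  using bilinear_ext_superset[of "Poly_Mapping.keys f" "Poly_Mapping.keys g" f "scale p g" t]
  by (simp add: keys_scale bilinear_ext_def scale_sum mult_ac)

lemma bilinear_ext_uminus:
  "bilinear_ext t (- f) g = - bilinear_ext t f g" "bilinear_ext t f (- g) = - bilinear_ext t f g"
  using bilinear_ext_scale_left[of t "- 1" f g] bilinear_ext_scale_right[of t f "- 1" g]
  by (simp_all add: scale_uminus_left)

lemma bilinear_ext_diff_left:
  "bilinear_ext t (f - f') g = bilinear_ext t f g - bilinear_ext t f' g"
  using bilinear_ext_add_left[of t f "- f'" g] by (simp add: bilinear_ext_uminus)

lemma bilinear_ext_diff_right:
  "bilinear_ext t f (g - g') = bilinear_ext t f g - bilinear_ext t f g'"
  using bilinear_ext_add_right[of t f g "- g'"] by (simp add: bilinear_ext_uminus)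

lemma bilinear_ext_assoc:
  assumes tab: "\<And>a b. a \<in> K \<Longrightarrow> b \<in> K \<Longrightarrow> Poly_Mapping.keys (t a b) \<subseteq> K"
    and basis: "\<And>a b c. a \<in> K \<Longrightarrow> b \<in> K \<Longrightarrow> c \<in> K \<Longrightarrow>
      bilinear_ext t (t a b) (Poly_Mapping.single c 1) = bilinear_ext t (Poly_Mapping.single a 1) (t b c)"
    and f: "Poly_Mapping.keys f \<subseteq> K" and g: "Poly_Mapping.keys g \<subseteq> K" and h: "Poly_Mapping.keys h \<subseteq> K"
  shows "bilinear_ext t (bilinear_ext t f g) h = bilinear_ext t f (bilinear_ext t g h)"
  using f
proof (induction rule: poly_mapping_scale_induct)
  case (single a p)
  show ?case using g
  proof (induction rule: poly_mapping_scale_induct)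
    case (single b q)
    show ?case using h
    proof (induction rule: poly_mapping_scale_induct)
      case (single c r)
      have s: "Poly_Mapping.single x y = scale y (Poly_Mapping.single x 1)" for x :: 'a and y :: 'b
        by simp
      have "bilinear_ext t (bilinear_ext t (Poly_Mapping.single a p) (Poly_Mapping.single b q)) (Poly_Mapping.single c r)
          = scale (p * q * r) (bilinear_ext t (t a b) (Poly_Mapping.single c 1))"
        by (subst s[of c r]) (simp only: bilinear_ext_single bilinear_ext_scale_left bilinear_ext_scale_right scale_scale ac_simps)
      also have "\<dots> = scale (p * q * r) (bilinear_ext t (Poly_Mapping.single a 1) (t b c))"
        using basis \<open>a \<in> K\<close> \<open>b \<in> K\<close> \<open>c \<in> K\<close> by simp
      also have "\<dots> = bilinear_ext t (Poly_Mapping.single a p) (bilinear_ext t (Poly_Mapping.single b q) (Poly_Mapping.single c r))"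
        by (subst s[of a p]) (simp only: bilinear_ext_single bilinear_ext_scale_left bilinear_ext_scale_right scale_scale ac_simps)
      finally show ?case .
    qed (simp_all add: bilinear_ext_add_right)
  qed (simp_all add: bilinear_ext_add_right bilinear_ext_add_left)
qed (simp_all add: bilinear_ext_add_left)

lemma keys_lookup_bilinear_ext:
  assumes t: "\<And>a b. a \<in> K \<Longrightarrow> b \<in> K \<Longrightarrow>
      Poly_Mapping.keys (t a b) \<subseteq> K \<and> (\<forall>w. Poly_Mapping.lookup (t a b) w \<in> C)"
    and C: "0 \<in> C" "\<And>x y. x \<in> C \<Longrightarrow> y \<in> C \<Longrightarrow> x + y \<in> C" "\<And>x y. x \<in> C \<Longrightarrow> y \<in> C \<Longrightarrow> x * y \<in> C"
    and f: "Poly_Mapping.keys f \<subseteq> K" "\<And>w. Poly_Mapping.lookup f w \<in> C"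
    and g: "Poly_Mapping.keys g \<subseteq> K" "\<And>w. Poly_Mapping.lookup g w \<in> C"
  shows "Poly_Mapping.keys (bilinear_ext t f g) \<subseteq> K \<and> (\<forall>w. Poly_Mapping.lookup (bilinear_ext t f g) w \<in> C)"
proof -
  define Q where "Q x \<longleftrightarrow> Poly_Mapping.keys x \<subseteq> K \<and> (\<forall>w. Poly_Mapping.lookup x w \<in> C)" for x
  have Q_add: "Q (x + y)" if "Q x" "Q y" for x y
    using that keys_add[of x y] C(2) unfolding Q_def by (auto simp: lookup_add)
  have Q_zero: "Q 0" using C(1) by (simp add: Q_def)
  have Q_sum: "Q (sum F I)" if "\<And>i. i \<in> I \<Longrightarrow> Q (F i)" for F :: "'a \<Rightarrow> _" and I
    using that by (induction I rule: infinite_finite_induct) (auto simp: Q_zero Q_add)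
  have Q_scale: "Q (scale c x)" if "c \<in> C" "Q x" for c x
    using that keys_scale[of c x] C(3) unfolding Q_def by auto
  have "Q (bilinear_ext t f g)" unfolding bilinear_ext_def
  proof (intro Q_sum)
    fix a b assume "a \<in> Poly_Mapping.keys f" "b \<in> Poly_Mapping.keys g"
    then show "Q (scale (Poly_Mapping.lookup f a * Poly_Mapping.lookup g b) (t a b))"
      using t[of a b] f g by (intro Q_scale C(3)) (auto simp: Q_def)
  qed
  then show ?thesis by (simp add: Q_def)
qed

text \<open>Both the Hecke algebras and the monoid rings behind the tensor products are free modules with a
  multiplication table, so that the ring axioms reduce to basis elements.\<close>

lemma ring_of_table:
  fixes R :: "('a \<Rightarrow>\<^sub>0 'r::comm_ring_1) ring"
  assumes R: "R = \<lparr>carrier = {f. Poly_Mapping.keys f \<subseteq> K \<and> (\<forall>w. Poly_Mapping.lookup f w \<in> C)},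
      monoid.mult = bilinear_ext t, one = Poly_Mapping.single e 1, ring.zero = 0, add = (+)\<rparr>"
    and C: "0 \<in> C" "1 \<in> C" "\<And>x y. x \<in> C \<Longrightarrow> y \<in> C \<Longrightarrow> x + y \<in> C" "\<And>x y. x \<in> C \<Longrightarrow> y \<in> C \<Longrightarrow> x * y \<in> C"
      "\<And>x. x \<in> C \<Longrightarrow> - x \<in> C"
    and t: "\<And>a b. a \<in> K \<Longrightarrow> b \<in> K \<Longrightarrow>
      Poly_Mapping.keys (t a b) \<subseteq> K \<and> (\<forall>w. Poly_Mapping.lookup (t a b) w \<in> C)"
    and basis: "\<And>a b c. a \<in> K \<Longrightarrow> b \<in> K \<Longrightarrow> c \<in> K \<Longrightarrow>
      bilinear_ext t (t a b) (Poly_Mapping.single c 1) = bilinear_ext t (Poly_Mapping.single a 1) (t b c)"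
    and e: "e \<in> K" "\<And>a. a \<in> K \<Longrightarrow> t e a = Poly_Mapping.single a 1" "\<And>a. a \<in> K \<Longrightarrow> t a e = Poly_Mapping.single a 1"
  shows "ring R"
proof (rule ringI)
  show "abelian_group R"
  proof (rule abelian_groupI)
    fix x y assume "x \<in> carrier R" "y \<in> carrier R"
    then show "x \<oplus>\<^bsub>R\<^esub> y \<in> carrier R"
      using keys_add[of x y] C(3) by (auto simp: R lookup_add)
  next
    fix x assume x: "x \<in> carrier R"
    have "Poly_Mapping.keys (- x) = Poly_Mapping.keys x" by (auto simp: in_keys_iff)
    then have "- x \<in> carrier R" using x C(5) by (auto simp: R)
    then show "\<exists>y\<in>carrier R. y \<oplus>\<^bsub>R\<^esub> x = \<zero>\<^bsub>R\<^esub>"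
      by (intro bexI[of _ "- x"]) (simp_all add: R)
  qed (simp_all add: R C(1) ac_simps)
  show "Group.monoid R"
  proof (rule monoidI)
    fix x y assume "x \<in> carrier R" "y \<in> carrier R"
    then show "x \<otimes>\<^bsub>R\<^esub> y \<in> carrier R"
      using keys_lookup_bilinear_ext[of K t C x y, OF t C(1,3,4)] by (auto simp: R)
  next
    fix x y z assume "x \<in> carrier R" "y \<in> carrier R" "z \<in> carrier R"
    then show "x \<otimes>\<^bsub>R\<^esub> y \<otimes>\<^bsub>R\<^esub> z = x \<otimes>\<^bsub>R\<^esub> (y \<otimes>\<^bsub>R\<^esub> z)"
      using bilinear_ext_assoc[of K t x y z] t basis by (auto simp: R)
  next
    fix x assume "x \<in> carrier R"
    then have x: "Poly_Mapping.keys x \<subseteq> K" by (simp add: R)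
    show "\<one>\<^bsub>R\<^esub> \<otimes>\<^bsub>R\<^esub> x = x" unfolding R monoid.simps using x
      by (induction rule: poly_mapping_scale_induct) (auto simp: bilinear_ext_single bilinear_ext_add_right e)
    show "x \<otimes>\<^bsub>R\<^esub> \<one>\<^bsub>R\<^esub> = x" unfolding R monoid.simps using x
      by (induction rule: poly_mapping_scale_induct) (auto simp: bilinear_ext_single bilinear_ext_add_left e)
  qed (use C(1,2) e in \<open>auto simp: R lookup_single when_def\<close>)
qed (auto simp: R bilinear_ext_add_left bilinear_ext_add_right)

section \<open>Signs of roots and of coroots\<close>

locale based_root_datum =
  fixes D :: "('x::ab_group_add, 'y::ab_group_add) root_data"
  assumes datum: "reduced_based_root_datum D"
begin

abbreviation "pr \<equiv> pairing D"
abbreviation "cr \<equiv> coroot D"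
abbreviation "\<Phi> \<equiv> roots D"
abbreviation "B \<equiv> simples D"
abbreviation "rfl \<equiv> reflection D"
abbreviation "corfl \<equiv> coreflection D"
abbreviation "N \<equiv> nat_span B cr"
abbreviation "pos \<equiv> positive_roots D"

lemma pairing_perfect: "perfect_pairing pr"
  using datum by (simp add: reduced_based_root_datum_def)

lemma additive_left: "additive (\<lambda>x. pr x y)" and additive_right: "additive (pr x)"
  using pairing_perfect by (simp_all add: perfect_pairing_def)

lemmas pr_simps [simp] =
  additive.add[OF additive_left] additive.add[OF additive_right]
  additive.zero[OF additive_left] additive.zero[OF additive_right]
  additive.minus[OF additive_left] additive.minus[OF additive_right]
  additive.diff[OF additive_left] additive.diff[OF additive_right]

lemmas pr_sum_left = additive.sum[OF additive_left]
lemmas pr_sum_right = additive.sum[OF additive_right]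

lemma pr_zmul_left [simp]: "pr (zmul n x) y = n * pr x y"
  by (simp add: zmul_def pr_sum_left left_diff_distrib[symmetric])

lemma pr_zmul_right [simp]: "pr x (zmul n y) = n * pr x y"
  by (simp add: zmul_def pr_sum_right left_diff_distrib[symmetric])

lemma pr_eqI_left:
  assumes "\<And>y. pr x y = pr x' y" shows "x = x'"
proof -
  have "\<forall>g. additive g \<longrightarrow> (\<exists>!z. \<forall>y. g y = pr z y)"
    using pairing_perfect by (simp add: perfect_pairing_def)
  with additive_right[of x] have "\<exists>!z. \<forall>y. pr x y = pr z y" by simp
  then show ?thesis using assms by (elim ex1E) metis
qed

lemma pr_eqI_right:
  assumes "\<And>x. pr x y = pr x y'" shows "y = y'"
proof -
  have "\<forall>f. additive f \<longrightarrow> (\<exists>!z. \<forall>x. f x = pr x z)"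
    using pairing_perfect by (simp add: perfect_pairing_def)
  with additive_left[of y] have "\<exists>!z. \<forall>x. pr x y = pr x z" by simp
  then show ?thesis using assms by (elim ex1E) metis
qed

lemmas datum_unfolded = datum[unfolded reduced_based_root_datum_def]

lemma finite_roots: "finite \<Phi>"
  and inj_coroot: "inj_on cr \<Phi>"
  and simples_roots: "B \<subseteq> \<Phi>"
  and roots_pos_neg: "\<Phi> = pos \<union> negative_roots D"
  using datum_unfolded by - (elim conjE, assumption)+

lemma pr_root_coroot [simp]: "\<alpha> \<in> \<Phi> \<Longrightarrow> pr \<alpha> (cr \<alpha>) = 2"
  using datum_unfolded by (elim conjE) (erule (1) bspec)

lemma refl_root: assumes "\<alpha> \<in> \<Phi>" "\<gamma> \<in> \<Phi>" shows "rfl \<alpha> \<gamma> \<in> \<Phi>"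
proof -
  have "\<forall>\<alpha>\<in>\<Phi>. rfl \<alpha> ` \<Phi> \<subseteq> \<Phi>" using datum_unfolded by (elim conjE)
  then show ?thesis using assms by auto
qed

lemma corefl_coroot: assumes "\<alpha> \<in> \<Phi>" "c \<in> coroots D" shows "corfl \<alpha> c \<in> coroots D"
proof -
  have "\<forall>\<alpha>\<in>\<Phi>. corfl \<alpha> ` coroots D \<subseteq> coroots D" using datum_unfolded by (elim conjE)
  then show ?thesis using assms by auto
qed

lemma simple_root: "\<beta> \<in> B \<Longrightarrow> \<beta> \<in> \<Phi>"
  using simples_roots by blast

lemma finite_simples: "finite B"
  using finite_subset[OF simples_roots finite_roots] .

lemma reduced:
  assumes "\<alpha> \<in> \<Phi>" "\<beta> \<in> \<Phi>" "\<beta> = zmul m \<alpha>"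
  shows "\<beta> = \<alpha> \<or> \<beta> = - \<alpha>"
proof -
  have "zmul 1 \<beta> = zmul m \<alpha>" using assms(3) by (simp add: zmul_def)
  moreover have "\<forall>\<alpha>\<in>\<Phi>. \<forall>\<beta>\<in>\<Phi>. \<forall>m n. n \<noteq> 0 \<and> zmul n \<beta> = zmul m \<alpha> \<longrightarrow> \<beta> = \<alpha> \<or> \<beta> = - \<alpha>"
    using datum_unfolded by (elim conjE)
  ultimately show ?thesis using assms(1,2) zero_neq_one by metis
qed

lemma simples_independent:
  assumes "(\<Sum>\<beta>\<in>B. zmul (c \<beta>) \<beta>) = 0" "\<beta> \<in> B" shows "c \<beta> = 0"
proof -
  have "\<forall>c. (\<Sum>\<beta>\<in>B. zmul (c \<beta>) \<beta>) = 0 \<longrightarrow> (\<forall>\<beta>\<in>B. c \<beta> = 0)"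
    using datum_unfolded by (elim conjE)
  then show ?thesis using assms by simp
qed

lemma sum_zmul_add: "(\<Sum>\<beta>\<in>B. zmul (c \<beta> + d \<beta>) \<beta>) = (\<Sum>\<beta>\<in>B. zmul (c \<beta>) \<beta>) + (\<Sum>\<beta>\<in>B. zmul (d \<beta>) \<beta>)"
  by (rule pr_eqI_left) (simp add: pr_sum_left sum.distrib distrib_right)

lemma sum_zmul_diff: "(\<Sum>\<beta>\<in>B. zmul (c \<beta> - d \<beta>) \<beta>) = (\<Sum>\<beta>\<in>B. zmul (c \<beta>) \<beta>) - (\<Sum>\<beta>\<in>B. zmul (d \<beta>) \<beta>)"
  by (rule pr_eqI_left) (simp add: pr_sum_left sum_subtractf left_diff_distrib)

lemma pr_refl: "pr (rfl \<alpha> x) y = pr x y - pr x (cr \<alpha>) * pr \<alpha> y"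
  by (simp add: reflection_def)

lemma pr_corefl: "pr x (corfl \<alpha> y) = pr (rfl \<alpha> x) y"
  by (simp add: coreflection_def pr_refl)

lemma refl_refl [simp]: "\<alpha> \<in> \<Phi> \<Longrightarrow> rfl \<alpha> (rfl \<alpha> x) = x"
  by (rule pr_eqI_left) (simp add: pr_refl algebra_simps)

lemma corefl_corefl: "\<alpha> \<in> \<Phi> \<Longrightarrow> corfl \<alpha> (corfl \<alpha> y) = y"
  by (rule pr_eqI_right) (simp add: pr_corefl)

lemma refl_self [simp]: "\<alpha> \<in> \<Phi> \<Longrightarrow> rfl \<alpha> \<alpha> = - \<alpha>"
  by (rule pr_eqI_left) (simp add: pr_refl)

lemma refl_add [simp]: "rfl \<alpha> (x + x') = rfl \<alpha> x + rfl \<alpha> x'"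
  by (rule pr_eqI_left) (simp add: pr_refl algebra_simps)

lemma refl_uminus [simp]: "rfl \<alpha> (- x) = - rfl \<alpha> x"
  by (rule pr_eqI_left) (simp add: pr_refl algebra_simps)

lemma refl_zero [simp]: "rfl \<alpha> 0 = 0"
  by (rule pr_eqI_left) (simp add: pr_refl)

lemma uminus_root: "\<alpha> \<in> \<Phi> \<Longrightarrow> - \<alpha> \<in> \<Phi>"
  using refl_root[of \<alpha> \<alpha>] by simp

lemma bij_refl_roots: "\<alpha> \<in> \<Phi> \<Longrightarrow> bij_betw (rfl \<alpha>) \<Phi> \<Phi>"
  by (rule bij_betw_byWitness[of _ "rfl \<alpha>"]) (auto simp: refl_root)

text \<open>The canonical form, invariant under all reflections. It does the work of the angles between roots:
  it makes \<open>pr \<alpha> (cr \<gamma>)\<close> and \<open>pr \<gamma> (cr \<alpha>)\<close> have the same sign, and it characterizes the coroots.\<close>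

definition form :: "'x \<Rightarrow> 'x \<Rightarrow> int" where
  "form x x' = (\<Sum>\<alpha>\<in>\<Phi>. pr x (cr \<alpha>) * pr x' (cr \<alpha>))"

lemma form_commute: "form x x' = form x' x"
  by (simp add: form_def mult.commute)

lemma form_simps [simp]:
  "form (x + y) z = form x z + form y z" "form z (x + y) = form z x + form z y"
  "form (- x) z = - form x z" "form z (- x) = - form z x"
  "form (x - y) z = form x z - form y z" "form z (x - y) = form z x - form z y"
  "form (zmul n x) z = n * form x z" "form z (zmul n x) = n * form z x"
  by (simp_all add: form_def algebra_simps sum.distrib sum_subtractf sum_negf sum_distrib_left)

lemma form_zero [simp]: "form 0 z = 0"
  by (simp add: form_def)

lemma form_root_pos: "\<alpha> \<in> \<Phi> \<Longrightarrow> form \<alpha> \<alpha> > 0"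
  unfolding form_def
  by (rule sum_pos2[OF finite_roots, of \<alpha>]) auto

lemma form_refl: 
  assumes "\<alpha> \<in> \<Phi>" shows "form (rfl \<alpha> x) (rfl \<alpha> x') = form x x'"
proof -
  have c: "form u v = (\<Sum>c\<in>coroots D. pr u c * pr v c)" for u v
    unfolding form_def coroots_def by (simp add: sum.reindex[OF inj_coroot])
  have "bij_betw (corfl \<alpha>) (coroots D) (coroots D)"
    by (rule bij_betw_byWitness[of _ "corfl \<alpha>"]) (auto simp: corefl_coroot corefl_corefl assms)
  from sum.reindex_bij_betw[OF this, of "\<lambda>c. pr x c * pr x' c"] show ?thesis
    by (simp add: c pr_corefl)
qed

lemma form_root:
  assumes "\<gamma> \<in> \<Phi>" shows "2 * form x \<gamma> = pr x (cr \<gamma>) * form \<gamma> \<gamma>"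
proof -
  have "form x \<gamma> = form (rfl \<gamma> x) (rfl \<gamma> \<gamma>)" using form_refl[OF assms] by (rule sym)
  also have "\<dots> = - form x \<gamma> + pr x (cr \<gamma>) * form \<gamma> \<gamma>"
    using assms by simp (simp add: reflection_def)
  finally show ?thesis by simp
qed

lemma coroot_eqI:
  assumes "\<gamma> \<in> \<Phi>" "\<And>x. 2 * form x \<gamma> = pr x y * form \<gamma> \<gamma>"
  shows "cr \<gamma> = y"
  using form_root[OF assms(1)] assms(2) form_root_pos[OF assms(1)]
  by (intro pr_eqI_right) (metis mult_right_cancel less_irrefl)

text \<open>Conjugating the reflection of \<open>\<gamma>\<close> gives an isometry of the form with \<open>-1\<close>-eigenvector
  \<open>rfl \<alpha> \<gamma>\<close>, and the form leaves only one candidate for its coroot.\<close>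

lemma coroot_refl:
  assumes "\<alpha> \<in> \<Phi>" "\<gamma> \<in> \<Phi>" shows "cr (rfl \<alpha> \<gamma>) = corfl \<alpha> (cr \<gamma>)"
proof (rule coroot_eqI)
  show "rfl \<alpha> \<gamma> \<in> \<Phi>" using assms by (rule refl_root)
  fix x
  have "form x (rfl \<alpha> \<gamma>) = form (rfl \<alpha> x) \<gamma>"
    using form_refl[OF assms(1), of "rfl \<alpha> x" \<gamma>] assms by simp
  then show "2 * form x (rfl \<alpha> \<gamma>) = pr x (corfl \<alpha> (cr \<gamma>)) * form (rfl \<alpha> \<gamma>) (rfl \<alpha> \<gamma>)"
    using form_root[OF assms(2)] form_refl[OF assms(1)] by (simp add: pr_corefl)
qed

lemma coroot_uminus: assumes "\<alpha> \<in> \<Phi>" shows "cr (- \<alpha>) = - cr \<alpha>"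
proof -
  have "cr (- \<alpha>) = corfl \<alpha> (cr \<alpha>)" using coroot_refl[OF assms assms] assms by simp
  also have "\<dots> = - cr \<alpha>" by (rule pr_eqI_right) (simp add: pr_corefl pr_refl assms)
  finally show ?thesis .
qed

lemma pairing_sign:
  assumes "\<alpha> \<in> \<Phi>" "\<gamma> \<in> \<Phi>"
  shows "pr \<alpha> (cr \<gamma>) > 0 \<longleftrightarrow> pr \<gamma> (cr \<alpha>) > 0" "pr \<alpha> (cr \<gamma>) = 0 \<longleftrightarrow> pr \<gamma> (cr \<alpha>) = 0"
proof -
  have e: "pr \<alpha> (cr \<gamma>) * form \<gamma> \<gamma> = pr \<gamma> (cr \<alpha>) * form \<alpha> \<alpha>"
    using form_root[OF assms(1), of \<gamma>] form_root[OF assms(2), of \<alpha>] by (simp add: form_commute)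
  have "form \<alpha> \<alpha> > 0" "form \<gamma> \<gamma> > 0" using form_root_pos assms by auto
  then show "pr \<alpha> (cr \<gamma>) > 0 \<longleftrightarrow> pr \<gamma> (cr \<alpha>) > 0" "pr \<alpha> (cr \<gamma>) = 0 \<longleftrightarrow> pr \<gamma> (cr \<alpha>) = 0"
    using e by (smt (verit) zero_less_mult_iff mult_eq_0_iff)+
qed

lemma pos_root: "\<gamma> \<in> pos \<Longrightarrow> \<gamma> \<in> \<Phi>"
  by (simp add: positive_roots_def)

lemma pos_iff:
  "\<gamma> \<in> pos \<longleftrightarrow> \<gamma> \<in> \<Phi> \<and> (\<exists>c :: 'x \<Rightarrow> nat. \<gamma> = (\<Sum>\<beta>\<in>B. zmul (int (c \<beta>)) \<beta>))"
  by (auto simp: positive_roots_def nat_span_def)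

lemma neg_iff: "\<gamma> \<in> negative_roots D \<longleftrightarrow> \<gamma> \<in> \<Phi> \<and> - \<gamma> \<in> pos"
  using uminus_root by (auto simp: positive_roots_def negative_roots_def)

lemma root_cases: assumes "\<gamma> \<in> \<Phi>" shows "\<gamma> \<in> pos \<or> - \<gamma> \<in> pos"
  using roots_pos_neg assms neg_iff by blast

lemma coefficients_of_pos:
  assumes "\<gamma> \<in> pos" "\<gamma> = (\<Sum>\<beta>\<in>B. zmul (c \<beta>) \<beta>)" "\<beta> \<in> B"
  shows "c \<beta> \<ge> 0"
proof -
  obtain d :: "'x \<Rightarrow> nat" where d: "\<gamma> = (\<Sum>\<beta>\<in>B. zmul (int (d \<beta>)) \<beta>)" using assms(1) pos_iff by auto
  have "(\<Sum>\<beta>\<in>B. zmul (c \<beta> - int (d \<beta>)) \<beta>) = 0"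
    using assms(2) d sum_zmul_diff[of c "\<lambda>\<beta>. int (d \<beta>)"] by simp
  from simples_independent[OF this assms(3)] show ?thesis by simp
qed

lemma not_pos_and_neg: assumes "\<gamma> \<in> pos" shows "- \<gamma> \<notin> pos"
proof
  assume "- \<gamma> \<in> pos"
  then obtain d :: "'x \<Rightarrow> nat" where d: "- \<gamma> = (\<Sum>\<beta>\<in>B. zmul (int (d \<beta>)) \<beta>)" using pos_iff by auto
  obtain c :: "'x \<Rightarrow> nat" where c: "\<gamma> = (\<Sum>\<beta>\<in>B. zmul (int (c \<beta>)) \<beta>)" using assms pos_iff by auto
  have "(\<Sum>\<beta>\<in>B. zmul (int (c \<beta>) + int (d \<beta>)) \<beta>) = 0"
    unfolding sum_zmul_add using c d by (metis add.right_inverse)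
  then have "c \<beta> = 0" if "\<beta> \<in> B" for \<beta> using simples_independent[OF _ that] by fastforce
  then have "\<gamma> = 0" using c by (simp add: zmul_def)
  then show False using pr_root_coroot[of \<gamma>] pos_root[OF assms] by simp
qed

lemma simple_pos: assumes "\<beta> \<in> B" shows "\<beta> \<in> pos"
proof -
  have "\<beta> = (\<Sum>\<beta>'\<in>B. zmul (int (if \<beta>' = \<beta> then 1 else 0)) \<beta>')"
    using assms finite_simples by (intro pr_eqI_left) (simp add: pr_sum_left if_distrib if_distribR cong: if_cong)
  then show ?thesis unfolding pos_iff using simple_root[OF assms] by (intro conjI exI)
qed

lemma reflection_coefficients:
  assumes "\<beta> \<in> B" "\<gamma> = (\<Sum>\<beta>\<in>B. zmul (c \<beta>) \<beta>)"
  shows "rfl \<beta> \<gamma> = (\<Sum>\<beta>'\<in>B. zmul ((c(\<beta> := c \<beta> - pr \<gamma> (cr \<beta>))) \<beta>') \<beta>')"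
proof (rule pr_eqI_left)
  fix y
  have e: "(\<Sum>\<beta>'\<in>B. (c(\<beta> := c \<beta> - n)) \<beta>' * pr \<beta>' y) = (\<Sum>\<beta>'\<in>B. c \<beta>' * pr \<beta>' y) - n * pr \<beta> y" for n
    using assms(1) finite_simples by (simp add: sum.remove[of B \<beta>] algebra_simps)
  have "pr \<gamma> y = (\<Sum>\<beta>\<in>B. c \<beta> * pr \<beta> y)" by (subst assms(2)) (simp add: pr_sum_left)
  then show "pr (rfl \<beta> \<gamma>) y = pr (\<Sum>\<beta>'\<in>B. zmul ((c(\<beta> := c \<beta> - pr \<gamma> (cr \<beta>))) \<beta>') \<beta>') y"
    unfolding pr_refl pr_sum_left pr_zmul_left e by simp
qed

text \<open>A simple reflection changes only one coefficient of a positive root. Since a positive root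
  other than the simple one has another positive coefficient, it stays positive.\<close>

lemma refl_simple_pos:
  assumes b: "\<beta> \<in> B" and g: "\<gamma> \<in> pos" "\<gamma> \<noteq> \<beta>"
  shows "rfl \<beta> \<gamma> \<in> pos"
proof (rule ccontr)
  assume "rfl \<beta> \<gamma> \<notin> pos"
  then have n: "- rfl \<beta> \<gamma> \<in> pos"
    using root_cases[OF refl_root[OF simple_root[OF b] pos_root[OF g(1)]]] by simp
  obtain c :: "'x \<Rightarrow> nat" where c: "\<gamma> = (\<Sum>\<beta>\<in>B. zmul (int (c \<beta>)) \<beta>)" using g pos_iff by auto
  let ?c = "(\<lambda>x. int (c x))(\<beta> := int (c \<beta>) - pr \<gamma> (cr \<beta>))"
  have "rfl \<beta> \<gamma> = (\<Sum>\<beta>'\<in>B. zmul (?c \<beta>') \<beta>')" using reflection_coefficients[OF b c] .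
  then have "- rfl \<beta> \<gamma> = - (\<Sum>\<beta>'\<in>B. zmul (?c \<beta>') \<beta>')" by simp
  also have "\<dots> = (\<Sum>\<beta>'\<in>B. zmul (- ?c \<beta>') \<beta>')"
    by (intro pr_eqI_left) (simp only: pr_sum_left pr_simps pr_zmul_left mult_minus_left sum_negf)
  finally have "- rfl \<beta> \<gamma> = (\<Sum>\<beta>'\<in>B. zmul (- ?c \<beta>') \<beta>')" .
  from coefficients_of_pos[OF n this] have z: "c \<beta>' = 0" if "\<beta>' \<in> B" "\<beta>' \<noteq> \<beta>" for \<beta>'
    using that by fastforce
  have "\<gamma> = zmul (int (c \<beta>)) \<beta>"
  proof (rule pr_eqI_left)
    fix y
    have "pr \<gamma> y = (\<Sum>\<beta>\<in>B. int (c \<beta>) * pr \<beta> y)" by (subst c) (simp add: pr_sum_left)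
    also have "\<dots> = int (c \<beta>) * pr \<beta> y + (\<Sum>\<beta>\<in>B-{\<beta>}. int (c \<beta>) * pr \<beta> y)"
      by (rule sum.remove[OF finite_simples b])
    finally show "pr \<gamma> y = pr (zmul (int (c \<beta>)) \<beta>) y" using z by simp
  qed
  then have "\<gamma> = - \<beta>" using reduced[OF simple_root[OF b] pos_root[OF g(1)]] g(2) by blast
  then show False using not_pos_and_neg[OF simple_pos[OF b]] g(1) by blast
qed

lemma N_add: "a \<in> N \<Longrightarrow> b \<in> N \<Longrightarrow> a + b \<in> N"
proof -
  assume "a \<in> N" "b \<in> N"
  then obtain c d :: "'x \<Rightarrow> nat" where "a = (\<Sum>i\<in>B. zmul (int (c i)) (cr i))" "b = (\<Sum>i\<in>B. zmul (int (d i)) (cr i))"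
    by (auto simp: nat_span_def)
  then have "a + b = (\<Sum>i\<in>B. zmul (int (c i + d i)) (cr i))"
    by (intro pr_eqI_right) (simp add: pr_sum_right sum.distrib distrib_right)
  then show ?thesis unfolding nat_span_def by (intro CollectI exI conjI TrueI)
qed

lemma N_zmul: assumes "a \<in> N" "n \<ge> 0" shows "zmul n a \<in> N"
proof -
  obtain c :: "'x \<Rightarrow> nat" where "a = (\<Sum>i\<in>B. zmul (int (c i)) (cr i))"
    using assms by (auto simp: nat_span_def)
  then have "zmul n a = (\<Sum>i\<in>B. zmul (int (nat n * c i)) (cr i))"
    using assms(2) by (intro pr_eqI_right) (simp add: pr_sum_right sum_distrib_left mult.assoc)
  then show ?thesis unfolding nat_span_def by (intro CollectI exI conjI TrueI)
qed

lemma coroot_simple_N: assumes "\<beta> \<in> B" shows "cr \<beta> \<in> N"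
proof -
  have "cr \<beta> = (\<Sum>i\<in>B. zmul (int (if i = \<beta> then 1 else 0)) (cr i))"
    using assms finite_simples by (intro pr_eqI_right) (simp add: pr_sum_right if_distrib if_distribR cong: if_cong)
  then show ?thesis unfolding nat_span_def by (intro CollectI exI conjI TrueI)
qed

text \<open>By induction on the sum of the coefficients: a positive root has positive form with itself, so it pairs positively with
  some simple coroot, and the corresponding simple reflection lowers that sum.\<close>

lemma coroot_pos_N:
  assumes "\<gamma> \<in> pos" shows "cr \<gamma> \<in> N"
proof -
  have "cr \<gamma> \<in> N" if "\<gamma> \<in> pos" "\<gamma> = (\<Sum>\<beta>\<in>B. zmul (int (c \<beta>)) \<beta>)" for \<gamma> and c :: "'x \<Rightarrow> nat"
    using that
  proof (induction "\<Sum>\<beta>\<in>B. c \<beta>" arbitrary: \<gamma> c rule: less_induct)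
    case less
    note g = less.prems(1) and c = less.prems(2)
    show ?case
    proof (cases "\<gamma> \<in> B")
      case True
      then show ?thesis by (rule coroot_simple_N)
    next
      case False
      have lin: "form \<gamma> x = (\<Sum>\<beta>\<in>B. int (c \<beta>) * form \<beta> x)" for x
      proof -
        have fs: "form (sum F A) x = (\<Sum>i\<in>A. form (F i) x)" for F :: "'x \<Rightarrow> 'x" and A
          by (induction A rule: infinite_finite_induct) (simp_all add: form_zero)
        show ?thesis by (subst c) (simp add: fs)
      qed
      have "\<exists>\<beta>\<in>B. form \<beta> \<gamma> > 0"
      proof (rule ccontr)
        assume "\<not> ?thesis"
        then have "(\<Sum>\<beta>\<in>B. int (c \<beta>) * form \<beta> \<gamma>) \<le> 0"
          by (intro sum_nonpos) (auto simp: mult_nonneg_nonpos not_less)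
        then show False using form_root_pos[OF pos_root[OF g]] lin[of \<gamma>] by simp
      qed
      then obtain \<beta> where b: "\<beta> \<in> B" "form \<beta> \<gamma> > 0" by blast
      note bR = simple_root[OF b(1)] and gR = pos_root[OF g]
      have p: "pr \<gamma> (cr \<beta>) > 0"
        using form_root[OF bR, of \<gamma>] b(2) form_root_pos[OF bR]
        by (smt (verit) form_commute zero_less_mult_iff)
      have p': "pr \<beta> (cr \<gamma>) > 0" using p pairing_sign[OF bR gR] by simp
      have s: "rfl \<beta> \<gamma> \<in> pos" using refl_simple_pos[OF b(1) g] False b(1) by blast
      let ?c = "(\<lambda>x. int (c x))(\<beta> := int (c \<beta>) - pr \<gamma> (cr \<beta>))"
      have rc: "rfl \<beta> \<gamma> = (\<Sum>\<beta>'\<in>B. zmul (?c \<beta>') \<beta>')" using reflection_coefficients[OF b(1) c] .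
      have nn: "?c x \<ge> 0" if "x \<in> B" for x using coefficients_of_pos[OF s rc that] .
      define d where "d x = nat (?c x)" for x
      have rd: "rfl \<beta> \<gamma> = (\<Sum>\<beta>'\<in>B. zmul (int (d \<beta>')) \<beta>')"
        unfolding rc d_def by (rule sum.cong) (use nn in auto)
      have "(\<Sum>x\<in>B. d x) < (\<Sum>x\<in>B. c x)"
      proof (rule sum_strict_mono_ex1[OF finite_simples])
        show "\<forall>x\<in>B. d x \<le> c x" using p by (auto simp: d_def)
        show "\<exists>x\<in>B. d x < c x" using p nn[OF b(1)] by (intro bexI[OF _ b(1)]) (simp add: d_def)
      qed
      from less.hyps[OF this s rd] have "cr (rfl \<beta> \<gamma>) \<in> N" .
      moreover have "cr \<gamma> = cr (rfl \<beta> \<gamma>) + zmul (pr \<beta> (cr \<gamma>)) (cr \<beta>)"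
        by (rule pr_eqI_right) (simp add: coroot_refl[OF bR gR] pr_corefl pr_refl)
      ultimately show ?thesis using p' coroot_simple_N[OF b(1)] by (metis N_add N_zmul less_imp_le)
    qed
  qed
  with assms show ?thesis by (auto simp: pos_iff)
qed

text \<open>Twice the half-sum of the positive roots, which pairs to \<open>2\<close> with every simple coroot. As
  a linear function on coroots it detects the sign of a root.\<close>

definition two_rho :: 'x where "two_rho = \<Sum>pos"

lemma finite_pos: "finite pos"
  using finite_subset[OF _ finite_roots] pos_root by blast

lemma two_rho_simple: assumes b: "\<beta> \<in> B" shows "pr two_rho (cr \<beta>) = 2"
proof -
  have bR: "\<beta> \<in> \<Phi>" using simple_root[OF b] .
  have st: "rfl \<beta> \<gamma> \<in> pos - {\<beta>}" if "\<gamma> \<in> pos - {\<beta>}" for \<gamma>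
  proof -
    have "rfl \<beta> \<gamma> \<noteq> \<beta>"
    proof
      assume "rfl \<beta> \<gamma> = \<beta>"
      then have "\<gamma> = - \<beta>" using refl_refl[OF bR, of \<gamma>] bR by simp
      then show False using not_pos_and_neg[OF simple_pos[OF b]] that by blast
    qed
    then show ?thesis using refl_simple_pos[OF b] that by blast
  qed
  have "bij_betw (rfl \<beta>) (pos - {\<beta>}) (pos - {\<beta>})"
    by (rule bij_betw_byWitness[of _ "rfl \<beta>"]) (use st bR in auto)
  from sum.reindex_bij_betw[OF this, of "\<lambda>\<gamma>. pr \<gamma> (cr \<beta>)"]
  have "(\<Sum>\<gamma>\<in>pos-{\<beta>}. - pr \<gamma> (cr \<beta>)) = (\<Sum>\<gamma>\<in>pos-{\<beta>}. pr \<gamma> (cr \<beta>))"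
    by (simp add: pr_refl bR)
  then have "(\<Sum>\<gamma>\<in>pos-{\<beta>}. pr \<gamma> (cr \<beta>)) = 0" by (simp add: sum_negf)
  then show ?thesis
    unfolding two_rho_def pr_sum_left
    using sum.remove[OF finite_pos simple_pos[OF b], of "\<lambda>\<gamma>. pr \<gamma> (cr \<beta>)"] bR by simp
qed

lemma N_nonneg:
  assumes "y \<in> N" "\<And>\<beta>. \<beta> \<in> B \<Longrightarrow> pr x (cr \<beta>) \<ge> 0" shows "pr x y \<ge> 0"
proof -
  obtain c :: "'x \<Rightarrow> nat" where "y = (\<Sum>i\<in>B. zmul (int (c i)) (cr i))"
    using assms by (auto simp: nat_span_def)
  then show ?thesis by (simp add: pr_sum_right sum_nonneg assms(2))
qed

lemma two_rho_N: "y \<in> N \<Longrightarrow> pr two_rho y \<ge> 0"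
  by (rule N_nonneg) (simp_all add: two_rho_simple)

lemma two_rho_N_zero: assumes "y \<in> N" "pr two_rho y \<le> 0" shows "y = 0"
proof -
  obtain c :: "'x \<Rightarrow> nat" where c: "y = (\<Sum>i\<in>B. zmul (int (c i)) (cr i))"
    using assms by (auto simp: nat_span_def)
  then have "pr two_rho y = (\<Sum>i\<in>B. 2 * int (c i))" by (simp add: pr_sum_right two_rho_simple mult.commute)
  also have "\<dots> = 2 * int (\<Sum>i\<in>B. c i)" by (simp add: sum_distrib_left mult.commute)
  finally have "(\<Sum>i\<in>B. c i) = 0" using assms(2) by linarith
  then have "c i = 0" if "i \<in> B" for i using finite_simples that by simp
  then show ?thesis using c by (simp add: zmul_def)
qed

lemma coroot_nonzero: "\<gamma> \<in> \<Phi> \<Longrightarrow> cr \<gamma> \<noteq> 0"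
  by (metis pr_root_coroot pr_simps(4) zero_neq_numeral)

lemma pos_iff_two_rho: assumes "\<gamma> \<in> \<Phi>" shows "\<gamma> \<in> pos \<longleftrightarrow> pr two_rho (cr \<gamma>) > 0"
proof -
  have *: "pr two_rho (cr \<delta>) > 0" if "\<delta> \<in> pos" for \<delta>
    using two_rho_N[OF coroot_pos_N[OF that]] two_rho_N_zero[OF coroot_pos_N[OF that]]
      coroot_nonzero[OF pos_root[OF that]] by linarith
  show ?thesis
    using *[of \<gamma>] *[of "- \<gamma>"] root_cases[OF assms] coroot_uminus[OF assms] by auto
qed

lemma two_rho_root_nonzero: "\<gamma> \<in> \<Phi> \<Longrightarrow> pr two_rho (cr \<gamma>) \<noteq> 0"
  using pos_iff_two_rho[of \<gamma>] pos_iff_two_rho[of "- \<gamma>"] root_cases[of \<gamma>] coroot_uminus[of \<gamma>] uminus_root[of \<gamma>]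
  by auto


section \<open>The length and walls of the fundamental alcove\<close>

lemma additive_rfl: "additive (rfl \<alpha>)"
  by (rule additive.intro) simp

lemma bij_rfl: "\<alpha> \<in> \<Phi> \<Longrightarrow> bij (rfl \<alpha>)"
  by (rule bij_betw_byWitness[of _ "rfl \<alpha>"]) auto

lemma inv_rfl:
  assumes "\<alpha> \<in> \<Phi>" shows "inv\<^bsub>linear_group\<^esub> (rfl \<alpha>) = rfl \<alpha>"
  unfolding m_inv_def
proof (rule the_equality)
  show "rfl \<alpha> \<in> carrier linear_group \<and> rfl \<alpha> \<otimes>\<^bsub>linear_group\<^esub> rfl \<alpha> = \<one>\<^bsub>linear_group\<^esub> \<and>
      rfl \<alpha> \<otimes>\<^bsub>linear_group\<^esub> rfl \<alpha> = \<one>\<^bsub>linear_group\<^esub>"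
    using assms additive_rfl bij_rfl by (auto simp: linear_group_def)
  fix g assume "g \<in> carrier linear_group \<and> rfl \<alpha> \<otimes>\<^bsub>linear_group\<^esub> g = \<one>\<^bsub>linear_group\<^esub> \<and>
      g \<otimes>\<^bsub>linear_group\<^esub> rfl \<alpha> = \<one>\<^bsub>linear_group\<^esub>"
  then have "rfl \<alpha> (g x) = x" for x by (auto simp: linear_group_def fun_eq_iff)
  then show "g = rfl \<alpha>" using refl_refl[OF assms] by (metis ext)
qed

lemma rfl_weyl: "\<alpha> \<in> \<Phi> \<Longrightarrow> rfl \<alpha> \<in> finite_weyl D"
  unfolding finite_weyl_def by (rule generate.incl) simp

lemma weyl_comp: "g \<in> finite_weyl D \<Longrightarrow> h \<in> finite_weyl D \<Longrightarrow> g \<circ> h \<in> finite_weyl D"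
  unfolding finite_weyl_def using generate.eng[of g linear_group _ h] by (simp add: linear_group_def)

lemma weyl_id: "id \<in> finite_weyl D"
  unfolding finite_weyl_def using generate.one[of linear_group] by (simp add: linear_group_def)

lemma weyl_induct [consumes 1, case_names id rfl comp]:
  assumes "g \<in> finite_weyl D"
    and "P id" "\<And>\<alpha>. \<alpha> \<in> \<Phi> \<Longrightarrow> P (rfl \<alpha>)"
    and "\<And>g h. g \<in> finite_weyl D \<Longrightarrow> h \<in> finite_weyl D \<Longrightarrow> P g \<Longrightarrow> P h \<Longrightarrow> P (g \<circ> h)"
  shows "P g"
  using assms(1) unfolding finite_weyl_def
proof (induction rule: generate.induct)
  case one
  show ?case using assms(2) by (simp only: linear_group_def monoid.simps)
next
  case (incl h)
  then show ?case using assms(3) by auto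
next
  case (inv h)
  then show ?case using assms(3) by (auto simp: inv_rfl)
next
  case (eng g h)
  then show ?case using assms(4)[of g h]
    by (simp only: linear_group_def finite_weyl_def monoid.simps)
qed

lemma weyl_additive: "g \<in> finite_weyl D \<Longrightarrow> additive g"
  by (induction rule: weyl_induct) (auto simp: additive_def)

lemma weyl_bij: "g \<in> finite_weyl D \<Longrightarrow> bij g"
  by (induction rule: weyl_induct) (simp_all only: bij_id bij_rfl bij_comp)

lemma weyl_root: "g \<in> finite_weyl D \<Longrightarrow> \<gamma> \<in> \<Phi> \<Longrightarrow> g \<gamma> \<in> \<Phi>"
  by (induction arbitrary: \<gamma> rule: weyl_induct) (auto simp: refl_root)

lemma weyl_pairing: "g \<in> finite_weyl D \<Longrightarrow> \<gamma> \<in> \<Phi> \<Longrightarrow> pr (g x) (cr (g \<gamma>)) = pr x (cr \<gamma>)"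
proof (induction arbitrary: \<gamma> x rule: weyl_induct)
  case (rfl \<alpha>)
  then show ?case by (simp add: coroot_refl pr_corefl)
qed (auto simp: weyl_root)

lemma weyl_inv: "g \<in> finite_weyl D \<Longrightarrow> inv_into UNIV g \<in> finite_weyl D"
proof (induction rule: weyl_induct)
  case id
  show ?case using weyl_id by (simp only: inv_id)
next
  case (rfl \<alpha>)
  have "inv_into UNIV (rfl \<alpha>) = rfl \<alpha>"
    by (rule inv_equality) (use rfl in auto)
  then show ?case using rfl rfl_weyl by simp
next
  case (comp g h)
  then show ?case
    by (simp only: o_inv_distrib[OF weyl_bij weyl_bij] weyl_comp)
qed

lemma weyl_inv_simps [simp]:
  assumes "g \<in> finite_weyl D" shows "g (inv_into UNIV g x) = x" "inv_into UNIV g (g x) = x"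
  using weyl_bij[OF assms] by (simp_all add: bij_is_surj surj_f_inv_f bij_is_inj)

lemma weyl_uminus: "g \<in> finite_weyl D \<Longrightarrow> g (- x) = - g x"
  using additive.minus[OF weyl_additive] .

lemma weyl_add: "g \<in> finite_weyl D \<Longrightarrow> g (x + y) = g x + g y"
  using additive.add[OF weyl_additive] .

abbreviation "W \<equiv> ext_weyl D"

lemma W_simps [simp]:
  "(g, x) \<in> carrier W \<longleftrightarrow> g \<in> finite_weyl D"
  "(g, x) \<otimes>\<^bsub>W\<^esub> (h, y) = (g \<circ> h, inv_into UNIV h x + y)"
  "\<one>\<^bsub>W\<^esub> = (id, 0)"
  by (simp_all add: ext_weyl_def)

lemma W_mult_closed: "w \<in> carrier W \<Longrightarrow> w' \<in> carrier W \<Longrightarrow> w \<otimes>\<^bsub>W\<^esub> w' \<in> carrier W"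
  by (cases w; cases w') (simp add: weyl_comp)

lemma W_assoc:
  assumes "u \<in> carrier W" "v \<in> carrier W" "w \<in> carrier W"
  shows "u \<otimes>\<^bsub>W\<^esub> v \<otimes>\<^bsub>W\<^esub> w = u \<otimes>\<^bsub>W\<^esub> (v \<otimes>\<^bsub>W\<^esub> w)"
proof -
  obtain g x h y k z where u: "u = (g, x)" "v = (h, y)" "w = (k, z)"
    by (cases u; cases v; cases w)
  then have "h \<in> finite_weyl D" "k \<in> finite_weyl D" using assms by simp_all
  then show ?thesis
    by (simp add: u o_assoc o_inv_distrib[OF weyl_bij weyl_bij] weyl_add[OF weyl_inv] add.assoc)
qed

definition sg :: "'x \<Rightarrow> int" where "sg \<gamma> = (if \<gamma> \<in> pos then 0 else 1)"

text \<open>Up to sign, \<open>height w \<gamma>\<close> counts the affine hyperplanes of direction \<open>\<gamma>\<close> that separate the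
  fundamental alcove from its image under the inverse of \<open>w\<close>. It is odd in \<open>\<gamma>\<close> and a cocycle in \<open>w\<close>, which is
  what makes lengths of products computable.\<close>

definition height :: "'x weyl_elt \<Rightarrow> 'x \<Rightarrow> int" where
  "height w \<gamma> = pr (snd w) (cr \<gamma>) + sg (fst w \<gamma>) - sg \<gamma>"

lemma sg_uminus: "\<gamma> \<in> \<Phi> \<Longrightarrow> sg (- \<gamma>) = 1 - sg \<gamma>"
  using root_cases[of \<gamma>] not_pos_and_neg[of \<gamma>] by (auto simp: sg_def)

lemma height_uminus:
  assumes "w \<in> carrier W" "\<gamma> \<in> \<Phi>" shows "height w (- \<gamma>) = - height w \<gamma>"
  using assms by (cases w) (simp add: height_def coroot_uminus sg_uminus weyl_uminus weyl_root)

lemma height_mult: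
  assumes "w \<in> carrier W" "(h, y) \<in> carrier W" "\<gamma> \<in> \<Phi>"
  shows "height (w \<otimes>\<^bsub>W\<^esub> (h, y)) \<gamma> = height w (h \<gamma>) + height (h, y) \<gamma>"
proof -
  obtain g x where w: "w = (g, x)" by (cases w)
  have "pr (inv_into UNIV h x) (cr \<gamma>) = pr x (cr (h \<gamma>))"
    using weyl_pairing[of h \<gamma> "inv_into UNIV h x"] assms by simp
  then show ?thesis by (simp add: w height_def)
qed

lemma sum_roots:
  fixes F :: "'x \<Rightarrow> int"
  assumes "\<And>\<gamma>. \<gamma> \<in> pos \<Longrightarrow> F (- \<gamma>) = F \<gamma>"
  shows "sum F \<Phi> = 2 * sum F pos"
proof -
  have R: "\<Phi> = pos \<union> uminus ` pos"
  proof
    show "\<Phi> \<subseteq> pos \<union> uminus ` pos" using root_cases by (force simp: image_iff)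
    show "pos \<union> uminus ` pos \<subseteq> \<Phi>" using pos_root uminus_root by blast
  qed
  have "pos \<inter> uminus ` pos = {}" using not_pos_and_neg by auto
  then have "sum F \<Phi> = sum F pos + sum F (uminus ` pos)"
    unfolding R using finite_pos by (simp add: sum.union_disjoint)
  also have "sum F (uminus ` pos) = sum F pos"
    using assms by (simp add: sum.reindex)
  finally show ?thesis by simp
qed

lemma len_height_pos:
  assumes "w \<in> carrier W" shows "int (len D w) = (\<Sum>\<gamma>\<in>pos. \<bar>height w \<gamma>\<bar>)"
proof -
  obtain g x where w: "w = (g, x)" by (cases w)
  have g: "g \<in> finite_weyl D" using assms w by simp
  let ?P = "{\<alpha>. \<alpha> \<in> pos \<and> g \<alpha> \<in> pos}" and ?M = "{\<alpha>. \<alpha> \<in> pos \<and> g \<alpha> \<in> negative_roots D}"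
  have d: "?P \<inter> ?M = {}" using not_pos_and_neg neg_iff by auto
  have u: "pos = ?P \<union> ?M" using roots_pos_neg weyl_root[OF g] pos_root by auto
  have fin: "finite ?P" "finite ?M" using finite_pos by auto
  have "(\<Sum>\<gamma>\<in>pos. \<bar>height w \<gamma>\<bar>) = (\<Sum>\<gamma>\<in>?P. \<bar>height w \<gamma>\<bar>) + (\<Sum>\<gamma>\<in>?M. \<bar>height w \<gamma>\<bar>)"
    by (subst u) (rule sum.union_disjoint[OF fin d])
  also have "(\<Sum>\<gamma>\<in>?P. \<bar>height w \<gamma>\<bar>) = (\<Sum>\<gamma>\<in>?P. \<bar>pr x (cr \<gamma>)\<bar>)"
    by (rule sum.cong) (auto simp: w height_def sg_def)
  also have "(\<Sum>\<gamma>\<in>?M. \<bar>height w \<gamma>\<bar>) = (\<Sum>\<gamma>\<in>?M. \<bar>1 + pr x (cr \<gamma>)\<bar>)"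
    by (rule sum.cong) (use d in \<open>auto simp: w height_def sg_def add.commute\<close>)
  finally show ?thesis by (simp add: w len_def)
qed

lemma len_height:
  assumes "w \<in> carrier W" shows "2 * int (len D w) = (\<Sum>\<gamma>\<in>\<Phi>. \<bar>height w \<gamma>\<bar>)"
  using len_height_pos[OF assms] sum_roots[of "\<lambda>\<gamma>. \<bar>height w \<gamma>\<bar>"] height_uminus[OF assms] pos_root by simp

text \<open>Here \<open>s\<close> is the reflection in a wall of the fundamental alcove, the only hyperplane it crosses, and
  \<open>\<alpha>\<close> is the direction of that wall, with the sign for which \<open>height w \<alpha> > 0\<close> means that \<open>s\<close> shortens
  \<open>w\<close>.\<close>

definition wall :: "'x \<Rightarrow> 'x weyl_elt \<Rightarrow> bool" where
  "wall \<alpha> s \<longleftrightarrow> \<alpha> \<in> \<Phi> \<and> fst s = rfl \<alpha> \<and> rfl \<alpha> (snd s) + snd s = 0 \<and>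
     (\<forall>\<gamma>\<in>\<Phi>. height s \<gamma> = (if \<gamma> = \<alpha> then 1 else if \<gamma> = - \<alpha> then - 1 else 0))"

lemma wall_carrier: "wall \<alpha> s \<Longrightarrow> s \<in> carrier W"
  by (cases s) (simp add: wall_def rfl_weyl)

lemma wall_cancel:
  assumes "wall \<alpha> s" "w \<in> carrier W" shows "w \<otimes>\<^bsub>W\<^esub> s \<otimes>\<^bsub>W\<^esub> s = w"
proof -
  obtain g x where w: "w = (g, x)" by (cases w)
  obtain y where s: "s = (rfl \<alpha>, y)" using assms(1) by (cases s) (simp add: wall_def)
  have a: "\<alpha> \<in> \<Phi>" "rfl \<alpha> y + y = 0" using assms(1) by (simp_all add: wall_def s)
  have i: "inv_into UNIV (rfl \<alpha>) = rfl \<alpha>" by (rule inv_equality) (use a in auto)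
  have "(g \<circ> rfl \<alpha>) \<circ> rfl \<alpha> = g" by (rule ext) (simp add: a(1))
  then show ?thesis using a by (simp add: w s i add.assoc)
qed

lemma len_wall:
  assumes s: "wall \<alpha> s" and w: "w \<in> carrier W"
  shows "int (len D (w \<otimes>\<^bsub>W\<^esub> s)) = int (len D w) + \<bar>height w \<alpha> - 1\<bar> - \<bar>height w \<alpha>\<bar>"
proof -
  obtain y where sy: "s = (rfl \<alpha>, y)" using s by (cases s) (simp add: wall_def)
  have a: "\<alpha> \<in> \<Phi>" and hs: "\<And>\<gamma>. \<gamma> \<in> \<Phi> \<Longrightarrow> height s \<gamma> = (if \<gamma> = \<alpha> then 1 else if \<gamma> = - \<alpha> then - 1 else 0)"
    using s by (simp_all add: wall_def)
  have ne: "\<alpha> \<noteq> - \<alpha>" using root_cases[OF a] not_pos_and_neg by force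
  have sc: "s \<in> carrier W" using wall_carrier[OF s] .
  have "2 * int (len D (w \<otimes>\<^bsub>W\<^esub> s)) = (\<Sum>\<gamma>\<in>\<Phi>. \<bar>height w (rfl \<alpha> \<gamma>) + height s \<gamma>\<bar>)"
    using len_height[OF W_mult_closed[OF w sc]] height_mult[OF w sc[unfolded sy]] by (simp add: sy)
  also have "\<dots> = (\<Sum>\<gamma>\<in>\<Phi>. \<bar>height w \<gamma> + height s (rfl \<alpha> \<gamma>)\<bar>)"
    using sum.reindex_bij_betw[OF bij_refl_roots[OF a], of "\<lambda>\<gamma>. \<bar>height w (rfl \<alpha> \<gamma>) + height s \<gamma>\<bar>"] a by simp
  also have "\<dots> = (\<Sum>\<gamma>\<in>\<Phi>. \<bar>height w \<gamma>\<bar> + (if \<gamma> = \<alpha> then \<bar>height w \<alpha> - 1\<bar> - \<bar>height w \<alpha>\<bar> else 0) +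
       (if \<gamma> = - \<alpha> then \<bar>height w (- \<alpha>) + 1\<bar> - \<bar>height w (- \<alpha>)\<bar> else 0))"
  proof (rule sum.cong[OF refl])
    fix \<gamma> assume g: "\<gamma> \<in> \<Phi>"
    have e: "rfl \<alpha> \<gamma> = \<alpha> \<longleftrightarrow> \<gamma> = - \<alpha>" "rfl \<alpha> \<gamma> = - \<alpha> \<longleftrightarrow> \<gamma> = \<alpha>"
      using refl_refl[OF a, of \<gamma>] refl_self[OF a] refl_uminus[of \<alpha> \<alpha>] by (metis minus_minus)+
    show "\<bar>height w \<gamma> + height s (rfl \<alpha> \<gamma>)\<bar> = \<bar>height w \<gamma>\<bar> + (if \<gamma> = \<alpha> then \<bar>height w \<alpha> - 1\<bar> - \<bar>height w \<alpha>\<bar> else 0) +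
       (if \<gamma> = - \<alpha> then \<bar>height w (- \<alpha>) + 1\<bar> - \<bar>height w (- \<alpha>)\<bar> else 0)"
      using hs[OF refl_root[OF a g]] ne by (auto simp: e)
  qed
  also have "\<dots> = 2 * int (len D w) + (\<bar>height w \<alpha> - 1\<bar> - \<bar>height w \<alpha>\<bar>) +
       (\<bar>height w (- \<alpha>) + 1\<bar> - \<bar>height w (- \<alpha>)\<bar>)"
    using finite_roots a uminus_root[OF a] len_height[OF w] by (simp add: sum.distrib)
  finally show ?thesis using height_uminus[OF w a] by simp
qed

lemma len_one: "len D (id, 0) = 0"
proof -
  have "{\<alpha>. \<alpha> \<in> pos \<and> \<alpha> \<in> negative_roots D} = {}" using not_pos_and_neg neg_iff by auto
  then have "sum F {\<alpha>. \<alpha> \<in> pos \<and> id \<alpha> \<in> negative_roots D} = 0" for F :: "'x \<Rightarrow> nat"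
    by (simp only: id_apply sum.empty)
  then show ?thesis by (simp add: len_def del: sum_eq_0_iff)
qed

lemma len_of_wall: assumes "wall \<alpha> s" shows "len D s = 1"
proof -
  obtain y where sy: "s = (rfl \<alpha>, y)" using assms by (cases s) (simp add: wall_def)
  have a: "\<alpha> \<in> \<Phi>" using assms by (simp add: wall_def)
  have "(id, 0) \<otimes>\<^bsub>W\<^esub> s = s"
    using additive.zero[OF weyl_additive[OF weyl_inv[OF rfl_weyl[OF a]]]] by (simp add: sy)
  then show ?thesis
    using len_wall[OF assms, of "(id, 0)"] weyl_id by (simp add: len_one height_def)
qed


lemma wall_simple: assumes b: "\<beta> \<in> B" shows "wall \<beta> (rfl \<beta>, 0)"
proof -
  have bR: "\<beta> \<in> \<Phi>" using simple_root[OF b] .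
  have c: "(rfl \<beta>, 0) \<in> carrier W" using rfl_weyl[OF bR] by simp
  have nb: "- \<beta> \<notin> pos" using not_pos_and_neg[OF simple_pos[OF b]] .
  have p: "height (rfl \<beta>, 0) \<gamma> = (if \<gamma> = \<beta> then 1 else 0)" if "\<gamma> \<in> pos" for \<gamma>
  proof (cases "\<gamma> = \<beta>")
    case True
    then show ?thesis using simple_pos[OF b] bR nb by (simp add: height_def sg_def)
  next
    case False
    then show ?thesis using refl_simple_pos[OF b that] that by (simp add: height_def sg_def)
  qed
  have "height (rfl \<beta>, 0) \<gamma> = (if \<gamma> = \<beta> then 1 else if \<gamma> = - \<beta> then - 1 else 0)" if g: "\<gamma> \<in> \<Phi>" for \<gamma>
    using root_cases[OF g]
  proof
    assume "\<gamma> \<in> pos"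
    then show ?thesis using p nb by auto
  next
    assume m: "- \<gamma> \<in> pos"
    then show ?thesis using p[OF m] nb simple_pos[OF b] not_pos_and_neg[OF m] height_uminus[OF c g]
      by (auto simp: minus_equation_iff)
  qed
  then show ?thesis using bR by (simp add: wall_def)
qed

text \<open>If two distinct roots pair to at least \<open>2\<close> both ways, then their difference is orthogonal to every
  coroot, and the product of the two reflections moves one of them by twice that difference again and
  again, which is impossible in a finite set.\<close>

lemma pairing_both_ge_2:
  assumes R: "\<theta> \<in> \<Phi>" "\<gamma> \<in> \<Phi>" and p: "pr \<theta> (cr \<gamma>) \<ge> 2" and q: "pr \<gamma> (cr \<theta>) \<ge> 2"
  shows "\<gamma> = \<theta>"
proof -
  define u where "u = \<gamma> - \<theta>"
  have ft: "form \<theta> \<theta> > 0" "form \<gamma> \<gamma> > 0" using form_root_pos R by auto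
  have 1: "2 * form \<gamma> \<theta> = pr \<gamma> (cr \<theta>) * form \<theta> \<theta>" "2 * form \<gamma> \<theta> = pr \<theta> (cr \<gamma>) * form \<gamma> \<gamma>"
    using form_root[OF R(1), of \<gamma>] form_root[OF R(2), of \<theta>] by (simp_all add: form_commute)
  have "pr \<gamma> (cr \<theta>) * form \<theta> \<theta> \<ge> 2 * form \<theta> \<theta>" "pr \<theta> (cr \<gamma>) * form \<gamma> \<gamma> \<ge> 2 * form \<gamma> \<gamma>"
    using p q ft by simp_all
  then have "form u u \<le> 0" using 1 by (simp add: u_def form_commute)
  moreover have "form u u = (\<Sum>\<delta>\<in>\<Phi>. (pr u (cr \<delta>))\<^sup>2)" by (simp add: form_def power2_eq_square)
  ultimately have "(\<Sum>\<delta>\<in>\<Phi>. (pr u (cr \<delta>))\<^sup>2) = 0" by (simp add: order_antisym sum_nonneg)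
  then have u0: "pr u (cr \<delta>) = 0" if "\<delta> \<in> \<Phi>" for \<delta>
    using that finite_roots by (simp add: sum_nonneg_eq_0_iff)
  have it: "\<theta> + zmul (2 * int m) u \<in> \<Phi>" for m
  proof (induction m)
    case 0
    then show ?case using R by (simp add: zmul_def)
  next
    case (Suc m)
    have 2: "pr \<theta> (cr \<gamma>) = 2" using u0[OF R(2)] R by (simp add: u_def)
    have "rfl \<gamma> (rfl \<theta> (\<theta> + zmul (2 * int m) u)) = \<theta> + zmul (2 * int (Suc m)) u"
      by (rule pr_eqI_left)
        (simp add: pr_refl u0 R 2 algebra_simps, simp add: u_def algebra_simps)
    then show ?case using refl_root[OF R(2) refl_root[OF R(1) Suc.IH]] by simp
  qed
  have "\<not> inj (\<lambda>m. \<theta> + zmul (2 * int m) u)"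
    using finite_subset[OF image_subsetI finite_roots, of UNIV "\<lambda>m. \<theta> + zmul (2 * int m) u"] it
      finite_imageD by auto
  then obtain m n where mn: "m \<noteq> n" "zmul (2 * int m) u = zmul (2 * int n) u" by (auto simp: inj_def)
  have "pr u y = 0" for y
  proof -
    have "2 * int m * pr u y = 2 * int n * pr u y"
      using arg_cong[OF mn(2), of "\<lambda>x. pr x y"] by simp
    then show ?thesis using mn(1) by simp
  qed
  then have "u = 0" by (intro pr_eqI_left) simp
  then show ?thesis by (simp add: u_def)
qed

lemma minimal_coroot:
  assumes "\<alpha> \<in> minimal_coroot_roots D"
  shows "\<alpha> \<in> \<Phi>" "\<And>\<delta>. \<delta> \<in> \<Phi> \<Longrightarrow> cr \<alpha> - cr \<delta> \<in> N \<Longrightarrow> \<delta> = \<alpha>"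
  using assms inj_coroot
  by (auto simp: minimal_coroot_roots_def coroots_def coroot_le_def inj_on_def)

text \<open>The affine wall. The negative of a minimal coroot is a maximal one; its root pairs to \<open>0\<close> or \<open>1\<close>
  with every other positive coroot, and when it pairs to \<open>1\<close> the reflection makes the other root negative.
  The two contributions to \<open>height\<close> then cancel.\<close>

lemma wall_minimal:
  assumes m: "\<alpha> \<in> minimal_coroot_roots D" shows "wall \<alpha> (rfl \<alpha>, \<alpha>)"
proof -
  note aR = minimal_coroot(1)[OF m] and amin = minimal_coroot(2)[OF m]
  have c: "(rfl \<alpha>, \<alpha>) \<in> carrier W" using rfl_weyl[OF aR] by simp
  have na: "- \<alpha> \<in> pos"
  proof (rule ccontr)
    assume "- \<alpha> \<notin> pos"
    then have "\<alpha> \<in> pos" using root_cases[OF aR] by blast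
    have "cr \<alpha> - cr (- \<alpha>) = cr \<alpha> + cr \<alpha>" by (simp add: coroot_uminus[OF aR])
    also have "\<dots> \<in> N" using coroot_pos_N[OF \<open>\<alpha> \<in> pos\<close>] by (intro N_add)
    finally have "- \<alpha> = \<alpha>" by (rule amin[OF uminus_root[OF aR]])
    then show False using \<open>\<alpha> \<in> pos\<close> \<open>- \<alpha> \<notin> pos\<close> by simp
  qed
  then have ap: "\<alpha> \<notin> pos" using not_pos_and_neg by blast
  have maN: "- cr \<alpha> \<in> N" using coroot_pos_N[OF na] coroot_uminus[OF aR] by simp
  have dom: "pr (- \<alpha>) (cr \<beta>) \<ge> 0" if b: "\<beta> \<in> B" for \<beta>
  proof (rule ccontr)
    note bR = simple_root[OF b]
    assume n: "\<not> ?thesis"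
    then have "pr \<beta> (cr \<alpha>) > 0" using pairing_sign[OF aR bR] by simp
    moreover have "cr \<alpha> - cr (rfl \<beta> \<alpha>) = zmul (pr \<beta> (cr \<alpha>)) (cr \<beta>)"
      by (rule pr_eqI_right) (simp add: coroot_refl[OF bR aR] pr_corefl pr_refl)
    ultimately have "rfl \<beta> \<alpha> = \<alpha>"
      using amin[OF refl_root[OF bR aR]] N_zmul[OF coroot_simple_N[OF b]] by simp
    from arg_cong[OF this, of "\<lambda>x. pr x (cr \<beta>)"] show False
      using n bR by (simp add: pr_refl)
  qed
  have h: "height (rfl \<alpha>, \<alpha>) \<gamma> = (if \<gamma> = - \<alpha> then - 1 else 0)" if g: "\<gamma> \<in> pos" for \<gamma>
  proof (cases "\<gamma> = - \<alpha>")
    case True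
    then show ?thesis using g aR ap by (simp add: height_def sg_def coroot_uminus[OF aR])
  next
    case False
    note gR = pos_root[OF g]
    have not_le: "cr \<alpha> + cr \<gamma> \<notin> N"
    proof
      assume "cr \<alpha> + cr \<gamma> \<in> N"
      then have "- \<gamma> = \<alpha>" using amin[OF uminus_root[OF gR]] by (simp add: coroot_uminus[OF gR])
      then show False using False by (metis minus_minus)
    qed
    define p where "p = - pr \<alpha> (cr \<gamma>)"
    have p0: "p \<ge> 0" using N_nonneg[OF coroot_pos_N[OF g], of "- \<alpha>"] dom by (simp add: p_def)
    have cs: "cr (rfl \<alpha> \<gamma>) = cr \<gamma> + zmul p (cr \<alpha>)"
      by (rule pr_eqI_right) (simp add: coroot_refl[OF aR gR] pr_corefl pr_refl p_def)
    show ?thesis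
    proof (cases "p = 0")
      case True
      then have "pr \<gamma> (cr \<alpha>) = 0" using pairing_sign(2)[OF aR gR] by (simp add: p_def)
      then have "rfl \<alpha> \<gamma> = \<gamma>" by (intro pr_eqI_left) (simp add: pr_refl)
      then show ?thesis using True False by (simp add: height_def p_def)
    next
      case p1: False
      have sn: "rfl \<alpha> \<gamma> \<notin> pos"
      proof
        assume "rfl \<alpha> \<gamma> \<in> pos"
        from coroot_pos_N[OF this] have "cr \<gamma> + zmul p (cr \<alpha>) \<in> N" by (simp add: cs)
        moreover have "cr \<alpha> + cr \<gamma> = (cr \<gamma> + zmul p (cr \<alpha>)) + zmul (p - 1) (- cr \<alpha>)"
          by (rule pr_eqI_right) (simp add: algebra_simps)
        moreover have "zmul (p - 1) (- cr \<alpha>) \<in> N" using p0 p1 by (intro N_zmul maN) simp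
        ultimately show False using not_le N_add by metis
      qed
      have "p < 2"
      proof (rule ccontr)
        assume "\<not> p < 2"
        then have p2: "p \<ge> 2" by simp
        define q where "q = - pr \<gamma> (cr \<alpha>)"
        have ng: "- \<alpha> \<in> \<Phi>" using uminus_root[OF aR] .
        have q1: "q \<ge> 1" using pairing_sign(1)[OF ng gR] p2 coroot_uminus[OF aR] by (simp add: p_def q_def)
        have q: "q = 1"
        proof (rule ccontr)
          assume "q \<noteq> 1"
          then have "\<gamma> = - \<alpha>"
            using pairing_both_ge_2[OF ng gR] p2 q1 coroot_uminus[OF aR] by (simp add: p_def q_def)
          then show False using False by simp
        qed
        have "cr (rfl \<gamma> \<alpha>) = cr \<alpha> + cr \<gamma>"
          using q by (intro pr_eqI_right) (simp add: coroot_refl[OF gR aR] pr_corefl pr_refl q_def)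
        then have "- rfl \<gamma> \<alpha> \<in> pos" "cr (- rfl \<gamma> \<alpha>) = - (cr \<alpha> + cr \<gamma>)"
          using not_le root_cases[OF refl_root[OF gR aR]] coroot_pos_N[of "rfl \<gamma> \<alpha>"]
            coroot_uminus[OF refl_root[OF gR aR]] by auto
        then have n: "- (cr \<alpha> + cr \<gamma>) \<in> N" using coroot_pos_N by metis
        have "cr \<alpha> - cr (rfl \<alpha> \<gamma>) = - (cr \<alpha> + cr \<gamma>) + zmul (p - 2) (- cr \<alpha>)"
          unfolding cs by (rule pr_eqI_right) (simp add: algebra_simps)
        then have "rfl \<alpha> \<gamma> = \<alpha>"
          using amin[OF refl_root[OF aR gR]] N_add[OF n N_zmul[OF maN, of "p - 2"]] p2 by simp
        then have "\<gamma> = - \<alpha>" using refl_refl[OF aR, of \<gamma>] aR by simp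
        then show False using False by simp
      qed
      then show ?thesis using p0 p1 sn g False by (simp add: height_def sg_def p_def)
    qed
  qed
  have "height (rfl \<alpha>, \<alpha>) \<gamma> = (if \<gamma> = \<alpha> then 1 else if \<gamma> = - \<alpha> then - 1 else 0)" if g: "\<gamma> \<in> \<Phi>" for \<gamma>
    using root_cases[OF g]
  proof
    assume "\<gamma> \<in> pos"
    then show ?thesis using h ap by auto
  next
    assume m: "- \<gamma> \<in> pos"
    then show ?thesis using h[OF m] ap na not_pos_and_neg[OF m] height_uminus[OF c g] by auto
  qed
  then show ?thesis using aR by (simp add: wall_def)
qed

lemma minimal_coroot_below:
  assumes "\<gamma> \<in> \<Phi>" shows "\<exists>\<alpha>\<in>minimal_coroot_roots D. cr \<gamma> - cr \<alpha> \<in> N"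
proof -
  let ?S = "{\<delta> \<in> \<Phi>. cr \<gamma> - cr \<delta> \<in> N}"
  have "0 \<in> N" using N_zmul[of _ 0] coroot_simple_N coroot_pos_N root_cases assms by (metis zmul_def diff_self lessThan_0 minus_zero nat_0 sum.empty order_refl)
  then have "\<gamma> \<in> ?S" "finite ?S" using assms finite_roots by auto
  then obtain \<alpha> where a: "\<alpha> \<in> ?S" and min: "\<And>\<delta>. \<delta> \<in> ?S \<Longrightarrow> pr two_rho (cr \<alpha>) \<le> pr two_rho (cr \<delta>)"
    using ex_min_if_finite[of "(\<lambda>\<delta>. pr two_rho (cr \<delta>)) ` ?S"] by (fastforce simp: not_less)
  have "cr \<delta> = cr \<alpha>" if d: "\<delta> \<in> \<Phi>" "cr \<alpha> - cr \<delta> \<in> N" for \<delta>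
  proof -
    have "cr \<gamma> - cr \<delta> = (cr \<gamma> - cr \<alpha>) + (cr \<alpha> - cr \<delta>)" by simp
    then have "\<delta> \<in> ?S" using a d N_add by (metis (no_types, lifting) mem_Collect_eq)
    from min[OF this] two_rho_N_zero[OF d(2)] show ?thesis by simp
  qed
  then have "\<alpha> \<in> minimal_coroot_roots D" using a
    by (auto simp: minimal_coroot_roots_def coroots_def coroot_le_def)
  then show ?thesis using a by blast
qed

text \<open>For large \<open>K\<close> the point \<open>2\<rho>/K\<close> lies inside the fundamental alcove, and its image under the inverse of
  \<open>w\<close> determines the sign of every \<open>height w \<gamma>\<close>. If no wall has positive height, this image satisfies the
  inequalities that define the fundamental alcove; these imply the inequalities for all roots, so that no
  hyperplane separates the two alcoves.\<close>

lemma length_zero_if_no_descent: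
  assumes w: "w \<in> carrier W"
    and simple: "\<And>\<beta>. \<beta> \<in> B \<Longrightarrow> height w \<beta> \<le> 0"
    and aff: "\<And>\<alpha>. \<alpha> \<in> minimal_coroot_roots D \<Longrightarrow> height w \<alpha> \<le> 0"
  shows "len D w = 0"
proof -
  obtain g x where wg: "w = (g, x)" by (cases w)
  have g: "g \<in> finite_weyl D" using w wg by simp
  define h where "h \<gamma> = pr (inv_into UNIV g two_rho) (cr \<gamma>)" for \<gamma>
  have h: "h \<gamma> = pr two_rho (cr (g \<gamma>))" if "\<gamma> \<in> \<Phi>" for \<gamma>
    using weyl_pairing[OF g that, of "inv_into UNIV g two_rho"] g by (simp add: h_def)
  have h0: "h \<gamma> \<noteq> 0" if "\<gamma> \<in> \<Phi>" for \<gamma>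
    using two_rho_root_nonzero[OF weyl_root[OF g that]] h[OF that] by simp
  define K where "K = (\<Sum>\<gamma>\<in>\<Phi>. \<bar>h \<gamma>\<bar>) + 1"
  have K: "\<bar>h \<gamma>\<bar> < K" if "\<gamma> \<in> \<Phi>" for \<gamma>
    using member_le_sum[OF that, of "\<lambda>\<gamma>. \<bar>h \<gamma>\<bar>"] finite_roots by (simp add: K_def)
  \<comment> \<open>\<open>- K\<close> times the image of the point \<open>2\<rho>/K\<close> under the inverse of \<open>w\<close>\<close>
  define z where "z = zmul K x - inv_into UNIV g two_rho"
  have z: "pr z (cr \<gamma>) = K * pr x (cr \<gamma>) - h \<gamma>" for \<gamma> by (simp add: z_def h_def)
  have sgh: "sg (g \<gamma>) = (if h \<gamma> > 0 then 0 else 1)" if "\<gamma> \<in> \<Phi>" for \<gamma>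
    using pos_iff_two_rho[OF weyl_root[OF g that]] h[OF that] by (simp add: sg_def)
  have key: "n + (if h \<gamma> > 0 then 0 else 1) \<le> 0 \<longleftrightarrow> K * n - h \<gamma> < 0" if "\<gamma> \<in> \<Phi>" for \<gamma> n
  proof -
    have "K > 0" using K[OF that] by linarith
    consider "n \<le> - 1" | "n = 0" | "n \<ge> 1" by linarith
    then show ?thesis
    proof cases
      case 1
      then have "K * n \<le> K * (- 1)" using \<open>K > 0\<close> by (intro mult_left_mono) auto
      then show ?thesis using 1 K[OF that] by auto
    next
      case 2
      then show ?thesis using h0[OF that] by auto
    next
      case 3
      then have "K * 1 \<le> K * n" using \<open>K > 0\<close> by (intro mult_left_mono) auto
      then show ?thesis using 3 K[OF that] by auto
    qed
  qed
  have le_pos: "height w \<gamma> \<le> 0 \<longleftrightarrow> pr z (cr \<gamma>) < 0" if p: "\<gamma> \<in> pos" for \<gamma>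
    using key[OF pos_root[OF p], of "pr x (cr \<gamma>)"] sgh[OF pos_root[OF p]] p
    by (simp add: wg height_def z sg_def[of \<gamma>])
  have le_neg: "height w \<gamma> \<le> 0 \<longleftrightarrow> pr z (cr \<gamma>) < K" if p: "- \<gamma> \<in> pos" "\<gamma> \<in> \<Phi>" for \<gamma>
    using key[OF p(2), of "pr x (cr \<gamma>) - 1"] not_pos_and_neg[of \<gamma>] sgh[OF p(2)] p
    by (auto simp: wg height_def z sg_def[of \<gamma>] right_diff_distrib split: if_splits)
  have zs: "pr (- z) (cr \<beta>) \<ge> 0" if "\<beta> \<in> B" for \<beta>
    using simple[OF that] le_pos[OF simple_pos[OF that]] by simp
  have zN: "pr z y \<le> 0" if "y \<in> N" for y
    using N_nonneg[OF that, of "- z"] zs by simp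
  have np: "height w (- \<gamma>) \<le> 0" if p: "\<gamma> \<in> pos" for \<gamma>
  proof -
    note gR = uminus_root[OF pos_root[OF p]]
    obtain \<alpha> where a: "\<alpha> \<in> minimal_coroot_roots D" "cr (- \<gamma>) - cr \<alpha> \<in> N"
      using minimal_coroot_below[OF gR] by blast
    note aR = minimal_coroot(1)[OF a(1)]
    have "pr two_rho (cr \<alpha>) \<le> pr two_rho (cr (- \<gamma>))" using two_rho_N[OF a(2)] by simp
    also have "\<dots> < 0" using p pos_iff_two_rho[OF pos_root[OF p]] coroot_uminus[OF pos_root[OF p]] by simp
    finally have "- \<alpha> \<in> pos" using root_cases[OF aR] pos_iff_two_rho[OF aR] by auto
    then have "pr z (cr \<alpha>) < K" using le_neg aff[OF a(1)] aR by blast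
    then have "pr z (cr (- \<gamma>)) < K" using zN[OF a(2)] by simp
    then show ?thesis using le_neg[of "- \<gamma>"] p gR by simp
  qed
  have pp: "height w \<gamma> \<le> 0" if p: "\<gamma> \<in> pos" for \<gamma>
  proof -
    have "pr z (cr \<gamma>) < 0"
    proof -
      obtain c :: "'x \<Rightarrow> nat" where c: "cr \<gamma> = (\<Sum>i\<in>B. zmul (int (c i)) (cr i))"
        using coroot_pos_N[OF p] by (auto simp: nat_span_def)
      have zb: "pr z (cr i) < 0" if "i \<in> B" for i
        using simple[OF that] le_pos[OF simple_pos[OF that]] by simp
      have "\<exists>i\<in>B. c i \<noteq> 0"
      proof (rule ccontr)
        assume "\<not> ?thesis"
        then have "cr \<gamma> = 0" by (subst c) (simp add: zmul_def)
        then show False using coroot_nonzero[OF pos_root[OF p]] by simp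
      qed
      then obtain i where i: "i \<in> B" "c i \<noteq> 0" by blast
      have "(\<Sum>i\<in>B. int (c i) * (- pr z (cr i))) > 0"
        using i zb by (intro sum_pos2[OF finite_simples i(1)]) (auto simp: mult_nonneg_nonpos mult_pos_neg less_imp_le)
      then show ?thesis by (subst c) (simp add: pr_sum_right sum_negf)
    qed
    then show ?thesis using le_pos[OF p] by simp
  qed
  have "height w \<gamma> = 0" if "\<gamma> \<in> pos" for \<gamma>
    using pp[OF that] np[OF that] height_uminus[OF w pos_root[OF that]] by simp
  then show ?thesis using len_height_pos[OF w] by simp
qed


lemma exists_descent:
  assumes w: "w \<in> carrier W" and l: "len D w > 0"
  obtains s \<alpha> where "s \<in> simple_reflections D" "wall \<alpha> s" "len D (w \<otimes>\<^bsub>W\<^esub> s) + 1 = len D w"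
proof -
  have "\<exists>\<alpha> s. s \<in> simple_reflections D \<and> wall \<alpha> s \<and> height w \<alpha> > 0"
  proof (rule ccontr)
    assume n: "\<not> ?thesis"
    have 1: "height w \<beta> \<le> 0" if "\<beta> \<in> B" for \<beta>
    proof -
      have "(rfl \<beta>, 0) \<in> simple_reflections D" using that unfolding simple_reflections_def by blast
      then show ?thesis using n wall_simple[OF that] by (meson not_less)
    qed
    have 2: "height w \<alpha> \<le> 0" if "\<alpha> \<in> minimal_coroot_roots D" for \<alpha>
    proof -
      have "(rfl \<alpha>, \<alpha>) \<in> simple_reflections D" using that unfolding simple_reflections_def by blast
      then show ?thesis using n wall_minimal[OF that] by (meson not_less)
    qed
    show False using length_zero_if_no_descent[OF w 1 2] l by simp
  qed
  then obtain \<alpha> s where s: "s \<in> simple_reflections D" "wall \<alpha> s" "height w \<alpha> > 0" by blast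
  then have "len D (w \<otimes>\<^bsub>W\<^esub> s) + 1 = len D w" using len_wall[OF s(2) w] by linarith
  with s show thesis using that by blast
qed

lemma simple_reflection_wall: "s \<in> simple_reflections D \<Longrightarrow> \<exists>\<alpha>. wall \<alpha> s"
  using wall_simple wall_minimal unfolding simple_reflections_def by blast

text \<open>As every element of positive length has a descent, statements about \<open>W\<close> need to be checked only at
  length zero and under length-adding multiplication by a simple reflection.\<close>

lemma length_induct [consumes 1, case_names zero step]:
  assumes w: "w \<in> carrier W"
    and zero: "\<And>u. u \<in> carrier W \<Longrightarrow> len D u = 0 \<Longrightarrow> P u"
    and step: "\<And>w s. w \<in> carrier W \<Longrightarrow> s \<in> simple_reflections D \<Longrightarrow> s \<in> carrier W \<Longrightarrow>
      len D (w \<otimes>\<^bsub>W\<^esub> s) = len D w + len D s \<Longrightarrow> P w \<Longrightarrow> P (w \<otimes>\<^bsub>W\<^esub> s)"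
  shows "P w"
  using w
proof (induction "len D w" arbitrary: w rule: less_induct)
  case less
  show ?case
  proof (cases "len D w = 0")
    case True
    then show ?thesis using zero less.prems by blast
  next
    case False
    then obtain s \<alpha> where s: "s \<in> simple_reflections D" "wall \<alpha> s" "len D (w \<otimes>\<^bsub>W\<^esub> s) + 1 = len D w"
      using exists_descent[OF less.prems] by blast
    have sc: "s \<in> carrier W" using wall_carrier[OF s(2)] .
    have c: "w \<otimes>\<^bsub>W\<^esub> s \<in> carrier W" using W_mult_closed[OF less.prems sc] .
    have "P (w \<otimes>\<^bsub>W\<^esub> s \<otimes>\<^bsub>W\<^esub> s)"
      using step[OF c s(1) sc] less.hyps[OF _ c] s(3) len_of_wall[OF s(2)] wall_cancel[OF s(2) less.prems] by simp
    then show ?thesis using wall_cancel[OF s(2) less.prems] by simp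
  qed
qed

lemma word_prod_carrier: "set ss \<subseteq> simple_reflections D \<Longrightarrow> word_prod D ss \<in> carrier W"
proof (induction ss)
  case Nil
  then show ?case using weyl_id by (simp add: word_prod_def)
next
  case (Cons s ss)
  then obtain \<alpha> where "wall \<alpha> s" using simple_reflection_wall[of s] Cons.prems by auto
  then have "s \<otimes>\<^bsub>W\<^esub> word_prod D ss \<in> carrier W"
    using Cons wall_carrier by (intro W_mult_closed) auto
  then show ?case by (simp add: word_prod_def)
qed

lemma word_prod_snoc:
  assumes "set ss \<subseteq> simple_reflections D" "s \<in> carrier W"
  shows "word_prod D (ss @ [s]) = word_prod D ss \<otimes>\<^bsub>W\<^esub> s"
  using assms(1)
proof (induction ss)
  case Nil
  obtain h y where s: "s = (h, y)" by (cases s)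
  then have "h \<in> finite_weyl D" using assms(2) by simp
  then show ?case
    using additive.zero[OF weyl_additive[OF weyl_inv]] additive.zero[OF additive_rfl]
    by (simp add: word_prod_def s inv_into_def)
next
  case (Cons r ss)
  then obtain \<alpha> where "wall \<alpha> r" using simple_reflection_wall[of r] Cons.prems by auto
  then have "r \<in> carrier W" by (rule wall_carrier)
  then show ?case using Cons W_assoc[OF _ word_prod_carrier assms(2)] by (simp add: word_prod_def)
qed

lemma reduced_decomposition:
  assumes "w \<in> carrier W"
  shows "\<exists>u ss. u \<in> Omega D \<and> reduced_word D ss \<and> w = u \<otimes>\<^bsub>W\<^esub> word_prod D ss"
proof -
  have "\<exists>u ss. u \<in> Omega D \<and> set ss \<subseteq> simple_reflections D \<and> w = u \<otimes>\<^bsub>W\<^esub> word_prod D ss"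
    using assms
  proof (induction rule: length_induct)
    case (zero u)
    then have "u \<otimes>\<^bsub>W\<^esub> word_prod D [] = u" by (cases u) (simp add: word_prod_def)
    with zero show ?case by (intro exI[of _ u] exI[of _ "[]"]) (simp add: Omega_def)
  next
    case (step w s)
    then obtain u ss where u: "u \<in> Omega D" "set ss \<subseteq> simple_reflections D" "w = u \<otimes>\<^bsub>W\<^esub> word_prod D ss" by blast
    have "w \<otimes>\<^bsub>W\<^esub> s = u \<otimes>\<^bsub>W\<^esub> word_prod D (ss @ [s])"
      using u W_assoc[OF _ word_prod_carrier[OF u(2)] step(3), of u]
      by (simp add: word_prod_snoc[OF u(2) step(3)] Omega_def)
    then show ?case using u(1,2) step(2) by (intro exI[of _ u] exI[of _ "ss @ [s]"]) simp
  qed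
  then obtain u ss where u: "u \<in> Omega D" and ss: "set ss \<subseteq> simple_reflections D" "w = u \<otimes>\<^bsub>W\<^esub> word_prod D ss" by blast
  let ?Q = "\<lambda>ts. set ts \<subseteq> simple_reflections D \<and> word_prod D ts = word_prod D ss"
  have "?Q (arg_min length ?Q) \<and> (\<forall>ts. ?Q ts \<longrightarrow> length (arg_min length ?Q) \<le> length ts)"
    by (rule arg_min_nat_lemma[of ?Q ss]) (use ss in simp)
  then obtain ts where ts: "?Q ts" "\<And>rs. ?Q rs \<Longrightarrow> length ts \<le> length rs" by blast
  have "reduced_word D ts" unfolding reduced_word_def using ts by auto
  moreover have "w = u \<otimes>\<^bsub>W\<^esub> word_prod D ts" using ts(1) ss(2) by simp
  ultimately show ?thesis using u by (intro exI conjI)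
qed

text \<open>Since decompositions exist, the one chosen in the definition of \<open>q_exponent\<close> is genuine. Hence only
  weights of simple reflections occur, and the normalizing monomials are units of the Laurent ring.\<close>

lemma keys_q_exponent:
  assumes "w \<in> carrier W"
  shows "Poly_Mapping.keys (q_exponent D w) \<subseteq> conj_class D ` simple_reflections D"
proof -
  have k: "Poly_Mapping.keys (\<Sum>s\<leftarrow>ss. Poly_Mapping.single (conj_class D s) (1::int)) \<subseteq> conj_class D ` S"
    if "set ss \<subseteq> S" for ss S
    using that
  proof (induction ss)
    case (Cons s ss)
    then show ?case
      using keys_add[of "Poly_Mapping.single (conj_class D s) (1::int)" "\<Sum>s\<leftarrow>ss. Poly_Mapping.single (conj_class D s) 1"]
      by auto
  qed simp
  let ?Q = "\<lambda>(u, ss). u \<in> Omega D \<and> reduced_word D ss \<and> w = u \<otimes>\<^bsub>W\<^esub> word_prod D ss"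
  obtain u ss where u: "(SOME p. ?Q p) = (u, ss)" by (cases "SOME p. ?Q p")
  have "\<exists>p. ?Q p" using reduced_decomposition[OF assms] by auto
  from someI_ex[OF this] have "reduced_word D ss" unfolding u by simp
  then show ?thesis unfolding q_exponent_def u Let_def case_prod_conv
    by (intro k) (simp add: reduced_word_def)
qed

lemma length_zero_inverse:
  assumes "u \<in> carrier W" "len D u = 0"
  shows "\<exists>v\<in>carrier W. len D v = 0 \<and> u \<otimes>\<^bsub>W\<^esub> v = \<one>\<^bsub>W\<^esub> \<and> v \<otimes>\<^bsub>W\<^esub> u = \<one>\<^bsub>W\<^esub>"
proof -
  obtain g x where u: "u = (g, x)" by (cases u)
  have g: "g \<in> finite_weyl D" using assms u by simp
  let ?h = "inv_into UNIV g"
  have hW: "?h \<in> finite_weyl D" using weyl_inv[OF g] .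
  have ih: "inv_into UNIV ?h = g" using inv_inv_eq[OF weyl_bij[OF g]] .
  have gh: "g \<circ> ?h = id" "?h \<circ> g = id" using g by (auto simp: fun_eq_iff)
  define v where "v = (?h, - g x)"
  have vc: "v \<in> carrier W" using hW by (simp add: v_def)
  have uv: "u \<otimes>\<^bsub>W\<^esub> v = (id, 0)" by (simp add: u v_def ih gh)
  have vu: "v \<otimes>\<^bsub>W\<^esub> u = (id, 0)" using g by (simp add: u v_def gh weyl_uminus[OF hW])
  have "height u \<gamma> = 0" if "\<gamma> \<in> \<Phi>" for \<gamma>
    using len_height[OF assms(1)] assms(2) that finite_roots by (simp add: sum_nonneg_eq_0_iff)
  then have "height v \<gamma> = 0" if "\<gamma> \<in> pos" for \<gamma>
    using height_mult[OF assms(1) vc[unfolded v_def] pos_root[OF that]] uv weyl_root[OF hW pos_root[OF that]]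
    by (simp add: v_def height_def)
  then have "len D v = 0" using len_height_pos[OF vc] by simp
  then show ?thesis using uv vu vc by auto
qed

lemma dominant_coroot: "dominant D x \<Longrightarrow> \<gamma> \<in> pos \<Longrightarrow> pr x (cr \<gamma>) \<ge> 0"
  using N_nonneg[OF coroot_pos_N] by (simp add: dominant_def)

lemma dominant_add: "dominant D x \<Longrightarrow> dominant D y \<Longrightarrow> dominant D (x + y)"
  by (simp add: dominant_def)

text \<open>Any element becomes dominant after adding a large multiple of \<open>2\<rho>\<close>.\<close>

lemma dominant_difference: "\<exists>y z. dominant D y \<and> dominant D z \<and> x = y - z"
proof -
  define n where "n = (\<Sum>\<beta>\<in>B. \<bar>pr x (cr \<beta>)\<bar>)"
  have n: "\<bar>pr x (cr \<beta>)\<bar> \<le> n" if "\<beta> \<in> B" for \<beta>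
    using member_le_sum[OF that, of "\<lambda>\<beta>. \<bar>pr x (cr \<beta>)\<bar>"] finite_simples by (simp add: n_def)
  let ?z = "zmul n two_rho"
  have "dominant D ?z" "dominant D (x + ?z)"
    using n by (fastforce simp: dominant_def two_rho_simple)+
  then show ?thesis by (intro exI[of _ "x + ?z"] exI[of _ ?z]) simp
qed

lemma translation_carrier: "translation x \<in> carrier W"
  using weyl_id by (simp add: translation_def)

lemma translation_mult: "translation x \<otimes>\<^bsub>W\<^esub> translation y = translation (x + y)"
  by (simp add: translation_def inv_id)

lemma len_translation_add:
  assumes "dominant D x" "dominant D y"
  shows "len D (translation (x + y)) = len D (translation x) + len D (translation y)"
proof -
  have "int (len D (translation z)) = (\<Sum>\<gamma>\<in>pos. pr z (cr \<gamma>))" if "dominant D z" for z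
    unfolding len_height_pos[OF translation_carrier]
    by (rule sum.cong) (use dominant_coroot[OF that] in \<open>auto simp: height_def translation_def\<close>)
  from this[OF assms(1)] this[OF assms(2)] this[OF dominant_add[OF assms]] show ?thesis
    by (simp add: sum.distrib)
qed

end

section \<open>The commutative subalgebra\<close>

lemma (in monoid) unit_commute_inv:
  assumes "x \<in> carrier G" "y \<in> Units G" "x \<otimes> y = y \<otimes> x"
  shows "x \<otimes> inv y = inv y \<otimes> x"
proof -
  have y: "y \<in> carrier G" "inv y \<in> carrier G" using assms(2) by auto
  have "inv y \<otimes> x = inv y \<otimes> (x \<otimes> y) \<otimes> inv y"
    using assms(1,2) y by (simp add: m_assoc)
  also have "\<dots> = (inv y \<otimes> y) \<otimes> x \<otimes> inv y"
    using assms y by (simp only: assms(3) m_assoc m_closed)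
  also have "\<dots> = x \<otimes> inv y" using assms y by simp
  finally show ?thesis by simp
qed

lemma (in monoid) inv_mult_units:
  assumes "x \<in> Units G" "y \<in> Units G"
  shows "inv (x \<otimes> y) = inv y \<otimes> inv x"
proof (rule inv_unique'[symmetric])
  have c: "x \<in> carrier G" "y \<in> carrier G" "inv x \<in> carrier G" "inv y \<in> carrier G" using assms by auto
  show "x \<otimes> y \<in> carrier G" "inv y \<otimes> inv x \<in> carrier G" using c by auto
  have "x \<otimes> y \<otimes> (inv y \<otimes> inv x) = x \<otimes> (y \<otimes> inv y) \<otimes> inv x" using c by (simp only: m_assoc m_closed)
  then show "x \<otimes> y \<otimes> (inv y \<otimes> inv x) = \<one>" using assms c by simp
  have "inv y \<otimes> inv x \<otimes> (x \<otimes> y) = inv y \<otimes> (inv x \<otimes> x) \<otimes> y" using c by (simp only: m_assoc m_closed)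
  then show "inv y \<otimes> inv x \<otimes> (x \<otimes> y) = \<one>" using assms c by simp
qed

locale hecke_datum = based_root_datum D
  for D :: "('x::ab_group_add, 'y::ab_group_add) root_data" +
  fixes t :: "'x hecke_table"
  assumes table: "is_hecke_table D t"
begin

abbreviation "H \<equiv> hecke D t"
abbreviation "HH \<equiv> half_hecke D t"
abbreviation "cls \<equiv> conj_class D ` simple_reflections D"
abbreviation "LR \<equiv> half_weight_ring D"

lemma LR_iff: "p \<in> LR \<longleftrightarrow> (\<forall>e\<in>Poly_Mapping.keys p. Poly_Mapping.keys e \<subseteq> cls)"
  by (simp add: half_weight_ring_def)

lemma LR_zero: "0 \<in> LR" and LR_one: "1 \<in> LR"
  by (simp_all add: LR_iff)

lemma LR_add: "p \<in> LR \<Longrightarrow> q \<in> LR \<Longrightarrow> p + q \<in> LR"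
  using keys_add[of p q] unfolding LR_iff by blast

lemma LR_uminus: "p \<in> LR \<Longrightarrow> - p \<in> LR"
  unfolding LR_iff by (simp add: in_keys_iff)

lemma LR_mult: assumes "p \<in> LR" "q \<in> LR" shows "p * q \<in> LR"
  unfolding LR_iff
proof
  fix e assume "e \<in> Poly_Mapping.keys (p * q)"
  then obtain a b where e: "a \<in> Poly_Mapping.keys p" "b \<in> Poly_Mapping.keys q" "e = a + b"
    using keys_mult[of p q] by blast
  then have "Poly_Mapping.keys a \<subseteq> cls" "Poly_Mapping.keys b \<subseteq> cls" using assms by (auto simp: LR_iff)
  then show "Poly_Mapping.keys e \<subseteq> cls" using keys_add[of a b] e(3) by blast
qed

lemma LR_monomial: "Poly_Mapping.keys e \<subseteq> cls \<Longrightarrow> monomial e \<in> LR"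
  by (simp add: LR_iff monomial_def)

lemma keys_uminus_exponent: "Poly_Mapping.keys (- e :: 'x exponent) = Poly_Mapping.keys e"
  by (auto simp: in_keys_iff)

lemma LR_monomial_uminus: "Poly_Mapping.keys e \<subseteq> cls \<Longrightarrow> monomial (- e) \<in> LR"
  by (rule LR_monomial) (simp only: keys_uminus_exponent)

lemma monomial_mult: "monomial e * monomial e' = monomial (e + e')"
  by (simp add: monomial_def mult_single)

lemma monomial_zero: "monomial 0 = 1"
  by (simp add: monomial_def)

lemma weight_half: "weight_ring D \<subseteq> LR"
  by (auto simp: weight_ring_def)

lemma weight_zero: "0 \<in> weight_ring D" and weight_one: "1 \<in> weight_ring D"
  by (simp_all add: weight_ring_def LR_zero LR_one)

lemma H_ring: "ring H"
  using table by (simp add: is_hecke_table_def)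

lemma H_simps [simp]:
  "x \<otimes>\<^bsub>H\<^esub> y = bilinear_ext t x y" "\<one>\<^bsub>H\<^esub> = T_elt \<one>\<^bsub>W\<^esub>" "\<zero>\<^bsub>H\<^esub> = 0" "x \<oplus>\<^bsub>H\<^esub> y = x + y"
  by (simp_all add: hecke_def hecke_over_def)

lemma H_carrier: "f \<in> carrier H \<longleftrightarrow> Poly_Mapping.keys f \<subseteq> carrier W \<and> (\<forall>w. Poly_Mapping.lookup f w \<in> weight_ring D)"
  by (simp add: hecke_def hecke_over_def)

lemma HH_simps:
  "x \<otimes>\<^bsub>HH\<^esub> y = bilinear_ext t x y" "\<one>\<^bsub>HH\<^esub> = T_elt \<one>\<^bsub>W\<^esub>" "\<zero>\<^bsub>HH\<^esub> = 0" "x \<oplus>\<^bsub>HH\<^esub> y = x + y"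
  by (simp_all add: half_hecke_def hecke_over_def)

lemma HH_carrier: "f \<in> carrier HH \<longleftrightarrow> Poly_Mapping.keys f \<subseteq> carrier W \<and> (\<forall>w. Poly_Mapping.lookup f w \<in> LR)"
  by (simp add: half_hecke_def hecke_over_def)

lemma H_sub_HH: "carrier H \<subseteq> carrier HH"
  using weight_half unfolding H_carrier HH_carrier subset_iff by blast

lemma T_in_H: "w \<in> carrier W \<Longrightarrow> T_elt w \<in> carrier H"
  by (auto simp: H_carrier T_elt_def lookup_single when_def weight_zero weight_one)

lemma W_one: "\<one>\<^bsub>W\<^esub> \<in> carrier W"
  using weyl_id by simp

lemma table_eq: "t a b = bilinear_ext t (T_elt a) (T_elt b)"
  by (simp add: T_elt_def bilinear_ext_single)

lemma HH_ring: "ring HH"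
proof (rule ring_of_table[of HH "carrier W" LR t "\<one>\<^bsub>W\<^esub>"])
  interpret H: ring H by (rule H_ring)
  show "HH = \<lparr>carrier = {f. Poly_Mapping.keys f \<subseteq> carrier W \<and> (\<forall>w. Poly_Mapping.lookup f w \<in> LR)},
      monoid.mult = bilinear_ext t, one = Poly_Mapping.single \<one>\<^bsub>W\<^esub> 1, ring.zero = 0, add = (+)\<rparr>"
    by (simp add: half_hecke_def hecke_over_def T_elt_def)
  fix a b assume a: "a \<in> carrier W" and b: "b \<in> carrier W"
  have "T_elt a \<otimes>\<^bsub>H\<^esub> T_elt b \<in> carrier H" using a b T_in_H by blast
  then have "t a b \<in> carrier H" by (simp add: table_eq)
  then show "Poly_Mapping.keys (t a b) \<subseteq> carrier W \<and> (\<forall>w. Poly_Mapping.lookup (t a b) w \<in> LR)"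
    using H_sub_HH HH_carrier by blast
  fix c assume c: "c \<in> carrier W"
  have "T_elt a \<otimes>\<^bsub>H\<^esub> T_elt b \<otimes>\<^bsub>H\<^esub> T_elt c = T_elt a \<otimes>\<^bsub>H\<^esub> (T_elt b \<otimes>\<^bsub>H\<^esub> T_elt c)"
    using a b c T_in_H H.m_assoc by blast
  then show "bilinear_ext t (t a b) (Poly_Mapping.single c 1) = bilinear_ext t (Poly_Mapping.single a 1) (t b c)"
    by (simp add: table_eq[of a b] table_eq[of b c]) (simp add: T_elt_def)
next
  interpret H: ring H by (rule H_ring)
  show "\<one>\<^bsub>W\<^esub> \<in> carrier W" by (rule W_one)
  fix a assume a: "a \<in> carrier W"
  have "\<one>\<^bsub>H\<^esub> \<otimes>\<^bsub>H\<^esub> T_elt a = T_elt a" "T_elt a \<otimes>\<^bsub>H\<^esub> \<one>\<^bsub>H\<^esub> = T_elt a"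
    using T_in_H[OF a] H.l_one H.r_one by blast+
  then show "t \<one>\<^bsub>W\<^esub> a = Poly_Mapping.single a 1" "t a \<one>\<^bsub>W\<^esub> = Poly_Mapping.single a 1"
    unfolding H_simps table_eq[symmetric] by (simp_all only: T_elt_def)
qed (auto intro: LR_zero LR_one LR_add LR_mult LR_uminus)

sublocale HH: ring HH by (rule HH_ring)

lemma T_in_HH: "w \<in> carrier W \<Longrightarrow> T_elt w \<in> carrier HH"
  using T_in_H H_sub_HH by blast

lemma scale_HH: "p \<in> LR \<Longrightarrow> f \<in> carrier HH \<Longrightarrow> scale p f \<in> carrier HH"
  using keys_scale[of p f] by (auto simp: HH_carrier intro: LR_mult)

lemma scale_mult_HH:
  "scale p f \<otimes>\<^bsub>HH\<^esub> g = scale p (f \<otimes>\<^bsub>HH\<^esub> g)" "f \<otimes>\<^bsub>HH\<^esub> scale p g = scale p (f \<otimes>\<^bsub>HH\<^esub> g)"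
  by (simp_all add: HH_simps bilinear_ext_scale_left bilinear_ext_scale_right)

lemma T_mult:
  assumes "w \<in> carrier W" "w' \<in> carrier W" "len D (w \<otimes>\<^bsub>W\<^esub> w') = len D w + len D w'"
  shows "T_elt (w \<otimes>\<^bsub>W\<^esub> w') = T_elt w \<otimes>\<^bsub>HH\<^esub> T_elt w'"
  using table assms by (simp add: is_hecke_table_def HH_simps)

lemma unitI:
  assumes "x \<in> carrier HH" "y \<in> carrier HH" "x \<otimes>\<^bsub>HH\<^esub> y = \<one>\<^bsub>HH\<^esub>" "y \<otimes>\<^bsub>HH\<^esub> x = \<one>\<^bsub>HH\<^esub>"
  shows "x \<in> Units HH" "inv\<^bsub>HH\<^esub> x = y"
  using assms HH.inv_unique' unfolding Units_def by blast+

text \<open>The quadratic relation reads \<open>T\<^sub>s (T\<^sub>s - (q - 1)) = q\<close>, and \<open>q\<close> is invertible over the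
  Laurent polynomials.\<close>

lemma T_simple_unit: assumes s: "s \<in> simple_reflections D" shows "T_elt s \<in> Units HH"
proof -
  obtain \<alpha> where "wall \<alpha> s" using simple_reflection_wall[OF s] by blast
  then have Ts: "T_elt s \<in> carrier HH" using wall_carrier T_in_HH by blast
  let ?q = "q_gen D s" and ?i = "monomial (Poly_Mapping.single (conj_class D s) (- 2))"
  have iq: "?i * ?q = 1"
    by (simp add: q_gen_def monomial_mult single_add[symmetric] monomial_zero)
  have mem: "?i \<in> LR" "?q \<in> LR" unfolding q_gen_def by (intro LR_monomial; use s in auto)+
  have one: "\<one>\<^bsub>HH\<^esub> \<in> carrier HH" by simp
  have ne: "bilinear_ext t \<one>\<^bsub>HH\<^esub> (T_elt s) = T_elt s" "bilinear_ext t (T_elt s) \<one>\<^bsub>HH\<^esub> = T_elt s"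
    "bilinear_ext t \<one>\<^bsub>HH\<^esub> \<one>\<^bsub>HH\<^esub> = \<one>\<^bsub>HH\<^esub>"
    using HH.l_one[OF Ts] HH.r_one[OF Ts] HH.l_one[OF one] by (simp_all only: HH_simps(1))
  have "(T_elt s + \<one>\<^bsub>H\<^esub>) \<otimes>\<^bsub>H\<^esub> (T_elt s - scale ?q \<one>\<^bsub>H\<^esub>) = 0"
    using table s unfolding is_hecke_table_def by blast
  then have "bilinear_ext t (T_elt s + \<one>\<^bsub>HH\<^esub>) (T_elt s - scale ?q \<one>\<^bsub>HH\<^esub>) = 0"
    unfolding H_simps HH_simps .
  then have sq: "bilinear_ext t (T_elt s) (T_elt s) = scale ?q (T_elt s) - T_elt s + scale ?q \<one>\<^bsub>HH\<^esub>"
    by (simp add: bilinear_ext_add_left bilinear_ext_diff_right bilinear_ext_scale_right ne scale_add algebra_simps)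
  let ?y = "scale ?i (T_elt s + scale (1 + - ?q) \<one>\<^bsub>HH\<^esub>)"
  have "scale (1 + - ?q) \<one>\<^bsub>HH\<^esub> \<in> carrier HH"
    by (intro scale_HH LR_add LR_one LR_uminus mem one)
  then have y: "?y \<in> carrier HH"
    using HH.a_closed[OF Ts] by (intro scale_HH mem) (simp add: HH_simps(4))
  have "T_elt s \<otimes>\<^bsub>HH\<^esub> ?y = \<one>\<^bsub>HH\<^esub>" "?y \<otimes>\<^bsub>HH\<^esub> T_elt s = \<one>\<^bsub>HH\<^esub>"
    unfolding HH_simps(1)
    by (simp_all add: bilinear_ext_add_left bilinear_ext_add_right bilinear_ext_scale_left
      bilinear_ext_scale_right bilinear_ext_diff_left bilinear_ext_diff_right
      ne sq scale_diff_left scale_add scale_diff iq)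
  then show ?thesis using unitI Ts y by blast
qed

lemma T_unit: "w \<in> carrier W \<Longrightarrow> T_elt w \<in> Units HH"
proof (induction rule: length_induct)
  case (zero u)
  obtain v where v: "v \<in> carrier W" "len D v = 0" "u \<otimes>\<^bsub>W\<^esub> v = \<one>\<^bsub>W\<^esub>" "v \<otimes>\<^bsub>W\<^esub> u = \<one>\<^bsub>W\<^esub>"
    using length_zero_inverse zero by blast
  have l: "len D \<one>\<^bsub>W\<^esub> = 0" using len_one by simp
  have "T_elt u \<otimes>\<^bsub>HH\<^esub> T_elt v = \<one>\<^bsub>HH\<^esub>"
    using T_mult[OF zero(1) v(1)] unfolding v(3) l zero(2) v(2) HH_simps(2) by simp
  moreover have "T_elt v \<otimes>\<^bsub>HH\<^esub> T_elt u = \<one>\<^bsub>HH\<^esub>"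
    using T_mult[OF v(1) zero(1)] unfolding v(4) l zero(2) v(2) HH_simps(2) by simp
  ultimately show ?case by (intro unitI(1)[of _ "T_elt v"] T_in_HH zero(1) v(1))
next
  case (step w s)
  then show ?case using T_mult[of w s] T_simple_unit[OF step(2)] HH.Units_m_closed by simp
qed

abbreviation tau :: "'x \<Rightarrow> 'x hecke_elt" where "tau x \<equiv> T_elt (translation x)"

text \<open>The element \<open>theta x\<close> is \<open>theta_tilde D t x\<close> without its monomial factor. Lengths add on dominant
  translations, so \<open>theta\<close> is a homomorphism from \<open>'x\<close> to the units. As the span is over
  Laurent polynomials, the monomial factors do not change it.\<close>

definition theta :: "'x \<Rightarrow> 'x hecke_elt" where
  "theta x = (let (y, z) = (SOME (y, z). dominant D y \<and> dominant D z \<and> x = y - z)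
      in tau y \<otimes>\<^bsub>HH\<^esub> inv\<^bsub>HH\<^esub> tau z)"

lemma tau_unit: "tau x \<in> Units HH"
  using T_unit translation_carrier by blast

lemma tau_add: "dominant D x \<Longrightarrow> dominant D y \<Longrightarrow> tau x \<otimes>\<^bsub>HH\<^esub> tau y = tau (x + y)"
  using T_mult[OF translation_carrier translation_carrier, of x y] len_translation_add
  by (simp add: translation_mult)

lemma tau_commute: "dominant D x \<Longrightarrow> dominant D y \<Longrightarrow> tau x \<otimes>\<^bsub>HH\<^esub> tau y = tau y \<otimes>\<^bsub>HH\<^esub> tau x"
  by (simp add: tau_add add.commute)

lemma tau_commute_inv:
  assumes "dominant D x" "dominant D y"
  shows "tau x \<otimes>\<^bsub>HH\<^esub> inv\<^bsub>HH\<^esub> tau y = inv\<^bsub>HH\<^esub> tau y \<otimes>\<^bsub>HH\<^esub> tau x"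
  using tau_unit by (intro HH.unit_commute_inv tau_commute assms) auto

lemma tau_closed: "tau x \<in> carrier HH" "inv\<^bsub>HH\<^esub> tau x \<in> carrier HH"
  using tau_unit by auto

lemma chosen_dominant:
  obtains y z where "(SOME (y, z). dominant D y \<and> dominant D z \<and> x = y - z) = (y, z)"
    "dominant D y" "dominant D z" "x = y - z"
proof -
  let ?Q = "\<lambda>(y, z). dominant D y \<and> dominant D z \<and> x = y - z"
  obtain y z where yz: "(SOME p. ?Q p) = (y, z)" by (cases "SOME p. ?Q p")
  have "\<exists>p. ?Q p" using dominant_difference[of x] by (simp only: split_paired_Ex case_prod_conv)
  from someI_ex[OF this] have "?Q (y, z)" unfolding yz .
  then show thesis using that[OF yz] by simp
qed

lemma theta_eq:
  assumes "dominant D y" "dominant D z"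
  shows "theta (y - z) = tau y \<otimes>\<^bsub>HH\<^esub> inv\<^bsub>HH\<^esub> tau z"
proof -
  obtain y' z' where s: "(SOME (y', z'). dominant D y' \<and> dominant D z' \<and> y - z = y' - z') = (y', z')"
    and d: "dominant D y'" "dominant D z'" "y - z = y' - z'"
    using chosen_dominant[of "y - z"] by blast
  have th: "theta (y - z) = tau y' \<otimes>\<^bsub>HH\<^esub> inv\<^bsub>HH\<^esub> tau z'" unfolding theta_def s by simp
  note c = tau_closed[of y] tau_closed[of z] tau_closed[of y'] tau_closed[of z']
  have "y + z' = y' + z" using d(3) by (simp add: algebra_simps)
  then have e: "tau y \<otimes>\<^bsub>HH\<^esub> tau z' = tau y' \<otimes>\<^bsub>HH\<^esub> tau z" using tau_add assms d by simp
  have "tau y \<otimes>\<^bsub>HH\<^esub> inv\<^bsub>HH\<^esub> tau z = (tau y \<otimes>\<^bsub>HH\<^esub> tau z') \<otimes>\<^bsub>HH\<^esub> inv\<^bsub>HH\<^esub> tau z' \<otimes>\<^bsub>HH\<^esub> inv\<^bsub>HH\<^esub> tau z"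
    using c HH.Units_r_inv[OF tau_unit] by (simp add: HH.m_assoc)
  also have "\<dots> = tau y' \<otimes>\<^bsub>HH\<^esub> (tau z \<otimes>\<^bsub>HH\<^esub> inv\<^bsub>HH\<^esub> tau z') \<otimes>\<^bsub>HH\<^esub> inv\<^bsub>HH\<^esub> tau z"
    unfolding e using c by (simp add: HH.m_assoc)
  also have "\<dots> = tau y' \<otimes>\<^bsub>HH\<^esub> inv\<^bsub>HH\<^esub> tau z' \<otimes>\<^bsub>HH\<^esub> (tau z \<otimes>\<^bsub>HH\<^esub> inv\<^bsub>HH\<^esub> tau z)"
    unfolding tau_commute_inv[OF assms(2) d(2)] using c by (simp add: HH.m_assoc)
  also have "\<dots> = tau y' \<otimes>\<^bsub>HH\<^esub> inv\<^bsub>HH\<^esub> tau z'" using c HH.Units_r_inv[OF tau_unit] by simp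
  finally show ?thesis using th by simp
qed

lemma theta_zero: "theta 0 = \<one>\<^bsub>HH\<^esub>"
proof -
  have "dominant D 0" by (simp add: dominant_def)
  from theta_eq[OF this this] show ?thesis using HH.Units_r_inv[OF tau_unit] by simp
qed

lemma theta_add: "theta x \<otimes>\<^bsub>HH\<^esub> theta x' = theta (x + x')"
proof -
  obtain y z where d: "dominant D y" "dominant D z" "x = y - z" using dominant_difference[of x] by blast
  obtain y' z' where d': "dominant D y'" "dominant D z'" "x' = y' - z'" using dominant_difference[of x'] by blast
  note c = tau_closed[of y] tau_closed[of z] tau_closed[of y'] tau_closed[of z']
  have "x + x' = (y + y') - (z' + z)" using d d' by simp
  then have "theta (x + x') = tau (y + y') \<otimes>\<^bsub>HH\<^esub> inv\<^bsub>HH\<^esub> tau (z' + z)"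
    using theta_eq[OF dominant_add[OF d(1) d'(1)] dominant_add[OF d'(2) d(2)]] by (simp only:)
  also have "inv\<^bsub>HH\<^esub> tau (z' + z) = inv\<^bsub>HH\<^esub> tau z \<otimes>\<^bsub>HH\<^esub> inv\<^bsub>HH\<^esub> tau z'"
    using HH.inv_mult_units[OF tau_unit tau_unit, of z' z] tau_add[OF d'(2) d(2)] by simp
  also have "tau (y + y') = tau y \<otimes>\<^bsub>HH\<^esub> tau y'" using tau_add d d' by simp
  also have "tau y \<otimes>\<^bsub>HH\<^esub> tau y' \<otimes>\<^bsub>HH\<^esub> (inv\<^bsub>HH\<^esub> tau z \<otimes>\<^bsub>HH\<^esub> inv\<^bsub>HH\<^esub> tau z') =
      tau y \<otimes>\<^bsub>HH\<^esub> (tau y' \<otimes>\<^bsub>HH\<^esub> inv\<^bsub>HH\<^esub> tau z) \<otimes>\<^bsub>HH\<^esub> inv\<^bsub>HH\<^esub> tau z'"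
    using c by (simp add: HH.m_assoc)
  also have "\<dots> = (tau y \<otimes>\<^bsub>HH\<^esub> inv\<^bsub>HH\<^esub> tau z) \<otimes>\<^bsub>HH\<^esub> (tau y' \<otimes>\<^bsub>HH\<^esub> inv\<^bsub>HH\<^esub> tau z')"
    unfolding tau_commute_inv[OF d'(1) d(2)] using c by (simp add: HH.m_assoc)
  finally show ?thesis using theta_eq d d' by simp
qed

lemma theta_tilde_monomial:
  obtains e where "Poly_Mapping.keys e \<subseteq> cls" "theta_tilde D t x = scale (monomial e) (theta x)"
proof -
  obtain y z where s: "(SOME (y, z). dominant D y \<and> dominant D z \<and> x = y - z) = (y, z)"
    using chosen_dominant[of x] by blast
  define a b where "a = q_exponent D (translation y)" and "b = q_exponent D (translation z)"
  have k: "Poly_Mapping.keys a \<subseteq> cls" "Poly_Mapping.keys b \<subseteq> cls"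
    unfolding a_def b_def by (intro keys_q_exponent translation_carrier)+
  have mb: "monomial b \<in> LR" "monomial (- b) \<in> LR" using k LR_monomial LR_monomial_uminus by blast+
  have "inv\<^bsub>HH\<^esub> (scale (monomial (- b)) (tau z)) = scale (monomial b) (inv\<^bsub>HH\<^esub> tau z)"
    using tau_unit tau_closed mb
    by (intro unitI(2) scale_HH) (simp_all add: scale_mult_HH monomial_mult monomial_zero)
  then have "theta_tilde D t x = scale (monomial (b - a)) (theta x)"
    unfolding theta_tilde_def theta_def s T_tilde_def Let_def case_prod_conv a_def[symmetric] b_def[symmetric]
    by (simp add: scale_mult_HH monomial_mult)
  moreover have "Poly_Mapping.keys (b - a) \<subseteq> cls"
    using keys_diff[of b a] k by blast
  ultimately show thesis using that by blast
qed

abbreviation "A \<equiv> bernstein_A D t"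

lemma A_I: "finite F \<Longrightarrow> (\<And>x. x \<in> F \<Longrightarrow> a x \<in> LR) \<Longrightarrow> (\<Sum>x\<in>F. scale (a x) (theta_tilde D t x)) \<in> A"
  unfolding bernstein_A_def by blast

lemma A_single: "p \<in> LR \<Longrightarrow> scale p (theta_tilde D t x) \<in> A"
  using A_I[of "{x}" "\<lambda>_. p"] by simp

lemma A_theta: assumes "p \<in> LR" shows "scale p (theta x) \<in> A"
proof -
  obtain e where e: "Poly_Mapping.keys e \<subseteq> cls" "theta_tilde D t x = scale (monomial e) (theta x)"
    by (rule theta_tilde_monomial)
  have "p * monomial (- e) \<in> LR" using LR_mult[OF assms LR_monomial_uminus[OF e(1)]] .
  from A_single[OF this, of x] show ?thesis
    by (simp add: e(2) mult.assoc monomial_mult monomial_zero)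
qed

lemma A_zero: "0 \<in> A"
  using A_I[of "{}" "\<lambda>_. 0"] by simp

lemma A_add: assumes "f \<in> A" "g \<in> A" shows "f + g \<in> A"
proof -
  obtain F a where f: "finite F" "\<And>x. x \<in> F \<Longrightarrow> a x \<in> LR" "f = (\<Sum>x\<in>F. scale (a x) (theta_tilde D t x))"
    using assms(1) unfolding bernstein_A_def by blast
  obtain G b where g: "finite G" "\<And>x. x \<in> G \<Longrightarrow> b x \<in> LR" "g = (\<Sum>x\<in>G. scale (b x) (theta_tilde D t x))"
    using assms(2) unfolding bernstein_A_def by blast
  define a' b' where "a' x = (if x \<in> F then a x else 0)" and "b' x = (if x \<in> G then b x else 0)" for x
  have "f = (\<Sum>x\<in>F \<union> G. scale (a' x) (theta_tilde D t x))"
    unfolding f(3) by (rule sum.mono_neutral_cong_left) (use f g in \<open>auto simp: a'_def\<close>)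
  moreover have "g = (\<Sum>x\<in>F \<union> G. scale (b' x) (theta_tilde D t x))"
    unfolding g(3) by (rule sum.mono_neutral_cong_left) (use f g in \<open>auto simp: b'_def\<close>)
  ultimately have "f + g = (\<Sum>x\<in>F \<union> G. scale (a' x + b' x) (theta_tilde D t x))"
    by (simp add: scale_add_left sum.distrib)
  also have "\<dots> \<in> A" using f g by (intro A_I LR_add) (auto simp: a'_def b'_def LR_zero)
  finally show ?thesis .
qed

lemma A_induct [consumes 1, case_names zero add]:
  assumes "f \<in> A" "P 0"
    and add: "\<And>p x g. p \<in> LR \<Longrightarrow> g \<in> A \<Longrightarrow> P g \<Longrightarrow> P (scale p (theta x) + g)"
  shows "P f"
proof -
  obtain F a where f: "finite F" "\<And>x. x \<in> F \<Longrightarrow> a x \<in> LR" "f = (\<Sum>x\<in>F. scale (a x) (theta_tilde D t x))"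
    using assms(1) unfolding bernstein_A_def by blast
  from f(1,2) have "P (\<Sum>x\<in>F. scale (a x) (theta_tilde D t x))"
  proof (induction F)
    case (insert x F)
    obtain e where e: "Poly_Mapping.keys e \<subseteq> cls" "theta_tilde D t x = scale (monomial e) (theta x)"
      by (rule theta_tilde_monomial)
    have "a x * monomial e \<in> LR" using insert.prems e(1) by (auto intro: LR_mult LR_monomial)
    from add[OF this A_I[of F a] insert.IH] insert show ?case by (simp add: e(2))
  qed (use assms(2) in simp)
  then show ?thesis using f(3) by simp
qed

lemma theta_scale_mult:
  "bilinear_ext t (scale p (theta x)) (scale q (theta y)) = scale (p * q) (theta (x + y))"
  using theta_add[of x y] by (simp add: HH_simps bilinear_ext_scale_left bilinear_ext_scale_right mult.commute)

lemma theta_A: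
  assumes "f \<in> A" "p \<in> LR"
  shows "bilinear_ext t (scale p (theta x)) f \<in> A"
    "bilinear_ext t (scale p (theta x)) f = bilinear_ext t f (scale p (theta x))"
  using assms(1)
proof (induction rule: A_induct)
  case (add q y g)
  case 1
  show ?case using add A_theta[OF LR_mult[OF assms(2) add(1)]]
    by (simp add: bilinear_ext_add_right theta_scale_mult A_add)
  case 2
  show ?case using add
    by (simp add: bilinear_ext_add_right bilinear_ext_add_left theta_scale_mult add.commute mult.commute)
qed (simp_all add: A_zero)

lemma A_mult: assumes "f \<in> A" "g \<in> A" shows "bilinear_ext t f g \<in> A"
  using assms(1)
proof (induction rule: A_induct)
  case (add p x f)
  then show ?case using theta_A(1)[OF assms(2)] by (simp add: bilinear_ext_add_left A_add)
qed (simp add: A_zero)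

lemma A_commute: assumes "f \<in> A" "g \<in> A" shows "bilinear_ext t f g = bilinear_ext t g f"
  using assms(1)
proof (induction rule: A_induct)
  case (add p x f)
  then show ?case using theta_A(2)[OF assms(2)] by (simp add: bilinear_ext_add_left bilinear_ext_add_right)
qed simp

abbreviation "AH \<equiv> A_cap_H D t"

lemma AH_add: "f \<in> AH \<Longrightarrow> g \<in> AH \<Longrightarrow> f + g \<in> AH"
  using A_add ring.ring_simprules(1)[OF H_ring, of f g] by (simp add: A_cap_H_def)

lemma AH_mult: "f \<in> AH \<Longrightarrow> g \<in> AH \<Longrightarrow> bilinear_ext t f g \<in> AH"
  using A_mult ring.ring_simprules(5)[OF H_ring, of f g] by (simp add: A_cap_H_def)

lemma AH_commute: "f \<in> AH \<Longrightarrow> g \<in> AH \<Longrightarrow> bilinear_ext t f g = bilinear_ext t g f"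
  using A_commute by (simp add: A_cap_H_def)

lemma AH_carrier: "f \<in> AH \<Longrightarrow> f \<in> carrier H"
  by (simp add: A_cap_H_def)

lemma scale_one_H: "p \<in> weight_ring D \<Longrightarrow> scale p (T_elt \<one>\<^bsub>W\<^esub>) \<in> carrier H"
  using W_one by (auto simp: H_carrier T_elt_def lookup_single when_def weight_zero)

lemma AH_scalar: assumes "p \<in> weight_ring D" shows "scale p (T_elt \<one>\<^bsub>W\<^esub>) \<in> AH"
  using A_theta[of p 0] theta_zero assms weight_half scale_one_H by (auto simp: A_cap_H_def HH_simps)

lemma scale_H: assumes "p \<in> weight_ring D" "f \<in> carrier H" shows "scale p f \<in> carrier H"
proof -
  interpret H: ring H by (rule H_ring)
  have "scale p \<one>\<^bsub>H\<^esub> \<otimes>\<^bsub>H\<^esub> f \<in> carrier H" using scale_one_H[OF assms(1)] assms(2) by (intro H.m_closed) simp_all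
  then show ?thesis using H.l_one[OF assms(2)] by (simp add: bilinear_ext_scale_left)
qed

end

section \<open>Common eigenvectors\<close>

text \<open>Finite-dimensional subspaces are given by spanning lists, possibly redundant; the length of a shortest
  list plays the role of the dimension.\<close>

locale scalar_action = abelian_group M
  for M :: "('m, 'b) ring_scheme" (structure) +
  fixes s :: "'k::field \<Rightarrow> 'm \<Rightarrow> 'm"
  assumes s_closed: "x \<in> carrier M \<Longrightarrow> s c x \<in> carrier M"
    and s_add_left: "x \<in> carrier M \<Longrightarrow> s (c + d) x = s c x \<oplus> s d x"
    and s_add_right: "x \<in> carrier M \<Longrightarrow> y \<in> carrier M \<Longrightarrow> s c (x \<oplus> y) = s c x \<oplus> s c y"
    and s_mult: "x \<in> carrier M \<Longrightarrow> s (c * d) x = s c (s d x)"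
    and s_one: "x \<in> carrier M \<Longrightarrow> s 1 x = x"
begin

lemma zero_sum_unique:
  assumes "x \<oplus> z = \<zero>" "y \<oplus> z = \<zero>" "x \<in> carrier M" "y \<in> carrier M" "z \<in> carrier M"
  shows "x = y"
proof -
  have "x = x \<oplus> (y \<oplus> z)" using assms by simp
  also have "\<dots> = (x \<oplus> z) \<oplus> y" using assms(3-5) by (simp add: a_ac)
  also have "\<dots> = y" using assms by simp
  finally show ?thesis .
qed

lemma s_zero_left: assumes "x \<in> carrier M" shows "s 0 x = \<zero>"
proof -
  have "s 0 x \<oplus> s 0 x = s 0 x" using s_add_left[OF assms, of 0 0] by simp
  then show ?thesis using s_closed[OF assms, of 0] by simp
qed

lemma s_zero_right: "s c \<zero> = \<zero>"
  using s_mult[of \<zero> c 0] s_zero_left[of \<zero>] by simp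

lemma s_minus: assumes "x \<in> carrier M" shows "s (- c) x \<oplus> s c x = \<zero>" "s c x \<oplus> s (- c) x = \<zero>"
  using s_add_left[OF assms, of "- c" c] s_add_left[OF assms, of c "- c"] s_zero_left[OF assms] by simp_all

lemma s_cancel: assumes "x \<in> carrier M" "c \<noteq> 0" shows "s (inverse c) (s c x) = x"
  using s_mult[OF assms(1), of "inverse c" c] assms s_one by simp

primrec sp :: "'m list \<Rightarrow> 'm set" where
  "sp [] = {\<zero>}"
| "sp (f # fs) = {s c f \<oplus> y | c y. y \<in> sp fs}"

definition linear :: "('m \<Rightarrow> 'm) \<Rightarrow> bool" where
  "linear T \<longleftrightarrow> T \<in> carrier M \<rightarrow> carrier M \<and>
     (\<forall>x\<in>carrier M. \<forall>y\<in>carrier M. T (x \<oplus> y) = T x \<oplus> T y) \<and> (\<forall>c. \<forall>x\<in>carrier M. T (s c x) = s c (T x))"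

lemma linearD:
  assumes "linear T" "x \<in> carrier M"
  shows "T x \<in> carrier M" "y \<in> carrier M \<Longrightarrow> T (x \<oplus> y) = T x \<oplus> T y" "T (s c x) = s c (T x)"
  using assms by (auto simp: linear_def)

lemma linear_zero: "linear T \<Longrightarrow> T \<zero> = \<zero>"
  using linearD(3)[of T \<zero> 0] s_zero_left linearD(1)[of T \<zero>] by simp

lemma sp_carrier: "set fs \<subseteq> carrier M \<Longrightarrow> sp fs \<subseteq> carrier M"
  by (induction fs) (auto intro!: a_closed s_closed)

lemma sp_zero: "set fs \<subseteq> carrier M \<Longrightarrow> \<zero> \<in> sp fs"
proof (induction fs)
  case (Cons f fs)
  then have "\<zero> = s 0 f \<oplus> \<zero>" "\<zero> \<in> sp fs" using s_zero_left by simp_all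
  then show ?case unfolding sp.simps by blast
qed simp

lemma sp_scale: "set fs \<subseteq> carrier M \<Longrightarrow> x \<in> sp fs \<Longrightarrow> s d x \<in> sp fs"
proof (induction fs arbitrary: x)
  case Nil
  then show ?case using s_zero_right by simp
next
  case (Cons f fs)
  then obtain c y where x: "x = s c f \<oplus> y" "y \<in> sp fs" by auto
  have "f \<in> carrier M" "y \<in> carrier M" using Cons.prems sp_carrier[of fs] x by auto
  then have "s d x = s (d * c) f \<oplus> s d y" using x s_add_right s_mult s_closed by simp
  moreover have "s d y \<in> sp fs" using Cons x by simp
  ultimately show ?case unfolding sp.simps by blast
qed

lemma sp_add: "set fs \<subseteq> carrier M \<Longrightarrow> x \<in> sp fs \<Longrightarrow> x' \<in> sp fs \<Longrightarrow> x \<oplus> x' \<in> sp fs"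
proof (induction fs arbitrary: x x')
  case (Cons f fs)
  then obtain c y c' y' where x: "x = s c f \<oplus> y" "y \<in> sp fs" "x' = s c' f \<oplus> y'" "y' \<in> sp fs" by auto
  have "f \<in> carrier M" "y \<in> carrier M" "y' \<in> carrier M" using Cons.prems sp_carrier[of fs] x by auto
  then have "x \<oplus> x' = s (c + c') f \<oplus> (y \<oplus> y')" using x s_add_left s_closed by (simp add: a_ac)
  moreover have "y \<oplus> y' \<in> sp fs" using Cons x by simp
  ultimately show ?case unfolding sp.simps by blast
qed simp

lemma sp_Cons_mono: assumes "set (f # fs) \<subseteq> carrier M" "x \<in> sp fs" shows "x \<in> sp (f # fs)"
proof -
  have "x = s 0 f \<oplus> x" using assms s_zero_left sp_carrier[of fs] by auto
  then show ?thesis using assms(2) unfolding sp.simps by blast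
qed

lemma sp_Cons_redundant:
  assumes "set (f # fs) \<subseteq> carrier M" "f \<in> sp fs" shows "sp (f # fs) = sp fs"
proof
  show "sp (f # fs) \<subseteq> sp fs" using assms sp_add sp_scale by auto
  show "sp fs \<subseteq> sp (f # fs)" using sp_Cons_mono[OF assms(1)] by blast
qed

lemma sp_map:
  assumes "linear T" shows "set fs \<subseteq> carrier M \<Longrightarrow> T ` sp fs = sp (map T fs)"
proof (induction fs)
  case Nil
  then show ?case using linear_zero[OF assms] by simp
next
  case (Cons f fs)
  have f: "f \<in> carrier M" and fs: "sp fs \<subseteq> carrier M" using Cons.prems sp_carrier[of fs] by auto
  have "T (s c f \<oplus> y) = s c (T f) \<oplus> T y" if "y \<in> sp fs" for c y
    using linearD[OF assms] f fs that s_closed by auto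
  then have "T ` sp (f # fs) = {s c (T f) \<oplus> z | c z. z \<in> T ` sp fs}" by (auto simp: image_iff) metis+
  then show ?case using Cons by simp
qed

text \<open>A linear map with a nonzero kernel vector shortens spanning lists: the relation makes one of
  the images redundant.\<close>

lemma sp_image_shorter:
  assumes "linear T"
  shows "set fs \<subseteq> carrier M \<Longrightarrow> w \<in> sp fs \<Longrightarrow> w \<noteq> \<zero> \<Longrightarrow> T w = \<zero> \<Longrightarrow>
    \<exists>gs. length gs < length fs \<and> set gs \<subseteq> carrier M \<and> T ` sp fs = sp gs"
proof (induction fs)
  case (Cons f fs)
  have f: "f \<in> carrier M" and fs: "set fs \<subseteq> carrier M" using Cons.prems by auto
  obtain c y where w: "w = s c f \<oplus> y" "y \<in> sp fs" using Cons.prems(2) by auto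
  have y: "y \<in> carrier M" using w sp_carrier[OF fs] by auto
  have Tfs: "set (map T fs) \<subseteq> carrier M" using fs linearD(1)[OF assms] by auto
  have im: "T ` sp (f # fs) = sp (T f # map T fs)" using sp_map[OF assms Cons.prems(1)] by simp
  show ?case
  proof (cases "c = 0")
    case True
    then have "w = y" using w f y s_zero_left by simp
    then obtain gs where gs: "length gs < length fs" "set gs \<subseteq> carrier M" "T ` sp fs = sp gs"
      using Cons.IH[OF fs] w(2) Cons.prems by auto
    then have "sp (T f # map T fs) = sp (T f # gs)" using sp_map[OF assms fs] by simp
    then show ?thesis using gs im linearD(1)[OF assms f] by (intro exI[of _ "T f # gs"]) simp
  next
    case False
    have "s c (T f) \<oplus> T y = \<zero>" using Cons.prems(4) w linearD[OF assms] f y s_closed by simp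
    moreover have "s (- 1) (T y) \<oplus> T y = \<zero>"
      using s_minus(1)[OF linearD(1)[OF assms y], of 1] s_one[OF linearD(1)[OF assms y]] by simp
    ultimately have "s c (T f) = s (- 1) (T y)"
      by (rule zero_sum_unique) (use linearD(1)[OF assms] f y s_closed in auto)
    then have "T f = s (inverse c) (s (- 1) (T y))"
      using s_cancel[OF linearD(1)[OF assms f] False] by simp
    moreover have "T y \<in> sp (map T fs)" using sp_map[OF assms fs] w(2) by blast
    ultimately have "T f \<in> sp (map T fs)" using sp_scale[OF Tfs] by simp
    then have "sp (T f # map T fs) = sp (map T fs)"
      using linearD(1)[OF assms f] Tfs by (intro sp_Cons_redundant) auto
    then show ?thesis using im Tfs by (intro exI[of _ "map T fs"]) simp
  qed
qed simp

lemma span_coefficient_unique: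
  assumes "set (f # fs) \<subseteq> carrier M" "f \<notin> sp fs" "y \<in> sp fs" "y' \<in> sp fs"
    and e: "s c f \<oplus> y = s c' f \<oplus> y'"
  shows "c = c'"
proof (rule ccontr)
  assume "c \<noteq> c'"
  have f: "f \<in> carrier M" and fs: "set fs \<subseteq> carrier M" using assms by auto
  have y: "y \<in> carrier M" "y' \<in> carrier M" using assms sp_carrier[OF fs] by auto
  have "s (c - c') f = s (- c') f \<oplus> (s c f \<oplus> y) \<oplus> s (- 1) y"
  proof -
    have "s (- c') f \<oplus> (s c f \<oplus> y) \<oplus> s (- 1) y = (s (- c') f \<oplus> s c f) \<oplus> (y \<oplus> s (- 1) y)"
      using f y s_closed by (simp add: a_ac)
    also have "y \<oplus> s (- 1) y = \<zero>" using s_minus[OF y(1), of 1] s_one[OF y(1)] by simp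
    also have "s (- c') f \<oplus> s c f = s (c - c') f" using s_add_left[OF f, of "- c'" c] by simp
    finally show ?thesis using f s_closed by simp
  qed
  also have "\<dots> = (s (- c') f \<oplus> s c' f) \<oplus> (y' \<oplus> s (- 1) y)"
    unfolding e using f y s_closed by (simp add: a_ac)
  also have "\<dots> = y' \<oplus> s (- 1) y" using s_minus[OF f] f y s_closed by simp
  finally have "s (c - c') f \<in> sp fs" using sp_add[OF fs] sp_scale[OF fs] assms by simp
  then have "s (inverse (c - c')) (s (c - c') f) \<in> sp fs" using sp_scale[OF fs] by blast
  then show False using s_cancel[OF f] \<open>c \<noteq> c'\<close> assms(2) by simp
qed

definition linear_poly :: "('k poly \<Rightarrow> 'm) \<Rightarrow> bool" where
  "linear_poly E \<longleftrightarrow> (\<forall>p. E p \<in> carrier M) \<and> (\<forall>p q. E (p + q) = E p \<oplus> E q) \<and> (\<forall>a p. E (smult a p) = s a (E p))"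

text \<open>Polynomials form an infinite-dimensional space. The induction removes one spanning vector \<open>f\<close> by
  composing with an injective linear map of polynomials into the kernel of the \<open>f\<close>-coordinate.\<close>

lemma linear_poly_kernel:
  "set fs \<subseteq> carrier M \<Longrightarrow> linear_poly E \<Longrightarrow> (\<And>p. E p \<in> sp fs) \<Longrightarrow> \<exists>p. p \<noteq> 0 \<and> E p = \<zero>"
proof (induction fs arbitrary: E)
  case Nil
  then show ?case by (intro exI[of _ 1]) auto
next
  case (Cons f fs)
  have f: "f \<in> carrier M" and fs: "set fs \<subseteq> carrier M" using Cons.prems by auto
  have E: "E (p + q) = E p \<oplus> E q" "E (smult a p) = s a (E p)" for a p q
    using Cons.prems(2) by (simp_all add: linear_poly_def)
  show ?case
  proof (cases "f \<in> sp fs \<or> (\<forall>p. E p \<in> sp fs)")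
    case True
    then have "E p \<in> sp fs" for p using sp_Cons_redundant[OF Cons.prems(1)] Cons.prems(3) by auto
    then show ?thesis using Cons.IH[OF fs Cons.prems(2)] by blast
  next
    case False
    then obtain r where fn: "f \<notin> sp fs" and r: "E r \<notin> sp fs" by blast
    have "\<forall>p. \<exists>c. \<exists>y\<in>sp fs. E p = s c f \<oplus> y" using Cons.prems(3) by simp blast
    then obtain c where c: "\<And>p. \<exists>y\<in>sp fs. E p = s (c p) f \<oplus> y" by metis
    have cI: "c p = d" if "y \<in> sp fs" "E p = s d f \<oplus> y" for p d y
      using c[of p] span_coefficient_unique[OF Cons.prems(1) fn] that by metis
    have c_add: "c (p + q) = c p + c q" for p q
    proof -
      obtain y y' where y: "y \<in> sp fs" "E p = s (c p) f \<oplus> y" "y' \<in> sp fs" "E q = s (c q) f \<oplus> y'" using c by meson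
      have "y \<in> carrier M" "y' \<in> carrier M" using y sp_carrier[OF fs] by auto
      then have "E (p + q) = s (c p + c q) f \<oplus> (y \<oplus> y')"
        using y f s_closed by (simp add: E s_add_left a_ac)
      then show ?thesis using cI sp_add[OF fs y(1,3)] by blast
    qed
    have c_smult: "c (smult a p) = a * c p" for a p
    proof -
      obtain y where y: "y \<in> sp fs" "E p = s (c p) f \<oplus> y" using c by meson
      have "y \<in> carrier M" using y sp_carrier[OF fs] by auto
      then have "E (smult a p) = s (a * c p) f \<oplus> s a y"
        using y f s_closed by (simp add: E s_add_right s_mult)
      then show ?thesis using cI sp_scale[OF fs y(1)] by blast
    qed
    have c_zero: "E p \<in> sp fs" if "c p = 0" for p
    proof -
      obtain y where "y \<in> sp fs" "E p = s (c p) f \<oplus> y" using c by meson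
      then show ?thesis using that s_zero_left[OF f] sp_carrier[OF fs] by auto
    qed
    have cr: "c r \<noteq> 0" using r c_zero by blast
    define q where "q = monom (1 :: 'k) (Suc (degree r))"
    define G where "G p = smult (c r) (q * p) + smult (- c (q * p)) r" for p
    have "linear_poly (E \<circ> G)"
    proof -
      have "G (p + p') = G p + G p'" for p p'
        by (simp add: G_def c_add smult_add_right smult_add_left algebra_simps smult_diff_left)
      moreover have "G (smult a p) = smult a (G p)" for a p
        by (simp add: G_def c_smult smult_diff_right mult.commute)
      ultimately show ?thesis using Cons.prems(2) by (simp add: linear_poly_def)
    qed
    moreover have "(E \<circ> G) p \<in> sp fs" for p
      unfolding comp_def by (rule c_zero) (simp only: G_def c_add c_smult, simp)
    ultimately have "\<exists>p. p \<noteq> 0 \<and> (E \<circ> G) p = \<zero>" by (rule Cons.IH[OF fs])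
    then obtain p where p: "p \<noteq> 0" "E (G p) = \<zero>" by auto
    have "G p \<noteq> 0"
    proof
      assume "G p = 0"
      then have "smult (c r) (q * p) = smult (c (q * p)) r" by (simp add: G_def)
      then have "degree (smult (c r) (q * p)) \<le> degree r" by (metis degree_smult_le)
      moreover have "degree (q * p) = Suc (degree r) + degree p"
        using p(1) by (subst degree_mult_eq) (auto simp: q_def degree_monom_eq)
      ultimately show False using cr by simp
    qed
    then show ?thesis using p(2) by blast
  qed
qed

end

locale closed_scalar_action = scalar_action M s
  for M :: "('m, 'b) ring_scheme" (structure) and s :: "'k::alg_closed_field \<Rightarrow> 'm \<Rightarrow> 'm"
begin

lemma eigenvector:
  assumes T: "linear T" and fs: "set fs \<subseteq> carrier M" and inv: "T ` sp fs \<subseteq> sp fs"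
    and v: "v \<in> sp fs" "v \<noteq> \<zero>"
  shows "\<exists>w c. w \<in> sp fs \<and> w \<noteq> \<zero> \<and> T w = s c w"
proof -
  have vc: "v \<in> carrier M" using v sp_carrier[OF fs] by blast
  \<comment> \<open>\<open>E p\<close> is the value at \<open>v\<close> of the polynomial \<open>p\<close> in \<open>T\<close>.\<close>
  define E where "E p = fold_coeffs (\<lambda>c g. s c v \<oplus> T g) p \<zero>" for p
  have E0: "E 0 = \<zero>" by (simp add: E_def)
  have Ep: "E (pCons c p) = s c v \<oplus> T (E p)" for c p
  proof (cases "c = 0 \<and> p = 0")
    case True
    then show ?thesis using s_zero_left[OF vc] linear_zero[OF T] E0 by simp
  qed (auto simp: E_def)
  have Esp: "E p \<in> sp fs" for p
  proof (induction p)
    case (pCons c p)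
    then show ?case using sp_add[OF fs sp_scale[OF fs v(1)]] inv by (auto simp: Ep)
  qed (simp add: E0 sp_zero[OF fs])
  have Ec: "E p \<in> carrier M" for p using Esp sp_carrier[OF fs] by blast
  have TE: "T (E p) \<in> carrier M" for p using linearD(1)[OF T Ec] .
  have Eadd: "E (p + q) = E p \<oplus> E q" for p q
  proof (induction p q rule: poly_induct2)
    case (pCons a p b q)
    then show ?case using linearD(2)[OF T Ec Ec] TE s_closed[OF vc]
      by (simp add: Ep s_add_left[OF vc] a_ac)
  qed (simp add: E0)
  have Esm: "E (smult a p) = s a (E p)" for a p
  proof (induction p)
    case (pCons c p)
    then show ?case using linearD(3)[OF T Ec] TE s_closed[OF vc]
      by (simp add: Ep s_add_right s_mult[OF vc])
  qed (simp add: E0 s_zero_right)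
  have "linear_poly E" using Ec Eadd Esm by (simp add: linear_poly_def)
  then have ex: "\<exists>p. p \<noteq> 0 \<and> E p = \<zero>" using linear_poly_kernel[OF fs] Esp by blast
  define p where "p = arg_min degree (\<lambda>p. p \<noteq> 0 \<and> E p = \<zero>)"
  have p: "p \<noteq> 0" "E p = \<zero>" and pmin: "\<And>q. q \<noteq> 0 \<Longrightarrow> E q = \<zero> \<Longrightarrow> degree p \<le> degree q"
    using arg_min_nat_lemma[of "\<lambda>p. p \<noteq> 0 \<and> E p = \<zero>" _ degree] ex unfolding p_def by blast+
  have "degree p \<noteq> 0"
  proof
    assume "degree p = 0"
    then obtain c where c: "p = [:c:]" by (rule degree_eq_zeroE)
    then have "c \<noteq> 0" "s c v = \<zero>" using p linear_zero[OF T] s_closed[OF vc] by (auto simp: Ep E0)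
    then show False using s_cancel[OF vc] v(2) s_zero_right by metis
  qed
  then obtain c where "poly p c = 0" using alg_closed_imp_poly_has_root[of p] by auto
  then obtain q where q: "p = [:- c, 1:] * q" by (auto simp: poly_eq_0_iff_dvd)
  have q0: "q \<noteq> 0" using p(1) q by auto
  then have "degree p = Suc (degree q)" unfolding q by (subst degree_mult_eq) auto
  then have w: "E q \<noteq> \<zero>" using pmin[of q] q0 by auto
  have "p = smult (- c) q + pCons 0 q" by (simp add: q)
  with p(2) have "E (smult (- c) q + pCons 0 q) = \<zero>" by (simp only:)
  then have "s (- c) (E q) \<oplus> T (E q) = \<zero>"
    unfolding Eadd Esm using Ep[of 0 q] s_zero_left[OF vc] TE by simp
  then have "T (E q) \<oplus> s (- c) (E q) = \<zero>" using TE s_closed[OF Ec[of q]] by (simp add: a_comm)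
  then have "T (E q) = s c (E q)"
    using s_minus(2)[OF Ec[of q], of c] TE s_closed[OF Ec[of q]] s_closed[OF Ec[of q]] by (rule zero_sum_unique)
  then show ?thesis using w Esp by blast
qed

text \<open>In a nonzero invariant subspace with the shortest possible spanning list, an operator minus one of
  its eigenvalues has an image that is invariant and has a shorter list, hence is zero: every operator
  is a scalar there.\<close>

lemma common_eigenvector:
  assumes lin: "\<And>T. T \<in> Ops \<Longrightarrow> linear T"
    and comm: "\<And>T U x. T \<in> Ops \<Longrightarrow> U \<in> Ops \<Longrightarrow> x \<in> carrier M \<Longrightarrow> T (U x) = U (T x)"
    and fs0: "set fs0 \<subseteq> carrier M" "sp fs0 = carrier M" and nz: "carrier M \<noteq> {\<zero>}"
  shows "\<exists>v\<in>carrier M. v \<noteq> \<zero> \<and> (\<forall>T\<in>Ops. \<exists>c. T v = s c v)"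
proof -
  define Q where "Q fs \<longleftrightarrow> set fs \<subseteq> carrier M \<and> sp fs \<noteq> {\<zero>} \<and> (\<forall>T\<in>Ops. T ` sp fs \<subseteq> sp fs)" for fs
  have "Q fs0" using fs0 nz linearD(1)[OF lin] by (auto simp: Q_def)
  define fs where "fs = arg_min length Q"
  have "Q fs" and min: "\<And>gs. Q gs \<Longrightarrow> length fs \<le> length gs"
    using arg_min_nat_lemma[of Q, OF \<open>Q fs0\<close>, of length] unfolding fs_def by blast+
  then have fs: "set fs \<subseteq> carrier M" "sp fs \<noteq> {\<zero>}" "\<And>T. T \<in> Ops \<Longrightarrow> T ` sp fs \<subseteq> sp fs" by (auto simp: Q_def)
  obtain v where v: "v \<in> sp fs" "v \<noteq> \<zero>" using fs(2) sp_zero[OF fs(1)] by blast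
  have sub: "sp fs \<subseteq> carrier M" using sp_carrier[OF fs(1)] .
  have "\<exists>c. T v = s c v" if T: "T \<in> Ops" for T
  proof -
    obtain w c where w: "w \<in> sp fs" "w \<noteq> \<zero>" "T w = s c w"
      using eigenvector[OF lin[OF T] fs(1) fs(3)[OF T] v] by blast
    define S where "S x = T x \<oplus> s (- c) x" for x
    have S: "linear S"
      unfolding linear_def S_def
      using linearD[OF lin[OF T]] s_closed s_add_right s_mult[symmetric]
      by (auto simp: a_ac mult.commute)
    have "w \<in> carrier M" using w sub by auto
    then have "S w = \<zero>" using w(3) s_minus(2) by (simp add: S_def)
    then obtain gs where gs: "length gs < length fs" "set gs \<subseteq> carrier M" "S ` sp fs = sp gs"
      using sp_image_shorter[OF S fs(1) w(1,2)] by blast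
    have "U ` sp gs \<subseteq> sp gs" if U: "U \<in> Ops" for U
    proof -
      have "U (S x) = S (U x)" if "x \<in> sp fs" for x
        using that sub linearD[OF lin[OF U]] linearD[OF lin[OF T]] s_closed comm[OF T U]
        by (auto simp: S_def)
      then have "U ` S ` sp fs \<subseteq> S ` sp fs" using fs(3)[OF U] by auto
      then show ?thesis by (simp add: gs(3))
    qed
    then have "sp gs = {\<zero>}" using min[of gs] gs by (auto simp: Q_def)
    then have "S v = \<zero>" using gs(3) v(1) by auto
    have vM: "v \<in> carrier M" using sub v(1) by blast
    have "T v = s c v"
      using \<open>S v = \<zero>\<close> s_minus(2)[OF vM, of c] linearD(1)[OF lin[OF T] vM] s_closed[OF vM] s_closed[OF vM]
      unfolding S_def by (rule zero_sum_unique)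
    then show ?thesis by blast
  qed
  then show ?thesis using v sub by blast
qed

end

section \<open>Specialized modules\<close>

lemma pair_ring_simps:
  "x \<otimes>\<^bsub>pair_ring R\<^esub> y = bilinear_ext (\<lambda>(h, a) (h', b). frag_of (h \<otimes>\<^bsub>R\<^esub> h', a * b)) x y"
  "\<one>\<^bsub>pair_ring R\<^esub> = frag_of (\<one>\<^bsub>R\<^esub>, 1)" "\<zero>\<^bsub>pair_ring R\<^esub> = 0" "x \<oplus>\<^bsub>pair_ring R\<^esub> y = x + y"
  "x \<in> carrier (pair_ring R) \<longleftrightarrow> Poly_Mapping.keys x \<subseteq> carrier R \<times> UNIV"
  by (simp_all add: pair_ring_def)

lemma pair_ring_mult [simp]:
  "frag_of (h, a) \<otimes>\<^bsub>pair_ring R\<^esub> frag_of (h', b) = frag_of (h \<otimes>\<^bsub>R\<^esub> h', a * b)"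
  by (simp add: pair_ring_simps bilinear_ext_single)

lemma pair_ring_mult_diff:
  "(x - y) \<otimes>\<^bsub>pair_ring R\<^esub> z = x \<otimes>\<^bsub>pair_ring R\<^esub> z - y \<otimes>\<^bsub>pair_ring R\<^esub> z"
  "z \<otimes>\<^bsub>pair_ring R\<^esub> (x - y) = z \<otimes>\<^bsub>pair_ring R\<^esub> x - z \<otimes>\<^bsub>pair_ring R\<^esub> y"
  by (simp_all add: pair_ring_simps bilinear_ext_diff_left bilinear_ext_diff_right)

lemma frag_in_pair_ring [simp]: "frag_of (h, a) \<in> carrier (pair_ring R) \<longleftrightarrow> h \<in> carrier R"
  by (simp add: pair_ring_simps)

lemma pair_ring_ring: assumes "ring R" shows "ring (pair_ring R)"
proof (rule ring_of_table[of _ "carrier R \<times> UNIV" UNIV "\<lambda>(h, a) (h', b). frag_of (h \<otimes>\<^bsub>R\<^esub> h', a * b)" "(\<one>\<^bsub>R\<^esub>, 1)"])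
  interpret ring R by fact
  show "pair_ring R = \<lparr>carrier = {f. Poly_Mapping.keys f \<subseteq> carrier R \<times> UNIV \<and> (\<forall>w. Poly_Mapping.lookup f w \<in> UNIV)},
      monoid.mult = bilinear_ext (\<lambda>(h, a) (h', b). frag_of (h \<otimes>\<^bsub>R\<^esub> h', a * b)),
      one = frag_of (\<one>\<^bsub>R\<^esub>, 1), ring.zero = 0, add = (+)\<rparr>"
    by (simp add: pair_ring_def)
  show "(\<one>\<^bsub>R\<^esub>, 1) \<in> carrier R \<times> UNIV" by simp
qed (use assms in \<open>auto simp: bilinear_ext_single ring.ring_simprules ring.is_monoid monoid.m_assoc mult.assoc
  monoid.l_one monoid.r_one\<close>)

lemma pair_ring_a_inv:
  assumes "ring R" "x \<in> carrier (pair_ring R)"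
  shows "\<ominus>\<^bsub>pair_ring R\<^esub> x = - x" "- x \<in> carrier (pair_ring R)"
proof -
  interpret P: ring "pair_ring R" using pair_ring_ring[OF assms(1)] .
  have "Poly_Mapping.keys (- x) = Poly_Mapping.keys x" by (auto simp: in_keys_iff)
  then show c: "- x \<in> carrier (pair_ring R)" using assms(2) by (simp add: pair_ring_simps)
  show "\<ominus>\<^bsub>pair_ring R\<^esub> x = - x"
    by (rule P.minus_equality) (use assms c in \<open>simp_all add: pair_ring_simps\<close>)
qed

lemma pair_ring_minus_closed:
  assumes "ring R" "x \<in> carrier (pair_ring R)" "y \<in> carrier (pair_ring R)"
  shows "x - y \<in> carrier (pair_ring R)"
  using assms(2,3) keys_diff[of x y] by (auto simp: pair_ring_simps)

text \<open>Specialization and induction use the same generating relations and differ only in the ring \<open>B\<close>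
  over which the tensor product is taken.\<close>

locale tensor = R?: ring R for R :: "'h ring" (structure) +
  fixes B :: "'b set" and r :: "'h \<Rightarrow> 'b \<Rightarrow> 'h" and l :: "'b \<Rightarrow> 'k::comm_ring_1 \<Rightarrow> 'k"
  assumes r_closed: "h \<in> carrier R \<Longrightarrow> b \<in> B \<Longrightarrow> r h b \<in> carrier R"
begin

abbreviation "P \<equiv> pair_ring R :: (('h \<times> 'k) \<Rightarrow>\<^sub>0 int) ring"
abbreviation "J \<equiv> tensor_kernel R B r l"

sublocale P: ring P by (rule pair_ring_ring) (rule ring_axioms)

definition relations :: "(('h \<times> 'k) \<Rightarrow>\<^sub>0 int) set" where
  "relations = {frag_of (h \<oplus> h', a) - frag_of (h, a) - frag_of (h', a) | h h' a.
           h \<in> carrier R \<and> h' \<in> carrier R} \<union>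
        {frag_of (h, a + a') - frag_of (h, a) - frag_of (h, a') | h a a'. h \<in> carrier R} \<union>
        {frag_of (r h b, a) - frag_of (h, l b a) | h b a. h \<in> carrier R \<and> b \<in> B}"

lemma J_generate: "J = generate (add_monoid P) relations"
  by (simp add: tensor_kernel_def relations_def)

lemma relations_carrier: "relations \<subseteq> carrier P"
  unfolding relations_def by (auto intro!: pair_ring_minus_closed ring_axioms r_closed)

lemma J_subgroup: "subgroup J (add_monoid P)"
  unfolding J_generate using relations_carrier by (intro P.add.generate_is_subgroup) simp

lemma J_carrier: "x \<in> J \<Longrightarrow> x \<in> carrier P"
  using subgroup.subset[OF J_subgroup] by auto

lemma J_zero: "0 \<in> J"
  using subgroup.one_closed[OF J_subgroup] by (simp add: pair_ring_simps)

lemma J_add: "x \<in> J \<Longrightarrow> y \<in> J \<Longrightarrow> x + y \<in> J"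
  using subgroup.m_closed[OF J_subgroup, of x y] by (simp add: pair_ring_simps)

lemma J_uminus: "x \<in> J \<Longrightarrow> - x \<in> J"
  using subgroup.m_inv_closed[OF J_subgroup, of x] pair_ring_a_inv(1)[OF ring_axioms J_carrier]
  by (simp add: a_inv_def)

lemma J_diff: "x \<in> J \<Longrightarrow> y \<in> J \<Longrightarrow> x - y \<in> J"
  using J_add[OF _ J_uminus, of x y] by simp

lemma J_rel: "x \<in> relations \<Longrightarrow> x \<in> J"
  unfolding J_generate by (rule generate.incl)

lemma J_add_left: "h \<in> carrier R \<Longrightarrow> h' \<in> carrier R \<Longrightarrow>
    frag_of (h \<oplus> h', a) - frag_of (h, a) - frag_of (h', a) \<in> J"
  by (rule J_rel) (unfold relations_def, blast)

lemma J_add_right: "h \<in> carrier R \<Longrightarrow> frag_of (h, a + a') - frag_of (h, a) - frag_of (h, a') \<in> J"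
  by (rule J_rel) (unfold relations_def, blast)

lemma J_balanced: "h \<in> carrier R \<Longrightarrow> b \<in> B \<Longrightarrow> frag_of (r h b, a) - frag_of (h, l b a) \<in> J"
  by (rule J_rel) (unfold relations_def, blast)

lemma J_induct [consumes 1, case_names zero left right balanced uminus add]:
  assumes "x \<in> J" and zero: "Q 0"
    and left: "\<And>h h' a. h \<in> carrier R \<Longrightarrow> h' \<in> carrier R \<Longrightarrow>
      Q (frag_of (h \<oplus> h', a) - frag_of (h, a) - frag_of (h', a))"
    and right: "\<And>h a a'. h \<in> carrier R \<Longrightarrow> Q (frag_of (h, a + a') - frag_of (h, a) - frag_of (h, a'))"
    and bal: "\<And>h b a. h \<in> carrier R \<Longrightarrow> b \<in> B \<Longrightarrow> Q (frag_of (r h b, a) - frag_of (h, l b a))"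
    and um: "\<And>x. x \<in> J \<Longrightarrow> Q x \<Longrightarrow> Q (- x)"
    and add: "\<And>x y. x \<in> J \<Longrightarrow> y \<in> J \<Longrightarrow> Q x \<Longrightarrow> Q y \<Longrightarrow> Q (x + y)"
  shows "Q x"
proof -
  have rel: "Q x" if "x \<in> relations" for x
    using that left right bal unfolding relations_def by blast
  from assms(1) show ?thesis
    unfolding J_generate
  proof (induction rule: generate.induct)
    case one
    then show ?case using zero by (simp add: pair_ring_simps)
  next
    case (incl x)
    then show ?case using rel by blast
  next
    case (inv x)
    then have "inv\<^bsub>add_monoid P\<^esub> x = - x"
      using pair_ring_a_inv(1)[OF ring_axioms, of x] relations_carrier by (auto simp: a_inv_def)
    then show ?case using um[OF J_rel[OF inv] rel[OF inv]] by simp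
  next
    case (eng x y)
    then show ?case using add[of x y] by (simp add: J_generate pair_ring_simps)
  qed
qed

end

locale hecke_module = hecke_datum D t
  for D :: "('x::ab_group_add, 'y::ab_group_add) root_data" and t :: "'x hecke_table" +
  fixes \<phi> :: "'x laurent \<Rightarrow> 'k::alg_closed_field"
    and M :: "(('x hecke_elt \<times> 'k \<Rightarrow>\<^sub>0 int) set, 'm) module"
  assumes simple: "simple_left_module (hecke_specialized D t \<phi>) M"
    and fin_dim: "finite_dimensional D t \<phi> M"
begin

abbreviation "I \<equiv> specialization_kernel D t \<phi>"
abbreviation "S \<equiv> hecke_specialized D t \<phi>"

sublocale H: ring H by (rule H_ring)

sublocale K: tensor H "weight_ring D" "\<lambda>h p. scale p h" "\<lambda>p a. \<phi> p * a"
  by unfold_locales (rule scale_H)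

abbreviation "PR \<equiv> pair_ring H :: (('x hecke_elt \<times> 'k) \<Rightarrow>\<^sub>0 int) ring"

lemma I_eq: "I = tensor_kernel H (weight_ring D) (\<lambda>h p. scale p h) (\<lambda>p a. \<phi> p * a)"
  by (simp add: specialization_kernel_def)

text \<open>Weights are central in \<open>H\<close>, so multiplying a relation by a basis element on either side gives a
  relation of the same kind.\<close>

lemma I_mult_frag:
  assumes "x \<in> I" "h \<in> carrier H"
  shows "frag_of (h, a) \<otimes>\<^bsub>PR\<^esub> x \<in> I" "x \<otimes>\<^bsub>PR\<^esub> frag_of (h, a) \<in> I"
  using assms(1) unfolding I_eq
proof (induction rule: K.J_induct)
  case zero
  { case 1 then show ?case using K.J_zero by (simp add: pair_ring_simps) }
  { case 2 then show ?case using K.J_zero by (simp add: pair_ring_simps) }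
next
  case (left h1 h2 b)
  { case 1 show ?case
      using K.J_add_left[of "h \<otimes>\<^bsub>H\<^esub> h1" "h \<otimes>\<^bsub>H\<^esub> h2" "a * b"] H.m_closed[OF assms(2)] left H.r_distr[OF left assms(2)]
      unfolding pair_ring_mult_diff pair_ring_mult by simp }
  { case 2 show ?case
      using K.J_add_left[of "h1 \<otimes>\<^bsub>H\<^esub> h" "h2 \<otimes>\<^bsub>H\<^esub> h" "b * a"] H.m_closed[OF _ assms(2)] left H.l_distr[OF left assms(2)]
      unfolding pair_ring_mult_diff pair_ring_mult by simp }
next
  case (right h1 b c)
  { case 1 show ?case
      using K.J_add_right[OF H.m_closed[OF assms(2) right], of "a * b" "a * c"]
      unfolding pair_ring_mult_diff pair_ring_mult by (simp add: distrib_left) }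
  { case 2 show ?case
      using K.J_add_right[OF H.m_closed[OF right assms(2)], of "b * a" "c * a"]
      unfolding pair_ring_mult_diff pair_ring_mult by (simp add: distrib_right) }
next
  case (balanced h1 p b)
  { case 1 show ?case
      using K.J_balanced[OF H.m_closed[OF assms(2) balanced(1)] balanced(2), of "a * b"]
      unfolding pair_ring_mult_diff pair_ring_mult by (simp add: bilinear_ext_scale_right mult_ac) }
  { case 2 show ?case
      using K.J_balanced[OF H.m_closed[OF balanced(1) assms(2)] balanced(2), of "b * a"]
      unfolding pair_ring_mult_diff pair_ring_mult by (simp add: bilinear_ext_scale_left mult_ac) }
next
  case (uminus x)
  { case 1 show ?case using K.J_uminus[OF uminus(2)] by (simp add: pair_ring_simps bilinear_ext_uminus) }
  { case 2 show ?case using K.J_uminus[OF uminus(3)] by (simp add: pair_ring_simps bilinear_ext_uminus) }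
next
  case (add x y)
  { case 1 show ?case using K.J_add[OF add(3,5)] by (simp add: pair_ring_simps bilinear_ext_add_right) }
  { case 2 show ?case using K.J_add[OF add(4,6)] by (simp add: pair_ring_simps bilinear_ext_add_left) }
qed

lemma I_ideal: "ideal I PR"
proof (rule idealI[OF K.P.ring_axioms])
  show "subgroup I (add_monoid PR)" using K.J_subgroup I_eq by simp
  fix x z assume x: "x \<in> I" and "z \<in> carrier PR"
  then have "Poly_Mapping.keys z \<subseteq> carrier H \<times> UNIV" by (simp add: pair_ring_simps)
  then have "z \<otimes>\<^bsub>PR\<^esub> x \<in> I \<and> x \<otimes>\<^bsub>PR\<^esub> z \<in> I"
  proof (induction z rule: frag_induction)
    case zero
    then show ?case using K.J_zero I_eq by (simp add: pair_ring_simps)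
  next
    case (one ha)
    then show ?case using I_mult_frag[OF x] by (cases ha) auto
  next
    case (diff u w)
    then show ?case using K.J_diff I_eq by (simp only: pair_ring_mult_diff)
  qed
  then show "z \<otimes>\<^bsub>PR\<^esub> x \<in> I" "x \<otimes>\<^bsub>PR\<^esub> z \<in> I" by auto
qed

sublocale I: ideal I PR by (rule I_ideal)

lemma module: "left_module S M"
  using simple by (simp add: simple_left_module_def)

sublocale L: left_module S M by (rule module)

text \<open>Working with representatives: \<open>M\<close> is a module over the monoid ring, and the kernel acts by zero.
  This makes all maps out of tensor products below additive for free.\<close>

definition act :: "('x hecke_elt \<times> 'k \<Rightarrow>\<^sub>0 int) \<Rightarrow> 'm \<Rightarrow> 'm" where
  "act z m = (I +>\<^bsub>PR\<^esub> z) \<odot>\<^bsub>M\<^esub> m"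

lemma S_eq: "S = PR Quot I"
  by (simp add: hecke_specialized_def)

lemma class_hom: "(\<lambda>z. I +>\<^bsub>PR\<^esub> z) \<in> ring_hom PR S"
  unfolding S_eq by (rule I.rcos_ring_hom)

lemma act_closed: "z \<in> carrier PR \<Longrightarrow> m \<in> carrier M \<Longrightarrow> act z m \<in> carrier M"
  unfolding act_def using ring_hom_closed[OF class_hom] by (intro L.smult_closed)

lemma act_add: "z \<in> carrier PR \<Longrightarrow> z' \<in> carrier PR \<Longrightarrow> m \<in> carrier M \<Longrightarrow>
    act (z + z') m = act z m \<oplus>\<^bsub>M\<^esub> act z' m"
  unfolding act_def using ring_hom_add[OF class_hom, of z z'] ring_hom_closed[OF class_hom] L.smult_l_distr
  by (simp add: pair_ring_simps(4))

lemma act_mult: "z \<in> carrier PR \<Longrightarrow> z' \<in> carrier PR \<Longrightarrow> m \<in> carrier M \<Longrightarrow>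
    act (z \<otimes>\<^bsub>PR\<^esub> z') m = act z (act z' m)"
  unfolding act_def using ring_hom_mult[OF class_hom, of z z'] ring_hom_closed[OF class_hom] L.smult_assoc
  by simp

lemma act_add_right: "z \<in> carrier PR \<Longrightarrow> m \<in> carrier M \<Longrightarrow> m' \<in> carrier M \<Longrightarrow>
    act z (m \<oplus>\<^bsub>M\<^esub> m') = act z m \<oplus>\<^bsub>M\<^esub> act z m'"
  unfolding act_def using ring_hom_closed[OF class_hom] by (intro L.smult_r_distr)

lemma act_one: "m \<in> carrier M \<Longrightarrow> act \<one>\<^bsub>PR\<^esub> m = m"
  unfolding act_def using ring_hom_one[OF class_hom] L.smult_one by simp

lemma act_zero: assumes "m \<in> carrier M" shows "act 0 m = \<zero>\<^bsub>M\<^esub>"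
proof -
  have c: "0 \<in> carrier PR" using K.P.zero_closed by (simp add: pair_ring_simps)
  have "act 0 m \<oplus>\<^bsub>M\<^esub> act 0 m = act 0 m" using act_add[OF c c assms] by simp
  then show ?thesis using act_closed[OF c assms] by simp
qed

lemma act_I: assumes "z \<in> I" "m \<in> carrier M" shows "act z m = \<zero>\<^bsub>M\<^esub>"
proof -
  have "0 \<in> carrier PR" using K.P.zero_closed by (simp add: pair_ring_simps)
  then have "I +>\<^bsub>PR\<^esub> z = I +>\<^bsub>PR\<^esub> 0"
    using I.a_rcos_const[OF assms(1)] I.a_rcos_const[of 0] K.J_zero I_eq by simp
  then show ?thesis using act_zero[OF assms(2)] by (simp add: act_def)
qed

lemma act_eqI:
  assumes "x - y \<in> I" "y \<in> carrier PR" "m \<in> carrier M" shows "act x m = act y m"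
proof -
  have "act ((x - y) + y) m = act (x - y) m \<oplus>\<^bsub>M\<^esub> act y m"
    using assms I.a_Hcarr by (intro act_add) auto
  then show ?thesis using act_I[OF assms(1,3)] act_closed[OF assms(2,3)] by simp
qed

abbreviation hc :: "'x hecke_elt \<Rightarrow> 'm \<Rightarrow> 'm" where "hc h \<equiv> act (frag_of (h, 1))"
abbreviation sc :: "'k \<Rightarrow> 'm \<Rightarrow> 'm" where "sc a \<equiv> act (frag_of (\<one>\<^bsub>H\<^esub>, a))"

lemma frag_closed: "h \<in> carrier H \<Longrightarrow> frag_of (h, a) \<in> carrier PR"
  by simp

lemma one_frag_closed: "frag_of (\<one>\<^bsub>H\<^esub>, a) \<in> carrier PR"
  using H.one_closed by (rule frag_closed)

lemma act_frag:
  assumes "h \<in> carrier H" "m \<in> carrier M"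
  shows "act (frag_of (h, a)) m = hc h (sc a m)" "act (frag_of (h, a)) m = sc a (hc h m)"
proof -
  have "frag_of (h, 1) \<otimes>\<^bsub>PR\<^esub> frag_of (\<one>\<^bsub>H\<^esub>, a) = frag_of (h, a)"
    "frag_of (\<one>\<^bsub>H\<^esub>, a) \<otimes>\<^bsub>PR\<^esub> frag_of (h, 1) = frag_of (h, a)"
    using H.l_one[OF assms(1)] H.r_one[OF assms(1)] by (simp_all only: pair_ring_mult) simp_all
  then show "act (frag_of (h, a)) m = hc h (sc a m)" "act (frag_of (h, a)) m = sc a (hc h m)"
    using act_mult[OF frag_closed[OF assms(1)] one_frag_closed assms(2)]
      act_mult[OF one_frag_closed frag_closed[OF assms(1)] assms(2)] by metis+
qed

lemma act_frag_add_right: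
  assumes "h \<in> carrier H" "m \<in> carrier M"
  shows "act (frag_of (h, a + a')) m = act (frag_of (h, a)) m \<oplus>\<^bsub>M\<^esub> act (frag_of (h, a')) m"
proof -
  have "act (frag_of (h, a + a')) m = act (frag_of (h, a) + frag_of (h, a')) m"
    using K.J_add_right[OF assms(1), of a a'] K.P.a_closed[of "frag_of (h, a)" "frag_of (h, a')"] assms
    by (intro act_eqI) (simp_all add: I_eq diff_diff_eq pair_ring_simps(4))
  then show ?thesis using act_add[OF frag_closed frag_closed] assms by simp
qed

lemma hc_add:
  assumes "h \<in> carrier H" "h' \<in> carrier H" "m \<in> carrier M"
  shows "act (frag_of (h + h', a)) m = act (frag_of (h, a)) m \<oplus>\<^bsub>M\<^esub> act (frag_of (h', a)) m"
proof -
  have "act (frag_of (h + h', a)) m = act (frag_of (h, a) + frag_of (h', a)) m"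
    using K.J_add_left[OF assms(1,2), of a] K.P.a_closed[of "frag_of (h, a)" "frag_of (h', a)"] assms
    by (intro act_eqI) (simp_all add: I_eq diff_diff_eq pair_ring_simps(4))
  then show ?thesis using act_add[OF frag_closed frag_closed] assms by simp
qed

lemma hc_mult:
  assumes "h \<in> carrier H" "h' \<in> carrier H" "m \<in> carrier M"
  shows "hc (bilinear_ext t h h') m = hc h (hc h' m)"
  using act_mult[OF frag_closed[OF assms(1), of 1] frag_closed[OF assms(2), of 1] assms(3)] by simp

lemma sc_mult: "m \<in> carrier M \<Longrightarrow> sc (a * b) m = sc a (sc b m)"
  using act_mult[OF one_frag_closed[of a] one_frag_closed[of b]] H.l_one[OF H.one_closed]
  by (simp only: pair_ring_mult)

lemma hc_scalar:
  assumes "p \<in> weight_ring D" "m \<in> carrier M"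
  shows "hc (scale p \<one>\<^bsub>H\<^esub>) m = sc (\<phi> p) m"
  using K.J_balanced[OF H.one_closed assms(1), of 1] assms(2) one_frag_closed
  by (intro act_eqI) (simp_all add: I_eq del: H_simps)

sublocale V: closed_scalar_action M sc
proof unfold_locales
  fix x y c d assume x: "x \<in> carrier M"
  show "sc c x \<in> carrier M" using act_closed[OF one_frag_closed x] .
  show "sc (c + d) x = sc c x \<oplus>\<^bsub>M\<^esub> sc d x" using act_frag_add_right[OF H.one_closed x] .
  show "sc (c * d) x = sc c (sc d x)" using sc_mult[OF x] .
  show "sc 1 x = x" using act_one[OF x] by (simp add: pair_ring_simps)
  assume y: "y \<in> carrier M"
  show "sc c (x \<oplus>\<^bsub>M\<^esub> y) = sc c x \<oplus>\<^bsub>M\<^esub> sc c y" using act_add_right[OF one_frag_closed x y] .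
qed

lemma hc_linear: assumes "h \<in> carrier H" shows "V.linear (hc h)"
  unfolding V.linear_def
proof (intro conjI ballI allI funcsetI)
  fix x y c assume x: "x \<in> carrier M"
  show "hc h x \<in> carrier M" using act_closed[OF frag_closed[OF assms] x] .
  show "hc h (sc c x) = sc c (hc h x)" by (rule trans[OF act_frag(1)[OF assms x, symmetric] act_frag(2)[OF assms x]])
  assume y: "y \<in> carrier M"
  show "hc h (x \<oplus>\<^bsub>M\<^esub> y) = hc h x \<oplus>\<^bsub>M\<^esub> hc h y" using act_add_right[OF frag_closed[OF assms] x y] .
qed

lemma spanning_list: "\<exists>fs. set fs \<subseteq> carrier M \<and> V.sp fs = carrier M"
proof -
  obtain F where F: "finite F" "F \<subseteq> carrier M"
    "\<And>m. m \<in> carrier M \<Longrightarrow> \<exists>c. m = (\<Oplus>\<^bsub>M\<^esub>v\<in>F. scalar D t \<phi> (c v) \<odot>\<^bsub>M\<^esub> v)"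
    using fin_dim unfolding finite_dimensional_def by blast
  obtain fs where fs: "set fs = F" "distinct fs" using finite_distinct_list[OF F(1)] by blast
  have sp: "(\<Oplus>\<^bsub>M\<^esub>v\<in>set gs. sc (c v) v) \<in> V.sp gs" if "distinct gs" "set gs \<subseteq> carrier M" for c gs
    using that
  proof (induction gs)
    case (Cons g gs)
    have e: "(\<Oplus>\<^bsub>M\<^esub>v\<in>set (g # gs). sc (c v) v) = sc (c g) g \<oplus>\<^bsub>M\<^esub> (\<Oplus>\<^bsub>M\<^esub>v\<in>set gs. sc (c v) v)"
      unfolding list.set using Cons.prems V.s_closed by (intro L.M.finsum_insert) auto
    have "(\<Oplus>\<^bsub>M\<^esub>v\<in>set gs. sc (c v) v) \<in> V.sp gs" using Cons by auto
    then show ?case unfolding e V.sp.simps by blast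
  qed (simp only: V.sp.simps list.set L.M.finsum_empty singletonI)
  have "m \<in> V.sp fs" if m: "m \<in> carrier M" for m
  proof -
    obtain c where "m = (\<Oplus>\<^bsub>M\<^esub>v\<in>F. scalar D t \<phi> (c v) \<odot>\<^bsub>M\<^esub> v)" using F(3)[OF m] by blast
    then show ?thesis using sp[OF fs(2), of c] F(2) fs(1) by (simp add: scalar_def act_def)
  qed
  then show ?thesis using V.sp_carrier[of fs] F(2) fs(1) by blast
qed

lemma AH_eigenvector:
  "\<exists>v\<in>carrier M. v \<noteq> \<zero>\<^bsub>M\<^esub> \<and> (\<forall>b\<in>AH. \<exists>c. hc b v = sc c v)"
proof -
  obtain fs where fs: "set fs \<subseteq> carrier M" "V.sp fs = carrier M" using spanning_list by blast
  have "\<exists>v\<in>carrier M. v \<noteq> \<zero>\<^bsub>M\<^esub> \<and> (\<forall>T\<in>hc ` AH. \<exists>c. T v = sc c v)"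
  proof (rule V.common_eigenvector[OF _ _ fs])
    show "carrier M \<noteq> {\<zero>\<^bsub>M\<^esub>}" using simple by (simp add: simple_left_module_def)
    fix T assume T: "T \<in> hc ` AH"
    then show "V.linear T" using hc_linear AH_carrier by blast
    fix U x assume U: "U \<in> hc ` AH" and x: "x \<in> carrier M"
    obtain b c where b: "b \<in> AH" "T = hc b" and c: "c \<in> AH" "U = hc c" using T U by blast
    show "T (U x) = U (T x)"
      unfolding b(2) c(2) hc_mult[OF AH_carrier[OF b(1)] AH_carrier[OF c(1)] x, symmetric]
        hc_mult[OF AH_carrier[OF c(1)] AH_carrier[OF b(1)] x, symmetric]
      by (simp only: AH_commute[OF b(1) c(1)])
  qed
  then show ?thesis by blast
qed

end

locale weight_vector = hecke_module D t \<phi> M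
  for D :: "('x::ab_group_add, 'y::ab_group_add) root_data" and t :: "'x hecke_table"
    and \<phi> :: "'x laurent \<Rightarrow> 'k::alg_closed_field"
    and M :: "(('x hecke_elt \<times> 'k \<Rightarrow>\<^sub>0 int) set, 'm) module" +
  fixes v :: 'm and \<chi> :: "'x hecke_elt \<Rightarrow> 'k"
  assumes v: "v \<in> carrier M" "v \<noteq> \<zero>\<^bsub>M\<^esub>" and \<chi>: "\<And>b. b \<in> AH \<Longrightarrow> hc b v = sc (\<chi> b) v"
    and \<phi>_one: "\<phi> 1 = 1"
begin

lemma sc_unique: assumes "sc a v = sc b v" shows "a = b"
proof (rule ccontr)
  assume "a \<noteq> b"
  have "sc (a + - b) v = \<zero>\<^bsub>M\<^esub>" using V.s_add_left[OF v(1), of a "- b"] V.s_minus[OF v(1), of b] assms by simp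
  then show False using V.s_cancel[OF v(1), of "a + - b"] V.s_zero_right v(2) \<open>a \<noteq> b\<close> by simp
qed

lemma chi_scalar: assumes "p \<in> weight_ring D" shows "\<chi> (scale p \<one>\<^bsub>H\<^esub>) = \<phi> p"
  using \<chi>[of "scale p \<one>\<^bsub>H\<^esub>"] AH_scalar[OF assms] hc_scalar[OF assms v(1)] sc_unique by simp

lemma chi_character: "\<chi> \<in> characters_extending D t \<phi>"
proof -
  have "\<chi> (b + b') = \<chi> b + \<chi> b'" if "b \<in> AH" "b' \<in> AH" for b b'
  proof (rule sc_unique)
    show "sc (\<chi> (b + b')) v = sc (\<chi> b + \<chi> b') v"
      using \<chi>[OF that(1)] \<chi>[OF that(2)] \<chi>[OF AH_add[OF that]] hc_add[OF AH_carrier AH_carrier v(1), OF that, of 1]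
        V.s_add_left[OF v(1), of "\<chi> b" "\<chi> b'"] by simp
  qed
  moreover have "\<chi> (bilinear_ext t b b') = \<chi> b * \<chi> b'" if "b \<in> AH" "b' \<in> AH" for b b'
  proof (rule sc_unique)
    have "sc (\<chi> (bilinear_ext t b b')) v = hc b (hc b' v)"
      using \<chi>[OF AH_mult[OF that]] hc_mult[OF AH_carrier AH_carrier v(1), OF that] by simp
    also have "\<dots> = sc (\<chi> b') (hc b v)"
      unfolding \<chi>[OF that(2)]
      by (rule trans[OF act_frag(1)[OF AH_carrier[OF that(1)] v(1), symmetric] act_frag(2)[OF AH_carrier[OF that(1)] v(1)]])
    also have "\<dots> = sc (\<chi> b') (sc (\<chi> b) v)" by (simp only: \<chi>[OF that(1)])
    also have "\<dots> = sc (\<chi> b * \<chi> b') v" using sc_mult[OF v(1), of "\<chi> b'" "\<chi> b"] by (simp add: mult.commute)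
    finally show "sc (\<chi> (bilinear_ext t b b')) v = sc (\<chi> b * \<chi> b') v" .
  qed
  moreover have "\<chi> \<one>\<^bsub>H\<^esub> = 1" using chi_scalar[OF weight_one] \<phi>_one by simp
  ultimately show ?thesis
    using chi_scalar by (simp add: characters_extending_def ring_hom_def ring_of_type_algebra_def)
qed

sublocale J: tensor H AH "\<lambda>h b. h \<otimes>\<^bsub>H\<^esub> b" "\<lambda>b a. \<chi> b * a"
  by unfold_locales (rule H.m_closed, use AH_carrier in auto)

abbreviation "J \<equiv> standard_kernel D t \<chi>"

lemma J_eq: "J = tensor_kernel H AH (\<lambda>h b. h \<otimes>\<^bsub>H\<^esub> b) (\<lambda>b a. \<chi> b * a)"
  by (simp add: standard_kernel_def)

text \<open>The first two families of relations already hold in the specialized algebra; the third expresses that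
  \<open>v\<close> has weight \<open>\<chi>\<close>.\<close>

lemma J_kills: "z \<in> J \<Longrightarrow> act z v = \<zero>\<^bsub>M\<^esub>"
  unfolding J_eq
proof (induction rule: J.J_induct)
  case zero
  show ?case using act_zero v(1) .
next
  case (left h h' a)
  show ?case using act_I[OF _ v(1)] K.J_add_left[OF left] I_eq by simp
next
  case (right h a a')
  show ?case using act_I[OF _ v(1)] K.J_add_right[OF right] I_eq by simp
next
  case (balanced h b a)
  note b = AH_carrier[OF balanced(2)] and h = balanced(1)
  have hb: "h \<otimes>\<^bsub>H\<^esub> b \<in> carrier H" using h b by (rule H.m_closed)
  have "act (frag_of (h \<otimes>\<^bsub>H\<^esub> b, a)) v = act (frag_of (h, a) \<otimes>\<^bsub>PR\<^esub> frag_of (b, 1)) v"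
    by (simp only: pair_ring_mult mult_1_right)
  also have "\<dots> = act (frag_of (h, a)) (sc (\<chi> b) v)"
    by (simp only: act_mult[OF frag_closed[OF h] frag_closed[OF b] v(1)] \<chi>[OF balanced(2)])
  also have "\<dots> = act (frag_of (h, a) \<otimes>\<^bsub>PR\<^esub> frag_of (\<one>\<^bsub>H\<^esub>, \<chi> b)) v"
    by (simp only: act_mult[OF frag_closed[OF h] one_frag_closed v(1)])
  also have "frag_of (h, a) \<otimes>\<^bsub>PR\<^esub> frag_of (\<one>\<^bsub>H\<^esub>, \<chi> b) = frag_of (h, \<chi> b * a)"
    using H.r_one[OF h] by (simp only: pair_ring_mult mult.commute)
  finally have e: "act (frag_of (h \<otimes>\<^bsub>H\<^esub> b, a)) v = act (frag_of (h, \<chi> b * a)) v" .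
  let ?x = "frag_of (h \<otimes>\<^bsub>H\<^esub> b, a)" and ?y = "frag_of (h, \<chi> b * a)"
  have c: "?x \<in> carrier PR" "?y \<in> carrier PR" using frag_closed[OF hb] frag_closed[OF h] by auto
  have "act ((?x - ?y) + ?y) v = act (?x - ?y) v \<oplus>\<^bsub>M\<^esub> act ?y v"
    using pair_ring_minus_closed[OF H_ring c] c(2) v(1) by (rule act_add)
  then show ?case using e act_closed[OF c(2) v(1)] act_closed[OF pair_ring_minus_closed[OF H_ring c] v(1)] by simp
next
  case (uminus x)
  have c: "x \<in> carrier PR" "- x \<in> carrier PR" using J.J_carrier[OF uminus(1)] pair_ring_a_inv(2)[OF H_ring] by auto
  show ?case using act_add[OF c v(1)] act_zero[OF v(1)] uminus(2) act_closed[OF c(2) v(1)] by simp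
next
  case (add x y)
  show ?case using act_add[OF J.J_carrier[OF add(1)] J.J_carrier[OF add(2)] v(1)] add(3,4) by simp
qed

text \<open>Evaluation at \<open>v\<close> of any representative of a class. The choice does not matter, as the kernel kills \<open>v\<close>.\<close>

definition ev :: "('x hecke_elt \<times> 'k \<Rightarrow>\<^sub>0 int) set \<Rightarrow> 'm" where
  "ev Z = act (SOME x. x \<in> Z) v"

lemma ev_eqI: assumes "x \<in> Z" "\<And>y. y \<in> Z \<Longrightarrow> act y v = m" shows "ev Z = m"
  unfolding ev_def using someI[of "\<lambda>x. x \<in> Z", OF assms(1)] assms(2) by blast

lemma coset_act:
  assumes "z \<in> carrier PR" "x \<in> J +>\<^bsub>PR\<^esub> z"
  shows "x \<in> carrier PR" "act x v = act z v"
proof -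
  obtain j where j: "j \<in> J" "x = j + z"
    using assms(2) by (auto simp: a_r_coset_def' pair_ring_simps(4))
  have jc: "j \<in> carrier PR" using J.J_carrier j J_eq by simp
  show "x \<in> carrier PR" using K.P.a_closed[OF jc assms(1)] j by (simp add: pair_ring_simps(4))
  show "act x v = act z v"
    using act_add[OF jc assms(1) v(1)] J_kills[OF j(1)] act_closed[OF assms(1) v(1)] j by simp
qed

lemma mem_coset: "z \<in> J +>\<^bsub>PR\<^esub> z"
  using J.J_zero J_eq by (auto simp: a_r_coset_def' pair_ring_simps(4) intro!: bexI[of _ 0])

lemma ev_coset: "z \<in> carrier PR \<Longrightarrow> ev (J +>\<^bsub>PR\<^esub> z) = act z v"
  using ev_eqI[OF mem_coset] coset_act(2) by blast

lemma standard_carrier: "carrier (standard_module D t \<chi>) = {J +>\<^bsub>PR\<^esub> z | z. z \<in> carrier PR}"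
  by (auto simp: standard_module_def A_RCOSETS_def')

lemma specialized_carrier: "carrier S = {I +>\<^bsub>PR\<^esub> z | z. z \<in> carrier PR}"
  by (auto simp: S_eq FactRing_def A_RCOSETS_def')

lemma ev_hom: "ev \<in> left_module_hom S (standard_module D t \<chi>) M"
  unfolding left_module_hom_def
proof (intro CollectI conjI ballI)
  show "ev \<in> carrier (standard_module D t \<chi>) \<rightarrow> carrier M"
    using act_closed v(1) by (auto simp: standard_carrier ev_coset)
  fix Z assume "Z \<in> carrier (standard_module D t \<chi>)"
  then obtain x where x: "x \<in> carrier PR" "Z = J +>\<^bsub>PR\<^esub> x" by (auto simp: standard_carrier)
  {
    fix Y assume "Y \<in> carrier (standard_module D t \<chi>)"
    then obtain y where y: "y \<in> carrier PR" "Y = J +>\<^bsub>PR\<^esub> y" by (auto simp: standard_carrier)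
    have sum: "Z \<oplus>\<^bsub>standard_module D t \<chi>\<^esub> Y = {a + b | a b. a \<in> Z \<and> b \<in> Y}"
      by (auto simp: standard_module_def set_add_defs pair_ring_simps(4))
    have "x + y \<in> Z \<oplus>\<^bsub>standard_module D t \<chi>\<^esub> Y"
      unfolding sum unfolding x(2) y(2) using mem_coset by blast
    then show "ev (Z \<oplus>\<^bsub>standard_module D t \<chi>\<^esub> Y) = ev Z \<oplus>\<^bsub>M\<^esub> ev Y"
    proof (rule ev_eqI)
      fix z assume "z \<in> Z \<oplus>\<^bsub>standard_module D t \<chi>\<^esub> Y"
      then obtain a b where z: "z = a + b" "a \<in> Z" "b \<in> Y" unfolding sum by blast
      show "act z v = ev Z \<oplus>\<^bsub>M\<^esub> ev Y"
        using act_add[OF coset_act(1)[OF x(1)] coset_act(1)[OF y(1)] v(1), of a b] z x y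
          coset_act(2)[OF x(1), of a] coset_act(2)[OF y(1), of b] by (simp add: ev_coset)
    qed
  next
    fix a assume a: "a \<in> carrier S"
    then obtain w where w: "w \<in> carrier PR" "a = I +>\<^bsub>PR\<^esub> w" by (auto simp: specialized_carrier)
    have aw: "z \<in> carrier PR" "act z m = a \<odot>\<^bsub>M\<^esub> m" if "z \<in> a" "m \<in> carrier M" for z m
    proof -
      show "z \<in> carrier PR" using that(1) w K.P.a_r_coset_subset_G[OF I.a_subset] by auto
      then have "I +>\<^bsub>PR\<^esub> z = a" using that(1) w I.a_repr_independence' by metis
      then show "act z m = a \<odot>\<^bsub>M\<^esub> m" by (simp add: act_def)
    qed
    have prod: "a \<odot>\<^bsub>standard_module D t \<chi>\<^esub> Z = (\<Union>z\<in>a. \<Union>y\<in>Z. J +>\<^bsub>PR\<^esub> (z \<otimes>\<^bsub>PR\<^esub> y))"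
      by (simp add: standard_module_def rcoset_mult_def)
    have "w \<otimes>\<^bsub>PR\<^esub> x \<in> a \<odot>\<^bsub>standard_module D t \<chi>\<^esub> Z"
      unfolding prod unfolding x(2) w(2) using mem_coset I.a_rcos_self[OF w(1)] by blast
    then show "ev (a \<odot>\<^bsub>standard_module D t \<chi>\<^esub> Z) = a \<odot>\<^bsub>M\<^esub> ev Z"
    proof (rule ev_eqI)
      fix u assume "u \<in> a \<odot>\<^bsub>standard_module D t \<chi>\<^esub> Z"
      then obtain z y where zy: "z \<in> a" "y \<in> Z" "u \<in> J +>\<^bsub>PR\<^esub> (z \<otimes>\<^bsub>PR\<^esub> y)" unfolding prod by blast
      have z: "z \<in> carrier PR" using aw(1)[OF zy(1) v(1)] .
      have y: "y \<in> carrier PR" "act y v = act x v" using coset_act[OF x(1)] zy(2) x(2) by auto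
      have "act u v = act (z \<otimes>\<^bsub>PR\<^esub> y) v" using coset_act(2)[OF K.P.m_closed[OF z y(1)] zy(3)] .
      also have "\<dots> = a \<odot>\<^bsub>M\<^esub> act x v"
        using act_mult[OF z y(1) v(1)] aw(2)[OF zy(1) act_closed[OF x(1) v(1)]] y(2) by simp
      finally show "act u v = a \<odot>\<^bsub>M\<^esub> ev Z" using ev_coset[OF x(1)] x(2) by simp
    qed
  }
qed

lemma ev_surj: "ev ` carrier (standard_module D t \<chi>) = carrier M"
proof -
  let ?N = "{act z v | z. z \<in> carrier PR}"
  have im: "ev ` carrier (standard_module D t \<chi>) = ?N"
    by (force simp: standard_carrier ev_coset)
  have "submodule ?N S M"
  proof (intro submodule.intro submodule_axioms.intro subgroup.intro)
    show "?N \<subseteq> carrier (add_monoid M)" using act_closed v(1) by auto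
    show "\<one>\<^bsub>add_monoid M\<^esub> \<in> ?N"
      using act_zero[OF v(1)] K.P.zero_closed by (auto simp: pair_ring_simps(3) intro!: exI[of _ 0])
    fix x assume "x \<in> ?N"
    then obtain z where z: "z \<in> carrier PR" "x = act z v" by blast
    note zm = pair_ring_a_inv(2)[OF H_ring z(1)]
    {
      have "act (- z) v \<oplus>\<^bsub>M\<^esub> act z v = \<zero>\<^bsub>M\<^esub>" using act_add[OF zm z(1) v(1)] act_zero[OF v(1)] by simp
      then have "\<ominus>\<^bsub>M\<^esub> x = act (- z) v"
        using act_closed[OF zm v(1)] act_closed[OF z(1) v(1)] z(2) L.M.minus_equality by simp
      then show "inv\<^bsub>add_monoid M\<^esub> x \<in> ?N" using zm by (auto simp: a_inv_def)
    next
      fix y assume "y \<in> ?N"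
      then obtain w where w: "w \<in> carrier PR" "y = act w v" by blast
      have "z + w \<in> carrier PR" using K.P.a_closed[OF z(1) w(1)] by (simp add: pair_ring_simps(4))
      moreover have "x \<otimes>\<^bsub>add_monoid M\<^esub> y = act (z + w) v" using act_add[OF z(1) w(1) v(1)] z w by simp
      ultimately show "x \<otimes>\<^bsub>add_monoid M\<^esub> y \<in> ?N" by blast
    next
      fix a assume "a \<in> carrier S"
      then obtain w where w: "w \<in> carrier PR" "a = I +>\<^bsub>PR\<^esub> w" by (auto simp: specialized_carrier)
      have "a \<odot>\<^bsub>M\<^esub> x = act (w \<otimes>\<^bsub>PR\<^esub> z) v" using act_mult[OF w(1) z(1) v(1)] w z by (simp add: act_def)
      then show "a \<odot>\<^bsub>M\<^esub> x \<in> ?N" using K.P.m_closed[OF w(1) z(1)] by blast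
    }
  qed
  moreover have "v \<in> ?N" using act_one[OF v(1)] K.P.one_closed by force
  ultimately have "?N = carrier M" using simple v(2) unfolding simple_left_module_def by blast
  then show ?thesis using im by simp
qed

end

theorem mainTheorem4:
  fixes D :: "('x::ab_group_add, 'y::ab_group_add) root_data"
    and t :: "'x hecke_table"
    and \<phi> :: "'x laurent \<Rightarrow> 'k::alg_closed_field"
    and M :: "(('x hecke_elt \<times> 'k \<Rightarrow>\<^sub>0 int) set, 'm) module"
  assumes "reduced_based_root_datum D"
    and "is_hecke_table D t"
    and "\<phi> \<in> ring_hom (ring_of_type_algebra\<lparr>carrier := weight_ring D\<rparr>) ring_of_type_algebra"
    and "simple_left_module (hecke_specialized D t \<phi>) M"
    and "finite_dimensional D t \<phi> M"
  shows "\<exists>\<chi>\<in>characters_extending D t \<phi>.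
           is_quotient_of (hecke_specialized D t \<phi>) M (standard_module D t \<chi>)"
proof -
  interpret hecke_module D t \<phi> M by unfold_locales (fact assms)+
  obtain v where v: "v \<in> carrier M" "v \<noteq> \<zero>\<^bsub>M\<^esub>" "\<forall>b\<in>AH. \<exists>c. hc b v = sc c v"
    using AH_eigenvector by blast
  then obtain \<chi> where \<chi>: "\<And>b. b \<in> AH \<Longrightarrow> hc b v = sc (\<chi> b) v" by metis
  have "\<phi> 1 = 1" using assms(3) by (simp add: ring_hom_def ring_of_type_algebra_def)
  interpret weight_vector D t \<phi> M v \<chi> by unfold_locales (fact v(1) v(2) \<chi> \<open>\<phi> 1 = 1\<close>)+
  show ?thesis
    using chi_character ev_hom ev_surj unfolding is_quotient_of_def by blast
qed

end
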